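(* Let $\gamma:I\to M$ be a unit speed curve in a spacelike hypersurface $M\subset\mathbb{R}^4_1$ such that $k_g(s)\neq0$, $(k_n\tau_2+k_g\tau_g)(s)\neq0$ and $k_n^2(s)>k_g^2(s)$ for any $s\in I$, and suppose $\rho\not\equiv0$. Let $s_0\in I$, $\theta_0$ be a parameter value, $v_0=DS_\gamma(s_0,\theta_0)$ and $c=\langle\gamma(s_0),v_0\rangle$. Then: (1) $\gamma$ and the timelike slice surface $M\cap HP(v_0,c)$ have contact of at least order $3$ at $s_0$ if and only if $(h^S_t)_{v_0}$ has an $A_k$-singularity at $s_0$ for some $k\ge2$. Furthermore, if $\gamma$ and $M\cap HP(v_0,c)$ have contact of order exactly $3$ at $s_0$, then the de Sitter curve $DC_\gamma$ of $\gamma$ is, at $s_0$, locally diffeomorphic to a line. (2) $\gamma$ and the timelike slice surface $M\cap HP(v_0,c)$ have contact of order $4$ at $s_0$ if and only if $(h^S_t)_{v_0}$ has an $A_3$-singularity at $s_0$. In this case, if $\lambda_0(s_0)\neq0$, then the de Sitter curve $DC_\gamma$ of $\gamma$ is, at $s_0$, locally diffeomorphic to the $(2,3,4)$-cusp $C(2,3,4)=\{(u^2,u^3,u^4)\mid u\in\mathbb{R}\}$.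
   Context: $\mathbb{R}^4_1$ is $\mathbb{R}^4$ with $\langle x,y\rangle=-x_0y_0+x_1y_1+x_2y_2+x_3y_3$; a nonzero vector $x$ is spacelike, lightlike or timelike if $\langle x,x\rangle$ is $>0$, $=0$ or $<0$; $\|x\|=\sqrt{|\langle x,x\rangle|}$. With $\{e_0,e_1,e_2,e_3\}$ the canonical basis, $x\wedge y\wedge z$ is the formal determinant with rows $(-e_0,e_1,e_2,e_3),x,y,z$. For $v\ne0$ and $c\in\mathbb{R}$, $HP(v,c)=\{x\in\mathbb{R}^4_1\mid\langle x,v\rangle=c\}$; $M\cap HP(v,c)$ is a timelike slice surface if $v$ is spacelike. $S^3_1=\{x\in\mathbb{R}^4_1\mid\langle x,x\rangle=1\}$. $U\subset\mathbb{R}^3$ is open, $X:U\to\mathbb{R}^4_1$ is a smooth embedding all of whose nonzero tangent vectors are spacelike, $M=X(U)$ (a spacelike hypersurface), and $n$ is the unit timelike normal field along $M$ which is future directed ($\langle n,e_0\rangle<0$). $I$ is an open interval and $\gamma=X\circ\bar\gamma:I\to M$, with $\bar\gamma:I\to U$ a smooth regular curve, is parametrized by arc length ("unit speed"). Put $t=\gamma'$, $n_\gamma(s)=n(\gamma(s))$, $k_n=-\langle n_\gamma,t'\rangle$, $k_g=\|t'-k_nn_\gamma\|$ and, when $k_g\ne0$ (so $k_g>0$), $n_1=(t'-k_nn_\gamma)/k_g$, $n_2=n_\gamma\wedge t\wedge n_1$, $\tau_1=\langle n_1,n_\gamma'\rangle$, $\tau_2=\langle n_2,n_\gamma'\rangle$,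 $\tau_g=-\langle n_2',n_1\rangle$. Then $\{n_\gamma,t,n_1,n_2\}$ is a pseudo-orthonormal frame along $\gamma$ with $n_\gamma'=k_nt+\tau_1n_1+\tau_2n_2$, $t'=k_nn_\gamma+k_gn_1$, $n_1'=\tau_1n_\gamma-k_gt+\tau_gn_2$, $n_2'=\tau_2n_\gamma-\tau_gn_1$. The de Sitter surface of $\gamma$ is (with $\theta$ read modulo $2\pi$) $$DS_\gamma(s,\theta)=\frac{\cos\theta}{\sqrt{k_n^2(s)-k_g^2(s)}}\bigl(k_g(s)n_\gamma(s)+k_n(s)n_1(s)\bigr)+\sin\theta\,n_2(s)\in S^3_1.$$ Put $\lambda_0=k_gk_n'+k_g^2\tau_1-k_n^2\tau_1-k_nk_g'$. The de Sitter curve of $\gamma$ is $DC_\gamma(s)=DS_\gamma(s,\theta(s))$, where $\theta(s)$ is a smooth function with $\tan\theta(s)=\dfrac{\lambda_0}{(k_n\tau_2+k_g\tau_g)\sqrt{k_n^2-k_g^2}}(s)$. For $v\in S^3_1$, $(h^S_t)_v(s)=\langle t(s),v\rangle$. The invariant $\rho$ is $$\begin{aligned}\rho=\;&(-k_gk_n''-k_gk_n\tau_2^2-2k_gk_g'\tau_1-k_g^2\tau_1'-k_g^2\tau_g\tau_2+2k_nk_n'\tau_1+k_n^2\tau_1'-k_n^2\tau_g\tau_2+k_g''k_n-k_gk_n\tau_g^2)(k_n\tau_2+k_g\tau_g)\\&+(k_gk_n'+k_g^2\tau_1-k_n^2\tau_1-k_nk_g')(2k_n'\tau_2+k_n\tau_1\tau_g+k_n\tau_2'+2k_g'\tau_g+k_g\tau_1\tau_2+k_g\tau_g').\end{aligned}$$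 A function $f$ has an $A_k$-singularity at $s_0$ if $f(s_0)=f'(s_0)=\dots=f^{(k)}(s_0)=0$ and $f^{(k+1)}(s_0)\neq0$. $\gamma$ and $M\cap HP(v_0,c)$ have contact of order $k$ at $s_0$ if $g(s)=\langle\gamma(s),v_0\rangle-c$ has an $A_k$-singularity at $s_0$; contact of at least order $3$ means contact of order $k$ for some $k\ge3$. $DC_\gamma$ is at $s_0$ locally diffeomorphic to a set $Z\subset\mathbb{R}^3$ (a line through $0$, or $C(2,3,4)$) if some local diffeomorphism from a neighbourhood of $DC_\gamma(s_0)$ in $S^3_1$ to a neighbourhood of $0$ in $\mathbb{R}^3$ carries the germ of the image of $DC_\gamma$ near $s_0$ to the germ of $Z$ at $0$. *)

theory Defs
  imports "HOL-Analysis.Analysis"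
begin

text \<open>For open \<open>S\<close>: \<open>f\<close> is of class \<open>C\<^sup>k\<close> on \<open>S\<close>, by
  recursion through the directional derivatives.\<close>

primrec Ck_on :: "nat \<Rightarrow> ('a::euclidean_space \<Rightarrow> 'b::euclidean_space) \<Rightarrow> 'a set \<Rightarrow> bool" where
  "Ck_on 0 f S \<longleftrightarrow> continuous_on S f"
| "Ck_on (Suc k) f S \<longleftrightarrow>
     f differentiable_on S \<and> (\<forall>w. Ck_on k (\<lambda>x. frechet_derivative f (at x) w) S)"

definition smooth_on :: "('a::euclidean_space \<Rightarrow> 'b::euclidean_space) \<Rightarrow> 'a set \<Rightarrow> bool" where
  "smooth_on f S \<longleftrightarrow> (\<forall>k. Ck_on k f S)"

text \<open>Smoothness on an arbitrary subset of Euclidean space: local existence of smooth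
  extensions. On an open set it agrees with \<open>smooth_on\<close>, and on an embedded submanifold
  (such as \<open>S\<^sup>3\<^sub>1\<close> in \<open>\<real>\<^sup>4\<close>) with smoothness for the manifold structure.\<close>

definition smooth_map_on :: "('a::euclidean_space \<Rightarrow> 'b::euclidean_space) \<Rightarrow> 'a set \<Rightarrow> bool" where
  "smooth_map_on f A \<longleftrightarrow>
     (\<forall>x\<in>A. \<exists>W g. open W \<and> x \<in> W \<and> smooth_on g W \<and> (\<forall>y\<in>A \<inter> W. g y = f y))"

definition diffeomorphism ::
  "'a::euclidean_space set \<Rightarrow> 'b::euclidean_space set \<Rightarrow> ('a \<Rightarrow> 'b) \<Rightarrow> ('b \<Rightarrow> 'a) \<Rightarrow> bool" where
  "diffeomorphism W V \<phi> \<psi> \<longleftrightarrow>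
     homeomorphism W V \<phi> \<psi> \<and> smooth_map_on \<phi> W \<and> smooth_map_on \<psi> V"

definition same_germ :: "'a::topological_space \<Rightarrow> 'a set \<Rightarrow> 'a set \<Rightarrow> bool" where
  "same_germ p A B \<longleftrightarrow> (\<exists>N. open N \<and> p \<in> N \<and> A \<inter> N = B \<inter> N)"

text \<open>\<open>\<real>\<^sup>4\<^sub>1\<close> is \<open>real^4\<close> with coordinates \<open>x $ 0, x $ 1, x $ 2, x $ 3\<close>; in the index type
  \<open>4\<close> the element \<open>0\<close> (equal to \<open>4\<close>) is the time index.\<close>

definition mink :: "real^4 \<Rightarrow> real^4 \<Rightarrow> real" where
  "mink x y = - (x$0 * y$0) + x$1 * y$1 + x$2 * y$2 + x$3 * y$3"

definition mink_norm :: "real^4 \<Rightarrow> real" where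
  "mink_norm x = sqrt \<bar>mink x x\<bar>"

definition spacelike :: "real^4 \<Rightarrow> bool" where
  "spacelike x \<longleftrightarrow> mink x x > 0"

definition de_Sitter_space :: "(real^4) set" where
  "de_Sitter_space = {x. mink x x = 1}"

text \<open>Component \<open>i\<close> of the formal determinant with first row \<open>(-e\<^sub>0, e\<^sub>1, e\<^sub>2, e\<^sub>3)\<close> is
  obtained by replacing that row with its \<open>i\<close>-th coordinates. The rows are listed explicitly
  in the order \<open>0, 1, 2, 3\<close> of the columns: \<open>vector\<close> would place the first row at
  index \<open>1\<close> and the last one at index \<open>0\<close>, which changes the sign.\<close>

definition wedge :: "real^4 \<Rightarrow> real^4 \<Rightarrow> real^4 \<Rightarrow> real^4" where
  "wedge x y z = (\<chi> i. det (\<chi> r.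
     if r = 0 then axis i (if i = 0 then -1 else 1)
     else if r = 1 then x else if r = 2 then y else z))"

definition smooth_embedding :: "(real^3) set \<Rightarrow> (real^3 \<Rightarrow> real^4) \<Rightarrow> bool" where
  "smooth_embedding U X \<longleftrightarrow>
     open U \<and> smooth_on X U \<and> (\<forall>u\<in>U. inj (frechet_derivative X (at u))) \<and>
     (\<exists>Y. homeomorphism U (X ` U) X Y)"

definition spacelike_hypersurface :: "(real^3) set \<Rightarrow> (real^3 \<Rightarrow> real^4) \<Rightarrow> bool" where
  "spacelike_hypersurface U X \<longleftrightarrow> smooth_embedding U X \<and>
     (\<forall>u\<in>U. \<forall>w. frechet_derivative X (at u) w \<noteq> 0 \<longrightarrow> spacelike (frechet_derivative X (at u) w))"

text \<open>These conditions determine \<open>n\<close> on \<open>X ` U\<close>; its smoothness along \<open>X\<close> follows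
  from them.\<close>

definition future_unit_normal ::
  "(real^3) set \<Rightarrow> (real^3 \<Rightarrow> real^4) \<Rightarrow> (real^4 \<Rightarrow> real^4) \<Rightarrow> bool" where
  "future_unit_normal U X n \<longleftrightarrow> (\<forall>u\<in>U.
     mink (n (X u)) (n (X u)) = -1 \<and>
     (\<forall>w. mink (n (X u)) (frechet_derivative X (at u) w) = 0) \<and>
     mink (n (X u)) (axis 0 1) < 0)"

text \<open>Below, \<open>n\<close> is the normal field of the hypersurface and \<open>\<gamma>\<close> the unit speed curve.\<close>

definition tangent :: "(real \<Rightarrow> real^4) \<Rightarrow> real \<Rightarrow> real^4" where
  "tangent \<gamma> s = vector_derivative \<gamma> (at s)"

definition nrm :: "(real^4 \<Rightarrow> real^4) \<Rightarrow> (real \<Rightarrow> real^4) \<Rightarrow> real \<Rightarrow> real^4" where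
  "nrm n \<gamma> s = n (\<gamma> s)"

definition k_n :: "(real^4 \<Rightarrow> real^4) \<Rightarrow> (real \<Rightarrow> real^4) \<Rightarrow> real \<Rightarrow> real" where
  "k_n n \<gamma> s = - mink (nrm n \<gamma> s) (vector_derivative (tangent \<gamma>) (at s))"

definition k_g :: "(real^4 \<Rightarrow> real^4) \<Rightarrow> (real \<Rightarrow> real^4) \<Rightarrow> real \<Rightarrow> real" where
  "k_g n \<gamma> s = mink_norm (vector_derivative (tangent \<gamma>) (at s) - k_n n \<gamma> s *\<^sub>R nrm n \<gamma> s)"

definition n1 :: "(real^4 \<Rightarrow> real^4) \<Rightarrow> (real \<Rightarrow> real^4) \<Rightarrow> real \<Rightarrow> real^4" where
  "n1 n \<gamma> s = (vector_derivative (tangent \<gamma>) (at s) - k_n n \<gamma> s *\<^sub>R nrm n \<gamma> s) /\<^sub>R k_g n \<gamma> s"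

definition n2 :: "(real^4 \<Rightarrow> real^4) \<Rightarrow> (real \<Rightarrow> real^4) \<Rightarrow> real \<Rightarrow> real^4" where
  "n2 n \<gamma> s = wedge (nrm n \<gamma> s) (tangent \<gamma> s) (n1 n \<gamma> s)"

definition tau_1 :: "(real^4 \<Rightarrow> real^4) \<Rightarrow> (real \<Rightarrow> real^4) \<Rightarrow> real \<Rightarrow> real" where
  "tau_1 n \<gamma> s = mink (n1 n \<gamma> s) (vector_derivative (nrm n \<gamma>) (at s))"

definition tau_2 :: "(real^4 \<Rightarrow> real^4) \<Rightarrow> (real \<Rightarrow> real^4) \<Rightarrow> real \<Rightarrow> real" where
  "tau_2 n \<gamma> s = mink (n2 n \<gamma> s) (vector_derivative (nrm n \<gamma>) (at s))"

definition tau_g :: "(real^4 \<Rightarrow> real^4) \<Rightarrow> (real \<Rightarrow> real^4) \<Rightarrow> real \<Rightarrow> real" where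
  "tau_g n \<gamma> s = - mink (vector_derivative (n2 n \<gamma>) (at s)) (n1 n \<gamma> s)"

definition lambda_0 :: "(real^4 \<Rightarrow> real^4) \<Rightarrow> (real \<Rightarrow> real^4) \<Rightarrow> real \<Rightarrow> real" where
  "lambda_0 n \<gamma> s =
     k_g n \<gamma> s * deriv (k_n n \<gamma>) s + (k_g n \<gamma> s)\<^sup>2 * tau_1 n \<gamma> s
     - (k_n n \<gamma> s)\<^sup>2 * tau_1 n \<gamma> s - k_n n \<gamma> s * deriv (k_g n \<gamma>) s"

definition rho :: "(real^4 \<Rightarrow> real^4) \<Rightarrow> (real \<Rightarrow> real^4) \<Rightarrow> real \<Rightarrow> real" where
  "rho n \<gamma> s =
    (let kn = k_n n \<gamma> s; kn' = deriv (k_n n \<gamma>) s; kn'' = deriv (deriv (k_n n \<gamma>)) s;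
         kg = k_g n \<gamma> s; kg' = deriv (k_g n \<gamma>) s; kg'' = deriv (deriv (k_g n \<gamma>)) s;
         t1 = tau_1 n \<gamma> s; t1' = deriv (tau_1 n \<gamma>) s;
         t2 = tau_2 n \<gamma> s; t2' = deriv (tau_2 n \<gamma>) s;
         tg = tau_g n \<gamma> s; tg' = deriv (tau_g n \<gamma>) s
     in (- kg * kn'' - kg * kn * t2\<^sup>2 - 2 * kg * kg' * t1 - kg\<^sup>2 * t1' - kg\<^sup>2 * tg * t2
           + 2 * kn * kn' * t1 + kn\<^sup>2 * t1' - kn\<^sup>2 * tg * t2 + kg'' * kn - kg * kn * tg\<^sup>2)
          * (kn * t2 + kg * tg)
        + (kg * kn' + kg\<^sup>2 * t1 - kn\<^sup>2 * t1 - kn * kg')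
          * (2 * kn' * t2 + kn * t1 * tg + kn * t2' + 2 * kg' * tg + kg * t1 * t2 + kg * tg'))"

definition DS :: "(real^4 \<Rightarrow> real^4) \<Rightarrow> (real \<Rightarrow> real^4) \<Rightarrow> real \<Rightarrow> real \<Rightarrow> real^4" where
  "DS n \<gamma> s \<theta> =
     (cos \<theta> / sqrt ((k_n n \<gamma> s)\<^sup>2 - (k_g n \<gamma> s)\<^sup>2)) *\<^sub>R
       (k_g n \<gamma> s *\<^sub>R nrm n \<gamma> s + k_n n \<gamma> s *\<^sub>R n1 n \<gamma> s)
     + sin \<theta> *\<^sub>R n2 n \<gamma> s"

text \<open>The condition \<open>cos (\<theta> s) \<noteq> 0\<close> says that \<open>tan (\<theta> s)\<close> is defined; in HOL the tangent
  is \<open>0\<close> at the zeros of the cosine.\<close>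

definition de_Sitter_angle ::
  "(real^4 \<Rightarrow> real^4) \<Rightarrow> (real \<Rightarrow> real^4) \<Rightarrow> real set \<Rightarrow> (real \<Rightarrow> real) \<Rightarrow> bool" where
  "de_Sitter_angle n \<gamma> I \<theta> \<longleftrightarrow> smooth_on \<theta> I \<and>
     (\<forall>s\<in>I. cos (\<theta> s) \<noteq> 0 \<and>
        tan (\<theta> s) = lambda_0 n \<gamma> s /
          ((k_n n \<gamma> s * tau_2 n \<gamma> s + k_g n \<gamma> s * tau_g n \<gamma> s)
           * sqrt ((k_n n \<gamma> s)\<^sup>2 - (k_g n \<gamma> s)\<^sup>2)))"

definition DC ::
  "(real^4 \<Rightarrow> real^4) \<Rightarrow> (real \<Rightarrow> real^4) \<Rightarrow> (real \<Rightarrow> real) \<Rightarrow> real \<Rightarrow> real^4" where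
  "DC n \<gamma> \<theta> s = DS n \<gamma> s (\<theta> s)"

definition h_t :: "(real \<Rightarrow> real^4) \<Rightarrow> real^4 \<Rightarrow> real \<Rightarrow> real" where
  "h_t \<gamma> v s = mink (tangent \<gamma> s) v"

definition A_singularity :: "nat \<Rightarrow> (real \<Rightarrow> real) \<Rightarrow> real \<Rightarrow> bool" where
  "A_singularity k f s \<longleftrightarrow>
     (\<forall>i\<le>k. (deriv ^^ i) f s = 0) \<and> (deriv ^^ Suc k) f s \<noteq> 0"

text \<open>Contact of order \<open>k\<close> at \<open>s\<close> of a curve \<open>\<gamma>\<close> in \<open>M\<close> with
  \<open>M \<inter> {x. mink x v = c}\<close>. As \<open>\<gamma>\<close> lies in \<open>M\<close>, only the restriction to \<open>\<gamma>\<close> of the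
  function defining the hyperplane enters.\<close>

definition contact_of_order :: "nat \<Rightarrow> (real \<Rightarrow> real^4) \<Rightarrow> real^4 \<Rightarrow> real \<Rightarrow> real \<Rightarrow> bool" where
  "contact_of_order k \<gamma> v c s \<longleftrightarrow> A_singularity k (\<lambda>s. mink (\<gamma> s) v - c) s"

text \<open>The germ at \<open>D s\<^sub>0\<close> of the image of \<open>D\<close> near \<open>s\<^sub>0\<close> is the germ of
  \<open>D ` {s\<^sub>0-\<epsilon><..<s\<^sub>0+\<epsilon>}\<close> for all sufficiently small \<open>\<epsilon> > 0\<close>.\<close>

definition locally_diffeomorphic_at ::
  "(real \<Rightarrow> real^4) \<Rightarrow> real \<Rightarrow> (real^3) set \<Rightarrow> bool" where
  "locally_diffeomorphic_at D s0 Z \<longleftrightarrow> (\<exists>W V \<phi> \<psi>.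
     openin (top_of_set de_Sitter_space) W \<and> D s0 \<in> W \<and> open V \<and> 0 \<in> V \<and>
     diffeomorphism W V \<phi> \<psi> \<and> \<phi> (D s0) = 0 \<and>
     (\<forall>\<^sub>F \<epsilon> in at_right 0. same_germ 0 (\<phi> ` (D ` {s0-\<epsilon><..<s0+\<epsilon>} \<inter> W)) Z))"

definition cusp_234 :: "(real^3) set" where
  "cusp_234 = {vector [u^2, u^3, u^4] |u. True}"

end

theory Submission
  imports Defs
begin

text \<open>
  Write \<open>t\<close> for the tangent, \<open>\<mu> = k\<^sub>n \<tau>\<^sub>2 + k\<^sub>g \<tau>\<^sub>g\<close> and \<open>\<Delta> = k\<^sub>n\<^sup>2 - k\<^sub>g\<^sup>2\<close>. The equivalences hold because the
  derivative of \<open>\<langle>\<gamma>, v\<^sub>0\<rangle> - c\<close> is \<open>h = \<langle>t, v\<^sub>0\<rangle>\<close>, so that the two orders of vanishing differ by one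
  (\<open>contact_of_order_Suc_iff\<close>).

  For the geometric claims, the frame gives \<open>\<langle>t, DS\<rangle> = \<langle>t', DS\<rangle> = 0\<close> and
  \<open>\<langle>t'', DS(s, \<phi>)\<rangle> = \<mu> sin \<phi> - \<lambda>\<^sub>0 cos \<phi> / \<surd>\<Delta>\<close> (\<open>mink_DS\<close>). The angle of the de Sitter curve \<open>D = DC\<close>
  is a zero of the last expression, so \<open>D(s)\<close> is a unit vector orthogonal to \<open>t, t', t''\<close>, and
  \<open>h''(s\<^sub>0) = 0\<close> forces \<open>v\<^sub>0 = \<plusminus>D(s\<^sub>0)\<close>. Contact of order \<open>3\<close> then means
  \<open>\<langle>D, t'''\<rangle> \<noteq> 0\<close> at \<open>s\<^sub>0\<close>, and contact of order \<open>4\<close> means that this number vanishes while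
  \<open>\<langle>D, t''''\<rangle> \<noteq> 0\<close>. What remains is a statement on dual curves (locale \<open>dual_curve\<close>): differentiating
  \<open>\<langle>D, t\<rangle> = \<langle>D, t'\<rangle> = \<langle>D, t''\<rangle> = 0\<close> repeatedly yields the Taylor coefficients of \<open>D\<close> at \<open>s\<^sub>0\<close> in the
  coordinates \<open>x \<mapsto> (\<langle>x, t\<rangle>, \<langle>x, t'\<rangle>, \<langle>x, t''\<rangle>)\<close>, taken at \<open>s\<^sub>0\<close>, which form a chart of the de Sitter
  space around \<open>D(s\<^sub>0)\<close>.

  In the first case the third coordinate has nonzero derivative, and subtracting from the other two
  their values along the curve straightens it (\<open>regular_curve_germ\<close>). In the second case the three
  coordinates vanish exactly to orders \<open>4, 3, 2\<close>, and such a curve is always a \<open>(2,3,4)\<close>-cusp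
  (\<open>cusp_234_curve_germ\<close>): in a parameter \<open>u\<close> for which the third coordinate is \<open>\<plusminus>u\<^sup>2\<close>, the others
  have the form \<open>u\<^sup>3 A(u\<^sup>2) + u\<^sup>4 B(u\<^sup>2)\<close> and \<open>u\<^sup>4 C(u\<^sup>2) + u\<^sup>5 E(u\<^sup>2)\<close> with smooth \<open>A, B, C, E\<close>, and
  \<open>(x, y, z) \<mapsto> (z C(x) + x y E(x), y A(x) + z B(x), \<plusminus>x)\<close> carries the cusp to the curve. It is linear in
  \<open>(y, z)\<close> with determinant \<open>A C \<noteq> 0\<close> at \<open>x = 0\<close>, so its inverse can be written down. That even functions
  of \<open>u\<close> are smooth functions of \<open>u\<^sup>2\<close> on both sides of \<open>0\<close> is Whitney's theorem, which in turn rests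
  on the theorems of Hadamard and Borel.
\<close>


section \<open>Calculus of smooth maps\<close>

lemma frechet_derivative_cong_open:
  assumes "open S" "x \<in> S" "\<And>y. y \<in> S \<Longrightarrow> f y = g y"
  shows "frechet_derivative f (at x) = frechet_derivative g (at x)"
proof -
  have "(f has_derivative D) (at x) \<longleftrightarrow> (g has_derivative D) (at x)" for D
    using assms has_derivative_transform_within_open[of f D x UNIV S g]
      has_derivative_transform_within_open[of g D x UNIV S f] by auto
  then show ?thesis by (simp add: frechet_derivative_def)
qed

lemma differentiable_iff_cong_open:
  assumes "open S" "x \<in> S" "\<And>y. y \<in> S \<Longrightarrow> f y = g y"
  shows "f differentiable (at x) \<longleftrightarrow> g differentiable (at x)"
proof -
  have "(f has_derivative D) (at x) \<longleftrightarrow> (g has_derivative D) (at x)" for D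
    using assms has_derivative_transform_within_open[of f D x UNIV S g]
      has_derivative_transform_within_open[of g D x UNIV S f] by auto
  then show ?thesis by (simp add: differentiable_def)
qed

lemma Ck_on_Suc_iff:
  assumes "open S"
  shows "Ck_on (Suc k) f S \<longleftrightarrow>
    (\<forall>x\<in>S. f differentiable (at x)) \<and> (\<forall>w. Ck_on k (\<lambda>x. frechet_derivative f (at x) w) S)"
  by (simp add: differentiable_on_eq_differentiable_at[OF assms])

lemma Ck_on_cong:
  assumes "open S" "\<And>x. x \<in> S \<Longrightarrow> f x = g x"
  shows "Ck_on k f S \<longleftrightarrow> Ck_on k g S"
  using assms(2)
proof (induction k arbitrary: f g)
  case 0
  then show ?case by (simp cong: continuous_on_cong)
next
  case (Suc k)
  have 1: "frechet_derivative f (at x) = frechet_derivative g (at x)" if "x \<in> S" for x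
    using frechet_derivative_cong_open[OF assms(1) that] Suc.prems by auto
  have 2: "f differentiable (at x) \<longleftrightarrow> g differentiable (at x)" if "x \<in> S" for x
    using differentiable_iff_cong_open[OF assms(1) that] Suc.prems by auto
  show ?case
    unfolding Ck_on_Suc_iff[OF assms(1)]
    using 2 Suc.IH[of "\<lambda>x. frechet_derivative f (at x) w" "\<lambda>x. frechet_derivative g (at x) w" for w] 1
    by auto
qed

lemma Ck_on_SucI:
  assumes "open S" "\<And>x. x \<in> S \<Longrightarrow> (f has_derivative f' x) (at x)" "\<And>w. Ck_on k (\<lambda>x. f' x w) S"
  shows "Ck_on (Suc k) f S"
  unfolding Ck_on_Suc_iff[OF assms(1)]
proof (intro conjI ballI allI)
  fix x assume "x \<in> S" then show "f differentiable (at x)"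
    using assms(2) differentiable_def by blast
next
  fix w
  have "frechet_derivative f (at x) w = f' x w" if "x \<in> S" for x
    using frechet_derivative_at[OF assms(2)[OF that]] by simp
  then show "Ck_on k (\<lambda>x. frechet_derivative f (at x) w) S"
    using Ck_on_cong[OF assms(1), of "\<lambda>x. frechet_derivative f (at x) w" "\<lambda>x. f' x w"] assms(3)
    by simp
qed

lemma Ck_on_SucE:
  assumes "Ck_on (Suc k) f S" "open S"
  obtains f' where "\<And>x. x \<in> S \<Longrightarrow> (f has_derivative f' x) (at x)" "\<And>w. Ck_on k (\<lambda>x. f' x w) S"
proof
  show "(f has_derivative frechet_derivative f (at x)) (at x)" if "x \<in> S" for x
    using assms that Ck_on_Suc_iff frechet_derivative_works by blast
  show "Ck_on k (\<lambda>x. frechet_derivative f (at x) w) S" for w using assms by simp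
qed

lemma Ck_on_imp_continuous_on: "Ck_on k f S \<Longrightarrow> open S \<Longrightarrow> continuous_on S f"
  by (cases k) (auto simp: differentiable_imp_continuous_on)

lemma Ck_on_SucD: "Ck_on (Suc k) f S \<Longrightarrow> Ck_on k f S"
proof (induction k arbitrary: f)
  case 0
  then show ?case by (simp add: differentiable_imp_continuous_on)
next
  case (Suc k)
  have "Ck_on k (\<lambda>x. frechet_derivative f (at x) w) S" for w
    using Suc.IH Suc.prems by (metis Ck_on.simps(2))
  then show ?case using Suc.prems by simp
qed

lemma Ck_on_subset: "Ck_on k f S \<Longrightarrow> open S \<Longrightarrow> open T \<Longrightarrow> T \<subseteq> S \<Longrightarrow> Ck_on k f T"
proof (induction k arbitrary: f)
  case 0
  then show ?case by (auto intro: continuous_on_subset)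
next
  case (Suc k)
  have "Ck_on k (\<lambda>x. frechet_derivative f (at x) w) T" for w
    using Suc by simp
  then show ?case using Suc.prems differentiable_on_subset by auto
qed

lemma Ck_on_const: "open S \<Longrightarrow> Ck_on k (\<lambda>x. c) S"
proof (induction k arbitrary: c)
  case (Suc k)
  show ?case by (rule Ck_on_SucI[where f'="\<lambda>x w. 0"]) (use Suc in auto)
qed auto

lemma Ck_on_linear:
  assumes "bounded_linear F" "open S" shows "Ck_on k F S"
proof (cases k)
  case 0 then show ?thesis using assms by (simp add: linear_continuous_on)
next
  case (Suc m)
  show ?thesis unfolding Suc
    by (rule Ck_on_SucI[where f'="\<lambda>x. F"])
      (use assms Ck_on_const bounded_linear_imp_has_derivative in auto)
qed

lemma Ck_on_linear_compose:
  assumes "bounded_linear F" "open S" "Ck_on k f S" shows "Ck_on k (\<lambda>x. F (f x)) S"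
  using assms(3)
proof (induction k arbitrary: f)
  case 0
  then show ?case
    using assms(1) linear_continuous_on continuous_on_compose2 by (metis Ck_on.simps(1) subset_UNIV)
next
  case (Suc k)
  obtain f' where f': "\<And>x. x \<in> S \<Longrightarrow> (f has_derivative f' x) (at x)" "\<And>w. Ck_on k (\<lambda>x. f' x w) S"
    using Ck_on_SucE[OF Suc.prems assms(2)] by blast
  show ?case
    by (rule Ck_on_SucI[where f'="\<lambda>x w. F (f' x w)"])
      (use assms(2) bounded_linear.has_derivative[OF assms(1) f'(1)] Suc.IH[OF f'(2)] in auto)
qed

lemma Ck_on_uminus: "open S \<Longrightarrow> Ck_on k f S \<Longrightarrow> Ck_on k (\<lambda>x. - f x) S"
  by (rule Ck_on_linear_compose[OF bounded_linear_minus[OF bounded_linear_ident]])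

lemma Ck_on_add:
  assumes "open S" "Ck_on k f S" "Ck_on k g S" shows "Ck_on k (\<lambda>x. f x + g x) S"
  using assms(2,3)
proof (induction k arbitrary: f g)
  case 0
  then show ?case by (auto intro: continuous_intros)
next
  case (Suc k)
  obtain f' where f': "\<And>x. x \<in> S \<Longrightarrow> (f has_derivative f' x) (at x)" "\<And>w. Ck_on k (\<lambda>x. f' x w) S"
    using Ck_on_SucE[OF Suc.prems(1) assms(1)] by blast
  obtain g' where g': "\<And>x. x \<in> S \<Longrightarrow> (g has_derivative g' x) (at x)" "\<And>w. Ck_on k (\<lambda>x. g' x w) S"
    using Ck_on_SucE[OF Suc.prems(2) assms(1)] by blast
  show ?case
    by (rule Ck_on_SucI[where f'="\<lambda>x w. f' x w + g' x w"])
      (use assms f' g' Suc.IH in \<open>auto intro: derivative_intros\<close>)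
qed

lemma Ck_on_bilinear:
  assumes "bounded_bilinear B" "open S" "Ck_on k f S" "Ck_on k g S"
  shows "Ck_on k (\<lambda>x. B (f x) (g x)) S"
  using assms(3,4)
proof (induction k arbitrary: f g)
  case 0
  then show ?case using bounded_bilinear.continuous_on[OF assms(1)] by auto
next
  case (Suc k)
  obtain f' where f': "\<And>x. x \<in> S \<Longrightarrow> (f has_derivative f' x) (at x)" "\<And>w. Ck_on k (\<lambda>x. f' x w) S"
    using Ck_on_SucE[OF Suc.prems(1) assms(2)] by blast
  obtain g' where g': "\<And>x. x \<in> S \<Longrightarrow> (g has_derivative g' x) (at x)" "\<And>w. Ck_on k (\<lambda>x. g' x w) S"
    using Ck_on_SucE[OF Suc.prems(2) assms(2)] by blast
  show ?case
  proof (rule Ck_on_SucI[where f'="\<lambda>x w. B (f x) (g' x w) + B (f' x w) (g x)"])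
    show "((\<lambda>x. B (f x) (g x)) has_derivative (\<lambda>w. B (f x) (g' x w) + B (f' x w) (g x))) (at x)"
      if "x \<in> S" for x
      using bounded_bilinear.FDERIV[OF assms(1) f'(1)[OF that] g'(1)[OF that]] .
    show "Ck_on k (\<lambda>x. B (f x) (g' x w) + B (f' x w) (g x)) S" for w
      by (intro Ck_on_add assms(2) Suc.IH f' g' Ck_on_SucD[OF Suc.prems(1)] Ck_on_SucD[OF Suc.prems(2)])
  qed (fact assms(2))
qed

lemma Ck_on_sum:
  assumes "open S" "\<And>i. i \<in> A \<Longrightarrow> Ck_on k (f i) S" shows "Ck_on k (\<lambda>x. \<Sum>i\<in>A. f i x) S"
  using assms(2)
proof (induction A rule: infinite_finite_induct)
  case (insert a A)
  then show ?case using Ck_on_add[OF assms(1)] by auto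
qed (auto intro: Ck_on_const assms)

text \<open>Expanding the inner derivative in the standard basis leaves derivatives of \<open>g\<close> in constant
  directions only, and to these the induction hypothesis applies.\<close>

lemma Ck_on_compose:
  assumes "open S" "open T" "f ` S \<subseteq> T" "Ck_on k g T" "Ck_on k f S"
  shows "Ck_on k (\<lambda>x. g (f x)) S"
  using assms(4,5)
proof (induction k arbitrary: g)
  case 0
  then show ?case using assms(3) by (auto intro: continuous_on_compose2)
next
  case (Suc k)
  obtain f' where f': "\<And>x. x \<in> S \<Longrightarrow> (f has_derivative f' x) (at x)" "\<And>w. Ck_on k (\<lambda>x. f' x w) S"
    using Ck_on_SucE[OF Suc.prems(2) assms(1)] by blast
  obtain g' where g': "\<And>x. x \<in> T \<Longrightarrow> (g has_derivative g' x) (at x)" "\<And>w. Ck_on k (\<lambda>x. g' x w) T"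
    using Ck_on_SucE[OF Suc.prems(1) assms(2)] by blast
  have *: "g' (f x) (f' x w) = (\<Sum>b\<in>Basis. (f' x w \<bullet> b) *\<^sub>R g' (f x) b)" if "x \<in> S" for x w
  proof -
    have l: "linear (g' (f x))" using g'(1)[of "f x"] that assms(3) has_derivative_linear by blast
    have "g' (f x) (f' x w) = g' (f x) (\<Sum>b\<in>Basis. (f' x w \<bullet> b) *\<^sub>R b)"
      by (simp add: euclidean_representation)
    also have "\<dots> = (\<Sum>b\<in>Basis. (f' x w \<bullet> b) *\<^sub>R g' (f x) b)"
      using l by (simp add: linear_sum linear_scale)
    finally show ?thesis .
  qed
  show ?case
  proof (rule Ck_on_SucI[where f'="\<lambda>x w. g' (f x) (f' x w)"])
    show "((\<lambda>x. g (f x)) has_derivative (\<lambda>w. g' (f x) (f' x w))) (at x)" if "x \<in> S" for x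
      using has_derivative_compose[OF f'(1)[OF that] g'(1)[of "f x"]] that assms(3) by auto
    have "Ck_on k (\<lambda>x. \<Sum>b\<in>Basis. (f' x w \<bullet> b) *\<^sub>R g' (f x) b) S" for w
      by (intro Ck_on_sum assms(1) Ck_on_bilinear[OF bounded_bilinear_scaleR]
          Suc.IH g' Ck_on_SucD[OF Suc.prems(2)]
          Ck_on_linear_compose[OF bounded_linear_inner_left] f')
    then show "Ck_on k (\<lambda>x. g' (f x) (f' x w)) S" for w
      using Ck_on_cong[OF assms(1), of "\<lambda>x. g' (f x) (f' x w)"] * by auto
  qed (fact assms(1))
qed

lemma smooth_on_cong: "open S \<Longrightarrow> (\<And>x. x \<in> S \<Longrightarrow> f x = g x) \<Longrightarrow> smooth_on f S \<longleftrightarrow> smooth_on g S"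
  unfolding smooth_on_def using Ck_on_cong by blast

lemma smooth_on_imp_continuous_on: "smooth_on f S \<Longrightarrow> open S \<Longrightarrow> continuous_on S f"
  unfolding smooth_on_def using Ck_on_imp_continuous_on by blast

lemma smooth_on_subset: "smooth_on f S \<Longrightarrow> open S \<Longrightarrow> open T \<Longrightarrow> T \<subseteq> S \<Longrightarrow> smooth_on f T"
  unfolding smooth_on_def using Ck_on_subset by blast

lemma smooth_on_const: "open S \<Longrightarrow> smooth_on (\<lambda>x. c) S"
  unfolding smooth_on_def using Ck_on_const by blast

lemma smooth_on_linear: "open S \<Longrightarrow> bounded_linear F \<Longrightarrow> smooth_on F S"
  unfolding smooth_on_def using Ck_on_linear by blast

lemma smooth_on_id: "open S \<Longrightarrow> smooth_on (\<lambda>x. x) S"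
  by (intro smooth_on_linear bounded_linear_ident)

lemma smooth_on_linear_compose:
  "open S \<Longrightarrow> bounded_linear F \<Longrightarrow> smooth_on f S \<Longrightarrow> smooth_on (\<lambda>x. F (f x)) S"
  unfolding smooth_on_def using Ck_on_linear_compose by blast

lemma smooth_on_add:
  "open S \<Longrightarrow> smooth_on f S \<Longrightarrow> smooth_on g S \<Longrightarrow> smooth_on (\<lambda>x. f x + g x) S"
  unfolding smooth_on_def using Ck_on_add by blast

lemma smooth_on_bilinear:
  "open S \<Longrightarrow> bounded_bilinear B \<Longrightarrow> smooth_on f S \<Longrightarrow> smooth_on g S \<Longrightarrow> smooth_on (\<lambda>x. B (f x) (g x)) S"
  unfolding smooth_on_def using Ck_on_bilinear by blast

lemma smooth_on_mult:
  fixes f g :: "'a::euclidean_space \<Rightarrow> real"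
  shows "open S \<Longrightarrow> smooth_on f S \<Longrightarrow> smooth_on g S \<Longrightarrow> smooth_on (\<lambda>x. f x * g x) S"
  by (rule smooth_on_bilinear[OF _ bounded_bilinear_mult])

lemma smooth_on_scaleR:
  "open S \<Longrightarrow> smooth_on f S \<Longrightarrow> smooth_on g S \<Longrightarrow> smooth_on (\<lambda>x. f x *\<^sub>R g x) S"
  by (rule smooth_on_bilinear[OF _ bounded_bilinear_scaleR])

lemma smooth_on_uminus: "open S \<Longrightarrow> smooth_on f S \<Longrightarrow> smooth_on (\<lambda>x. - f x) S"
  unfolding smooth_on_def using Ck_on_uminus by blast

lemma smooth_on_diff:
  "open S \<Longrightarrow> smooth_on f S \<Longrightarrow> smooth_on g S \<Longrightarrow> smooth_on (\<lambda>x. f x - g x) S"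
  using smooth_on_add[of S f "\<lambda>x. - g x"] smooth_on_uminus by auto

lemma smooth_on_power:
  fixes f :: "'a::euclidean_space \<Rightarrow> real"
  shows "open S \<Longrightarrow> smooth_on f S \<Longrightarrow> smooth_on (\<lambda>x. f x ^ n) S"
  by (induction n) (auto intro: smooth_on_const smooth_on_mult)

lemma smooth_on_sum:
  "open S \<Longrightarrow> (\<And>i. i \<in> A \<Longrightarrow> smooth_on (f i) S) \<Longrightarrow> smooth_on (\<lambda>x. \<Sum>i\<in>A. f i x) S"
  by (auto simp: smooth_on_def intro!: Ck_on_sum)

lemma smooth_on_prod:
  fixes f :: "'i \<Rightarrow> 'a::euclidean_space \<Rightarrow> real"
  assumes "open S" "\<And>i. i \<in> A \<Longrightarrow> smooth_on (f i) S" shows "smooth_on (\<lambda>x. \<Prod>i\<in>A. f i x) S"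
  using assms(2)
proof (induction A rule: infinite_finite_induct)
  case (insert a A)
  then show ?case using smooth_on_mult[OF assms(1)] by auto
qed (auto intro: smooth_on_const assms)

lemma smooth_on_compose:
  "open S \<Longrightarrow> open T \<Longrightarrow> f ` S \<subseteq> T \<Longrightarrow> smooth_on g T \<Longrightarrow> smooth_on f S \<Longrightarrow> smooth_on (\<lambda>x. g (f x)) S"
  unfolding smooth_on_def using Ck_on_compose by blast

lemma smooth_on_vec_nth: "open S \<Longrightarrow> smooth_on f S \<Longrightarrow> smooth_on (\<lambda>x. f x $ i) S"
  by (rule smooth_on_linear_compose[OF _ bounded_linear_vec_nth])

lemma smooth_on_vec_lambda:
  fixes f :: "'n::finite \<Rightarrow> 'a::euclidean_space \<Rightarrow> real"
  assumes "open S" "\<And>i. smooth_on (f i) S" shows "smooth_on (\<lambda>x. \<chi> i. f i x) S"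
proof -
  have "(\<lambda>x. \<chi> i. f i x) = (\<lambda>x. \<Sum>i\<in>UNIV. f i x *\<^sub>R axis i 1)"
    using basis_expansion[of "\<chi> i. f i x" for x] by (simp add: scalar_mult_eq_scaleR)
  moreover have "smooth_on (\<lambda>x. \<Sum>i\<in>UNIV. f i x *\<^sub>R (axis i 1 :: real^'n)) S"
    by (intro smooth_on_sum smooth_on_scaleR smooth_on_const assms)
  ultimately show ?thesis by simp
qed

lemma smooth_on_det:
  fixes A :: "'a::euclidean_space \<Rightarrow> real^'n^'n"
  assumes "open S" "\<And>i j. smooth_on (\<lambda>x. A x $ i $ j) S" shows "smooth_on (\<lambda>x. det (A x)) S"
  unfolding det_def by (intro smooth_on_sum smooth_on_mult smooth_on_prod smooth_on_const assms)

lemma Ck_on_SucI_real: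
  fixes f :: "real \<Rightarrow> real"
  assumes "open S" "\<And>x. x \<in> S \<Longrightarrow> (f has_real_derivative f' x) (at x)" "Ck_on k f' S"
  shows "Ck_on (Suc k) f S"
proof (rule Ck_on_SucI[where f'="\<lambda>x w. f' x * w"])
  show "Ck_on k (\<lambda>x. f' x * w) S" for w
    using Ck_on_linear_compose[OF bounded_linear_mult_left assms(1,3)] .
qed (use assms in \<open>auto simp: has_field_derivative_def\<close>)

text \<open>This avoids the recursion on the order when all derivatives are given explicitly.\<close>

lemma smooth_on_derivative_sequence:
  fixes G :: "nat \<Rightarrow> real \<Rightarrow> real"
  assumes "open S" "\<And>j x. x \<in> S \<Longrightarrow> (G j has_real_derivative G (Suc j) x) (at x)"
  shows "smooth_on (G j) S"
proof -
  have "\<forall>j. Ck_on k (G j) S" for k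
  proof (induction k)
    case 0
    show ?case using DERIV_isCont[OF assms(2)] by (auto intro!: continuous_at_imp_continuous_on)
  next
    case (Suc k)
    then show ?case using Ck_on_SucI_real[OF assms(1)] assms(2) by blast
  qed
  then show ?thesis unfolding smooth_on_def by blast
qed

lemma smooth_on_inverse_real: "smooth_on (inverse :: real \<Rightarrow> real) (- {0})"
  unfolding smooth_on_def
proof
  fix k show "Ck_on k (inverse :: real \<Rightarrow> real) (- {0})"
  proof (induction k)
    case 0 show ?case by (auto intro!: continuous_intros)
  next
    case (Suc k)
    have "Ck_on k (\<lambda>x::real. inverse x * inverse x) (- {0})"
      using Ck_on_bilinear[OF bounded_bilinear_mult _ Suc Suc] by auto
    then have "Ck_on k (\<lambda>x::real. - (inverse x * inverse x)) (- {0})"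
      by (intro Ck_on_uminus) auto
    then show ?case
      by (rule Ck_on_SucI_real[rotated 2]) (auto intro!: derivative_eq_intros simp: power2_eq_square)
  qed
qed

lemma smooth_on_inverse:
  fixes f :: "'a::euclidean_space \<Rightarrow> real"
  assumes "open S" "smooth_on f S" "\<And>x. x \<in> S \<Longrightarrow> f x \<noteq> 0"
  shows "smooth_on (\<lambda>x. inverse (f x)) S"
  by (rule smooth_on_compose[OF assms(1) _ _ smooth_on_inverse_real assms(2)]) (use assms in auto)

lemma smooth_on_divide:
  fixes f g :: "'a::euclidean_space \<Rightarrow> real"
  assumes "open S" "smooth_on f S" "smooth_on g S" "\<And>x. x \<in> S \<Longrightarrow> g x \<noteq> 0"
  shows "smooth_on (\<lambda>x. f x / g x) S"
  unfolding divide_inverse by (intro smooth_on_mult smooth_on_inverse assms)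

lemma smooth_on_sqrt_real: "smooth_on sqrt {0<..}"
  unfolding smooth_on_def
proof
  fix k show "Ck_on k sqrt {0<..}"
  proof (induction k)
    case 0 show ?case by (auto intro!: continuous_intros)
  next
    case (Suc k)
    have i: "Ck_on k (inverse :: real \<Rightarrow> real) (- {0})"
      using smooth_on_inverse_real smooth_on_def by blast
    have "Ck_on k (\<lambda>x::real. inverse (sqrt x)) {0<..}"
      by (rule Ck_on_compose[OF _ _ _ i Suc]) auto
    then have "Ck_on k (\<lambda>x::real. inverse (sqrt x) * (1/2)) {0<..}"
      by (intro Ck_on_linear_compose[OF bounded_linear_mult_left]) auto
    then show ?case
      by (rule Ck_on_SucI_real[rotated 2]) (auto intro!: derivative_eq_intros)
  qed
qed

lemma smooth_on_sqrt:
  fixes f :: "'a::euclidean_space \<Rightarrow> real"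
  assumes "open S" "smooth_on f S" "\<And>x. x \<in> S \<Longrightarrow> f x > 0"
  shows "smooth_on (\<lambda>x. sqrt (f x)) S"
  by (rule smooth_on_compose[OF assms(1) _ _ smooth_on_sqrt_real assms(2)]) (use assms in auto)

lemma smooth_on_sin_cos_real: "smooth_on (sin :: real \<Rightarrow> real) UNIV \<and> smooth_on (cos :: real \<Rightarrow> real) UNIV"
proof -
  have "Ck_on k (sin :: real \<Rightarrow> real) UNIV \<and> Ck_on k (cos :: real \<Rightarrow> real) UNIV" for k
  proof (induction k)
    case 0 show ?case by (auto intro!: continuous_intros)
  next
    case (Suc k)
    then have "Ck_on k (\<lambda>x::real. - sin x) UNIV"
      by (intro Ck_on_uminus) auto
    with Suc show ?case
      using Ck_on_SucI_real[of UNIV sin cos k] Ck_on_SucI_real[of UNIV cos "\<lambda>x. - sin x" k]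
      by (auto intro: DERIV_sin DERIV_cos)
  qed
  then show ?thesis unfolding smooth_on_def by blast
qed

lemma
  fixes f :: "'a::euclidean_space \<Rightarrow> real"
  assumes "open S" "smooth_on f S"
  shows smooth_on_sin: "smooth_on (\<lambda>x. sin (f x)) S" and smooth_on_cos: "smooth_on (\<lambda>x. cos (f x)) S"
  using smooth_on_compose[OF assms(1) open_UNIV subset_UNIV _ assms(2)] smooth_on_sin_cos_real by auto

lemma smooth_on_has_vector_derivative:
  fixes f :: "real \<Rightarrow> 'b::euclidean_space"
  assumes "smooth_on f S" "open S" "x \<in> S"
  shows "(f has_vector_derivative vector_derivative f (at x)) (at x)"
proof -
  have "Ck_on (Suc 0) f S" using assms(1) smooth_on_def by blast
  then have "f differentiable (at x)" using Ck_on_Suc_iff assms by blast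
  then show ?thesis using vector_derivative_works by blast
qed

lemma smooth_on_differentiable:
  assumes "smooth_on f S" "open S" "x \<in> S"
  shows "f differentiable (at x)"
proof -
  have "Ck_on (Suc 0) f S" using assms(1) smooth_on_def by blast
  then show "f differentiable (at x)" using Ck_on_Suc_iff assms by blast
qed

lemma smooth_on_frechet_derivative:
  assumes "smooth_on f S" shows "smooth_on (\<lambda>x. frechet_derivative f (at x) w) S"
  unfolding smooth_on_def
proof
  fix k
  have "Ck_on (Suc k) f S" using assms smooth_on_def by blast
  then show "Ck_on k (\<lambda>x. frechet_derivative f (at x) w) S" by simp
qed

lemma smooth_on_vector_derivative:
  fixes f :: "real \<Rightarrow> 'b::euclidean_space"
  assumes "smooth_on f S" "open S"
  shows "smooth_on (\<lambda>x. vector_derivative f (at x)) S"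
proof -
  have "frechet_derivative f (at x) 1 = vector_derivative f (at x)" if "x \<in> S" for x
    using frechet_derivative_at[OF smooth_on_has_vector_derivative[OF assms that, unfolded has_vector_derivative_def]]
    by (metis scaleR_one)
  then show ?thesis
    using smooth_on_frechet_derivative[OF assms(1), of 1]
      smooth_on_cong[OF assms(2), of "\<lambda>x. frechet_derivative f (at x) 1" "\<lambda>x. vector_derivative f (at x)"]
    by simp
qed

lemma smooth_on_has_real_derivative:
  fixes f :: "real \<Rightarrow> real"
  assumes "smooth_on f S" "open S" "x \<in> S"
  shows "(f has_real_derivative deriv f x) (at x)"
  using smooth_on_has_vector_derivative[OF assms]
  by (metis DERIV_imp_deriv has_real_derivative_iff_has_vector_derivative)

lemma smooth_on_deriv:
  fixes f :: "real \<Rightarrow> real"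
  assumes "smooth_on f S" "open S"
  shows "smooth_on (deriv f) S"
proof -
  have "vector_derivative f (at x) = deriv f x" if "x \<in> S" for x
    using smooth_on_has_vector_derivative[OF assms that] DERIV_imp_deriv
    unfolding has_real_derivative_iff_has_vector_derivative[symmetric] by metis
  then show ?thesis
    using smooth_on_vector_derivative[OF assms]
      smooth_on_cong[OF assms(2), of "\<lambda>x. vector_derivative f (at x)" "deriv f"] by simp
qed

lemma smooth_on_deriv_iterate:
  fixes f :: "real \<Rightarrow> real"
  assumes "smooth_on f S" "open S"
  shows "smooth_on ((deriv ^^ i) f) S"
  by (induction i) (use assms smooth_on_deriv in auto)


section \<open>Hadamard's lemma and the inverse function theorem on the line\<close>

lemma has_real_derivative_moment_integral:
  fixes f :: "real \<Rightarrow> real"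
  assumes "smooth_on f {-d<..<d}" "u \<in> {-d<..<d}"
  shows "((\<lambda>u. integral {0..1} (\<lambda>t. t^m * f (t*u))) has_real_derivative
          integral {0..1} (\<lambda>t. t^Suc m * deriv f (t*u))) (at u)"
proof -
  have in_dom: "t * x \<in> {-d<..<d}" if "x \<in> {-d<..<d}" "t \<in> {0..1}" for x t
  proof -
    have "\<bar>t * x\<bar> \<le> \<bar>x\<bar>" using that by (simp add: abs_mult mult_left_le_one_le)
    then show ?thesis using that by auto
  qed
  have cf: "continuous_on {-d<..<d} f" and cf': "continuous_on {-d<..<d} (deriv f)"
    using smooth_on_imp_continuous_on[OF assms(1)]
      smooth_on_imp_continuous_on[OF smooth_on_deriv[OF assms(1)]] by auto
  have "((\<lambda>u. integral (cbox 0 1) (\<lambda>t. t^m * f (t*u))) has_real_derivative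
          integral (cbox 0 1) (\<lambda>t. t^Suc m * deriv f (t*u))) (at u within {-d<..<d})"
  proof (rule leibniz_rule_field_derivative)
    fix x t assume x: "x \<in> {-d<..<d}" "t \<in> cbox 0 (1::real)"
    then have "(f has_real_derivative deriv f (t*x)) (at (t*x))"
      using smooth_on_has_real_derivative[OF assms(1)] in_dom by auto
    then have "((\<lambda>x. f (t*x)) has_real_derivative deriv f (t*x) * t) (at x)"
      by (rule DERIV_chain2) (auto intro!: derivative_eq_intros)
    then have "((\<lambda>x. t^m * f (t*x)) has_real_derivative t^Suc m * deriv f (t*x)) (at x)"
      by (auto intro!: derivative_eq_intros)
    then show "((\<lambda>x. t^m * f (t*x)) has_real_derivative t^Suc m * deriv f (t*x)) (at x within {-d<..<d})"
      by (rule has_field_derivative_at_within)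
  next
    fix x assume x: "x \<in> {-d<..<d}"
    show "(\<lambda>t. t^m * f (t*x)) integrable_on cbox 0 1"
      by (rule integrable_continuous)
        (use in_dom[OF x] in \<open>auto intro!: continuous_intros continuous_on_compose2[OF cf]\<close>)
  next
    show "continuous_on ({-d<..<d} \<times> cbox 0 1) (\<lambda>(x, t). t^Suc m * deriv f (t*x))"
      unfolding split_beta
      by (intro continuous_intros continuous_on_compose2[OF cf']) (use in_dom in auto)
  qed (use assms in auto)
  then show ?thesis unfolding at_within_open[OF assms(2) open_greaterThanLessThan] by simp
qed

lemma smooth_on_moment_integral:
  fixes f :: "real \<Rightarrow> real"
  assumes "smooth_on f {-d<..<d}"
  shows "smooth_on (\<lambda>u. integral {0..1} (\<lambda>t. t^m * f (t*u))) {-d<..<d}"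
proof -
  define G where "G j = (\<lambda>u. integral {0..1} (\<lambda>t. t^(m+j) * (deriv ^^ j) f (t*u)))" for j
  have "smooth_on (G 0) {-d<..<d}"
  proof (rule smooth_on_derivative_sequence)
    show "(G j has_real_derivative G (Suc j) u) (at u)" if "u \<in> {-d<..<d}" for j u
      unfolding G_def
      using has_real_derivative_moment_integral[OF smooth_on_deriv_iterate[OF assms, of j] that, of "m+j"]
      by simp
  qed simp
  then show ?thesis by (simp add: G_def)
qed

text \<open>The quotient is \<open>\<integral>\<^sub>0\<^sup>1 f'(t u) dt\<close>, which may be differentiated under the integral.\<close>

lemma Hadamard_lemma:
  fixes f :: "real \<Rightarrow> real"
  assumes "smooth_on f {-d<..<d}" "f 0 = 0"
  obtains g where "smooth_on g {-d<..<d}" "\<And>u. u \<in> {-d<..<d} \<Longrightarrow> f u = u * g u"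
proof
  let ?g = "\<lambda>u. integral {0..1} (\<lambda>t. t^0 * deriv f (t*u))"
  show "smooth_on ?g {-d<..<d}"
    by (rule smooth_on_moment_integral) (use assms smooth_on_deriv in auto)
  fix u assume u: "u \<in> {-d<..<d}"
  have "((\<lambda>t. u * deriv f (t*u)) has_integral f (1*u) - f (0*u)) {0..1}"
  proof (rule fundamental_theorem_of_calculus)
    fix t :: real assume t: "t \<in> {0..1}"
    have "\<bar>t * u\<bar> \<le> \<bar>u\<bar>" using t by (simp add: abs_mult mult_left_le_one_le)
    then have "t * u \<in> {-d<..<d}" using u by auto
    then have "(f has_real_derivative deriv f (t*u)) (at (t*u))"
      using smooth_on_has_real_derivative[OF assms(1)] by auto
    then have "((\<lambda>t. f (t*u)) has_real_derivative deriv f (t*u) * u) (at t)"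
      by (rule DERIV_chain2) (auto intro!: derivative_eq_intros)
    then show "((\<lambda>t. f (t*u)) has_vector_derivative u * deriv f (t*u)) (at t within {0..1})"
      by (auto simp: has_real_derivative_iff_has_vector_derivative[symmetric] mult.commute
          intro: has_field_derivative_at_within)
  qed simp
  from integral_unique[OF this] show "f u = u * ?g u" by (simp add: assms(2))
qed

lemma deriv_iterate_cong:
  fixes f g :: "real \<Rightarrow> real"
  assumes "open S" "x \<in> S" "\<And>y. y \<in> S \<Longrightarrow> f y = g y"
  shows "(deriv ^^ i) f x = (deriv ^^ i) g x"
  using assms(2)
proof (induction i arbitrary: x)
  case (Suc i)
  have "eventually (\<lambda>y. (deriv ^^ i) f y = (deriv ^^ i) g y) (nhds x)"
    using Suc assms(1) eventually_nhds by blast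
  then show ?case by (simp add: deriv_cong_ev)
qed (use assms in auto)

lemma deriv_iterate_power_times:
  fixes e :: "real \<Rightarrow> real"
  assumes "smooth_on e {-d<..<d}" "d > 0"
  shows "(deriv ^^ k) (\<lambda>u. u^k * e u) 0 = fact k * e 0"
  using assms(1)
proof (induction k arbitrary: e)
  case (Suc k)
  let ?e = "\<lambda>u. real (Suc k) * e u + u * deriv e u"
  have "deriv (\<lambda>u. u^Suc k * e u) u = u^k * ?e u" if "u \<in> {-d<..<d}" for u
  proof (rule DERIV_imp_deriv)
    have "((\<lambda>u. u^Suc k) has_real_derivative real (Suc k) * u^k) (at u)"
      using DERIV_pow[of "Suc k" u] by simp
    from DERIV_mult[OF this smooth_on_has_real_derivative[OF Suc.prems _ that]]
    show "((\<lambda>u. u^Suc k * e u) has_real_derivative u^k * ?e u) (at u)"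
      by (simp add: algebra_simps)
  qed
  then have "(deriv ^^ k) (deriv (\<lambda>u. u^Suc k * e u)) 0 = (deriv ^^ k) (\<lambda>u. u^k * ?e u) 0"
    by (intro deriv_iterate_cong[of "{-d<..<d}"]) (use assms(2) in simp_all)
  also have "\<dots> = fact k * ?e 0"
    by (rule Suc.IH)
      (use Suc.prems smooth_on_deriv in \<open>auto intro!: smooth_on_add smooth_on_mult smooth_on_const smooth_on_id\<close>)
  finally show ?case by (simp add: funpow_Suc_right del: funpow.simps)
qed simp

text \<open>Hadamard's lemma splits off one factor \<open>u\<close> for each vanishing derivative.\<close>

lemma vanishing_order_factor:
  fixes f :: "real \<Rightarrow> real"
  assumes "smooth_on f {-d<..<d}" "d > 0" "\<And>i. i < k \<Longrightarrow> (deriv ^^ i) f 0 = 0"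
  obtains e where "smooth_on e {-d<..<d}" "\<And>u. u \<in> {-d<..<d} \<Longrightarrow> f u = u^k * e u"
    "(deriv ^^ k) f 0 = fact k * e 0"
  using assms(3)
proof (induction k arbitrary: thesis)
  case 0
  then show ?case using assms(1) by force
next
  case (Suc k)
  obtain e where e: "smooth_on e {-d<..<d}" "\<And>u. u \<in> {-d<..<d} \<Longrightarrow> f u = u^k * e u"
    "(deriv ^^ k) f 0 = fact k * e 0"
    using Suc.IH Suc.prems by (metis less_SucI)
  then have "e 0 = 0" using Suc.prems(2)[of k] by simp
  then obtain g where g: "smooth_on g {-d<..<d}" "\<And>u. u \<in> {-d<..<d} \<Longrightarrow> e u = u * g u"
    using Hadamard_lemma[OF e(1)] by blast
  have *: "f u = u^Suc k * g u" if "u \<in> {-d<..<d}" for u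
    using e(2)[OF that] g(2)[OF that] by simp
  have "(deriv ^^ Suc k) f 0 = (deriv ^^ Suc k) (\<lambda>u. u^Suc k * g u) 0"
    by (rule deriv_iterate_cong[of "{-d<..<d}"]) (use * assms(2) in auto)
  also have "\<dots> = fact (Suc k) * g 0"
    by (rule deriv_iterate_power_times[OF g(1) assms(2)])
  finally show ?case using Suc.prems(1)[OF g(1)] * by blast
qed

text \<open>The formula \<open>g' = 1 / (f' \<circ> g)\<close> makes \<open>g\<close> one degree smoother than it is already known to be.\<close>

lemma smooth_on_inverse_function:
  fixes f g :: "real \<Rightarrow> real"
  assumes "open S" "open T" "smooth_on f S" "\<And>x. x \<in> S \<Longrightarrow> deriv f x \<noteq> 0" "homeomorphism S T f g"
  shows "smooth_on g T"
proof -
  have gT: "g y \<in> S" and fg: "f (g y) = y" if "y \<in> T" for y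
    using assms(5) that by (auto simp: homeomorphism_def)
  have cg: "continuous_on T g" using assms(5) by (simp add: homeomorphism_def)
  have dg: "(g has_real_derivative inverse (deriv f (g y))) (at y)" if y: "y \<in> T" for y
  proof -
    obtain e where e: "e > 0" "ball y e \<subseteq> T" using assms(2) y open_contains_ball by blast
    have sub: "z \<in> T" if "y - e < z" "z < y + e" for z
      using e that by (auto simp: dist_real_def subset_iff)
    show ?thesis
    proof (rule DERIV_inverse_function[where a="y-e" and b="y+e"])
      show "(f has_real_derivative deriv f (g y)) (at (g y))"
        using smooth_on_has_real_derivative[OF assms(3,1) gT[OF y]] .
      show "isCont g y" using cg assms(2) y continuous_on_eq_continuous_at by blast
    qed (use e sub fg assms(4) gT y in auto)
  qed
  have "Ck_on k g T" for k
  proof (induction k)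
    case (Suc k)
    have d: "smooth_on (\<lambda>x. inverse (deriv f x)) S"
      by (intro smooth_on_inverse smooth_on_deriv assms)
    have "Ck_on k (\<lambda>y. inverse (deriv f (g y))) T"
      by (rule Ck_on_compose[OF assms(2,1) _ _ Suc]) (use d gT smooth_on_def in auto)
    then show ?case using Ck_on_SucI_real[OF assms(2) dg] by blast
  qed (use cg in auto)
  then show ?thesis by (simp add: smooth_on_def)
qed

lemma smooth_local_inverse:
  fixes f :: "real \<Rightarrow> real"
  assumes "open S" "x0 \<in> S" "smooth_on f S" "deriv f x0 \<noteq> 0"
  obtains d g where "d > 0" "{x0-d<..<x0+d} \<subseteq> S" "open (f ` {x0-d<..<x0+d})"
    "homeomorphism {x0-d<..<x0+d} (f ` {x0-d<..<x0+d}) f g" "smooth_on g (f ` {x0-d<..<x0+d})"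
proof -
  have "continuous_on S (deriv f)"
    using smooth_on_deriv smooth_on_imp_continuous_on assms by blast
  then have "open (S \<inter> deriv f -` (-{0}))"
    by (intro continuous_open_preimage assms open_Compl closed_singleton)
  then obtain d where d: "d > 0" "ball x0 d \<subseteq> S \<inter> deriv f -` (-{0})"
    using assms openE[of "S \<inter> deriv f -` (-{0})" x0] by blast
  define J where "J = {x0-d<..<x0+d}"
  have "ball x0 d = J" by (simp add: J_def ball_eq_greaterThanLessThan)
  with d have J: "J \<subseteq> S" "\<And>x. x \<in> J \<Longrightarrow> deriv f x \<noteq> 0" "open J" by (auto simp: J_def)
  have der: "(f has_real_derivative deriv f x) (at x)" if "x \<in> J" for x
    using smooth_on_has_real_derivative assms J that by blast
  have "inj_on f J"
  proof (rule linorder_inj_onI)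
    fix x y assume xy: "x < y" "x \<in> J" "y \<in> J"
    show "f x \<noteq> f y"
    proof
      assume eq: "f x = f y"
      have "z \<in> J" if "x \<le> z" "z \<le> y" for z using that xy by (auto simp: J_def)
      then obtain z where z: "x < z" "z < y" "deriv f z = 0"
        using MVT2[of x y f "deriv f"] xy der eq by auto
      then show False using J(2)[of z] xy by (auto simp: J_def)
    qed
  qed auto
  moreover have sm: "smooth_on f J" using smooth_on_subset assms J by blast
  ultimately obtain g where g: "homeomorphism J (f ` J) f g" and op: "open (f ` J)"
    using invariance_of_domain_homeomorphism[of J f] invariance_of_domain[of J f] J
      smooth_on_imp_continuous_on[OF sm] by (metis order_refl)
  show ?thesis
    using that[of d g] d(1) J(1) g op smooth_on_inverse_function[OF J(3) op sm J(2) g]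
    unfolding J_def by blast
qed

section \<open>Borel's theorem\<close>

text \<open>Starting from \<open>cos + sin\<close>, none of whose derivatives vanishes at \<open>0\<close>, the step
  \<open>p(x) \<mapsto> p(2x) - 2\<^sup>k p(x)\<close> kills the \<open>k\<close>-th derivative at \<open>0\<close> and no later one.\<close>

primrec osc :: "nat \<Rightarrow> nat \<Rightarrow> real \<Rightarrow> real" where
  "osc 0 j x = cos (x + j * (pi/2)) + sin (x + j * (pi/2))"
| "osc (Suc k) j x = 2^j * osc k j (2*x) - 2^k * osc k j x"

lemma osc_has_real_derivative: "(osc k j has_real_derivative osc k (Suc j) x) (at x)"
proof (induction k arbitrary: x)
  case 0
  have s: "sin (x + real (Suc j) * (pi/2)) = cos (x + j * (pi/2))"
    "cos (x + real (Suc j) * (pi/2)) = - sin (x + j * (pi/2))"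
    by (simp_all add: algebra_simps add_divide_distrib sin_add cos_add)
  show ?case
    unfolding osc.simps s by (auto intro!: derivative_eq_intros)
next
  case (Suc k)
  have "((\<lambda>x. osc k j (2*x)) has_real_derivative osc k (Suc j) (2*x) * 2) (at x)"
    by (rule DERIV_chain2[OF Suc]) (auto intro!: derivative_eq_intros)
  with Suc[of x] show ?case
    unfolding osc.simps by (auto intro!: derivative_eq_intros)
qed

lemma osc_bounded: "\<exists>M. \<forall>x. \<bar>osc k j x\<bar> \<le> M"
proof (induction k)
  case 0
  have "\<bar>cos y + sin y\<bar> \<le> 2" for y :: real
    using abs_cos_le_one[of y] abs_sin_le_one[of y] by linarith
  then show ?case by auto
next
  case (Suc k)
  then obtain M where M: "\<bar>osc k j x\<bar> \<le> M" for x by blast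
  have "\<bar>osc (Suc k) j x\<bar> \<le> 2^j * M + 2^k * M" for x
  proof -
    have "\<bar>osc (Suc k) j x\<bar> \<le> \<bar>2^j * osc k j (2*x)\<bar> + \<bar>2^k * osc k j x\<bar>"
      by (simp add: abs_triangle_ineq4)
    also have "\<dots> \<le> 2^j * M + 2^k * M" using M by (intro add_mono) (auto simp: abs_mult)
    finally show ?thesis .
  qed
  then show ?case by blast
qed

lemma osc_at_0: "osc k j 0 = (\<Prod>i<k. 2^j - 2^i) * osc 0 j 0"
  by (induction k) (auto simp: algebra_simps)

lemma osc_at_0_eq_0_iff: "osc k j 0 = 0 \<longleftrightarrow> j < k"
proof -
  have "(osc 0 j 0)\<^sup>2 = 1 + sin (2 * (real j * (pi/2)))"
    unfolding sin_double by (simp add: power2_sum)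
  also have "\<dots> = 1" by (simp add: sin_npi)
  finally have "osc 0 j 0 \<noteq> 0" by auto
  then show ?thesis unfolding osc_at_0[of k] by (auto simp: power_inject_exp)
qed

text \<open>The series \<open>\<Sum>\<^sub>k H k\<close> is built term by term: \<open>H k\<close> is a multiple of \<open>osc k (L x)\<close>
  that corrects the \<open>k\<close>-th derivative at \<open>0\<close>, leaves the earlier ones alone, and for large
  \<open>L\<close> is small together with its first \<open>k - 1\<close> derivatives.\<close>

lemma Borel_theorem:
  fixes a :: "nat \<Rightarrow> real"
  obtains h :: "nat \<Rightarrow> real \<Rightarrow> real"
  where "\<And>j x. (h j has_real_derivative h (Suc j) x) (at x)" "\<And>j. h j 0 = a j"
proof -
  define P where "P f k r \<longleftrightarrow>
      (\<forall>j x. (r j has_real_derivative r (Suc j) x) (at x)) \<and>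
      (\<forall>j<k. \<forall>x. \<bar>r j x\<bar> \<le> (1/2)^k) \<and> (\<forall>j<k. r j 0 = 0) \<and>
      r k 0 = a k - (\<Sum>i<k. f i k 0)"
    for f :: "nat \<Rightarrow> nat \<Rightarrow> real \<Rightarrow> real" and k r
  have "\<exists>H. \<forall>k. P H k (H k)"
  proof (rule dependent_wellorder_choice)
    show "P f k r = P g k r" if "\<And>i. i < k \<Longrightarrow> f i = g i" for r f g k
      using that by (simp add: P_def)
  next
    fix k :: nat and f :: "nat \<Rightarrow> nat \<Rightarrow> real \<Rightarrow> real"
    define \<alpha> where "\<alpha> = (a k - (\<Sum>i<k. f i k 0)) / osc k k 0"
    obtain M where M: "\<bar>osc k j x\<bar> \<le> M j" for j x using osc_bounded[of k] by metis
    \<comment> \<open>The scale must absorb the bounds of all derivatives of order below \<open>k\<close> at once.\<close>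
    define L where "L = 1 + \<bar>\<alpha>\<bar> * (\<Sum>j<k. M j) * 2^k"
    have M0: "M j \<ge> 0" for j using M[of j 0] by linarith
    have L: "L \<ge> 1" by (auto simp: L_def intro!: mult_nonneg_nonneg sum_nonneg M0)
    define r where "r j x = \<alpha> * (L^j / L^k) * osc k j (L*x)" for j x
    have "P f k r" unfolding P_def
    proof (intro conjI allI impI)
      fix j x
      have "((\<lambda>x. osc k j (L*x)) has_real_derivative osc k (Suc j) (L*x) * L) (at x)"
        by (rule DERIV_chain2[OF osc_has_real_derivative]) (auto intro!: derivative_eq_intros)
      from DERIV_cmult[OF this, of "\<alpha> * (L^j / L^k)"]
      show "(r j has_real_derivative r (Suc j) x) (at x)"
        unfolding r_def by (simp add: mult_ac)
    next
      fix j x assume j: "j < k"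
      have "L^j * L \<le> L^k" using j L power_increasing[of "Suc j" k L] by (simp add: mult.commute)
      then have q: "L^j / L^k \<le> 1 / L" using L by (simp add: field_simps)
      have "M j \<le> (\<Sum>j<k. M j)" using j M0 by (intro member_le_sum) auto
      then have le: "\<bar>\<alpha>\<bar> * M j * 2^k \<le> \<bar>\<alpha>\<bar> * (\<Sum>j<k. M j) * 2^k"
        by (intro mult_right_mono mult_left_mono) auto
      have "\<bar>r j x\<bar> = \<bar>\<alpha>\<bar> * (L^j / L^k) * \<bar>osc k j (L*x)\<bar>"
        using L by (simp add: r_def abs_mult)
      also have "\<dots> \<le> \<bar>\<alpha>\<bar> * (1 / L) * M j"
        using q M L by (intro mult_mono) auto
      also have "\<dots> \<le> (1/2)^k"
        using le L by (simp add: field_simps L_def)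
      finally show "\<bar>r j x\<bar> \<le> (1/2)^k" .
    next
      fix j assume "j < k" then show "r j 0 = 0" by (simp add: r_def osc_at_0_eq_0_iff)
    next
      show "r k 0 = a k - (\<Sum>i<k. f i k 0)"
        using L osc_at_0_eq_0_iff[of k k] by (simp add: r_def \<alpha>_def)
    qed
    then show "\<exists>r. P f k r" by blast
  qed
  then obtain H where "\<And>k. P H k (H k)" by blast
  then have der: "\<And>k j x. (H k j has_real_derivative H k (Suc j) x) (at x)"
    and bd: "\<And>k j x. j < k \<Longrightarrow> \<bar>H k j x\<bar> \<le> (1/2)^k"
    and z: "\<And>k j. j < k \<Longrightarrow> H k j 0 = 0"
    and v: "\<And>k. H k k 0 = a k - (\<Sum>i<k. H i k 0)"
    unfolding P_def by blast+
  have s2: "summable (\<lambda>k. (1/2::real)^k)" by (simp add: summable_geometric)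
  have uc: "uniformly_convergent_on UNIV (\<lambda>n x. \<Sum>k<n. H k j x)" for j
    by (rule Weierstrass_m_test'_ev[OF _ s2])
      (use bd in \<open>auto simp: eventually_sequentially intro!: exI[of _ "Suc j"]\<close>)
  show ?thesis
  proof
    fix j
    have fin: "(\<lambda>k. H k j 0) sums (\<Sum>k<Suc j. H k j 0)"
      by (rule sums_finite) (use z in auto)
    show "(\<Sum>k. H k j 0) = a j"
      using sums_unique[OF fin] v[of j] by simp
    show "((\<lambda>x. \<Sum>k. H k j x) has_real_derivative (\<Sum>k. H k (Suc j) x)) (at x)" for x
      by (rule has_field_derivative_series'(2)[OF convex_UNIV der uc UNIV_I sums_summable[OF fin]]) simp
  qed
qed

section \<open>Whitney's theorem on even functions\<close>

text \<open>By L'Hopital's rule. This is the way to cross the point at which two smooth functions with equal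
  Taylor coefficients are joined.\<close>

lemma has_real_derivative_at_removable_point:
  fixes f :: "real \<Rightarrow> real"
  assumes "isCont f x" "isCont f' x" "\<forall>\<^sub>F y in at x. (f has_real_derivative f' y) (at y)"
  shows "(f has_real_derivative f' x) (at x)"
proof -
  have "((\<lambda>y. (f y - f x) / (y - x)) \<longlongrightarrow> f' x) (at x)"
  proof (rule lhopital[where f'=f' and g'="\<lambda>_. 1"])
    show "((\<lambda>y. f y - f x) \<longlongrightarrow> 0) (at x)" using assms(1) by (simp add: isCont_def LIM_zero)
    show "((\<lambda>y. y - x) \<longlongrightarrow> 0) (at x)" by (simp add: LIM_zero)
    show "\<forall>\<^sub>F y in at x. y - x \<noteq> 0" by (auto simp: eventually_at_filter)
    show "\<forall>\<^sub>F y in at x. ((\<lambda>y. f y - f x) has_real_derivative f' y) (at y)"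
      using assms(3) by eventually_elim (auto intro!: derivative_eq_intros)
    show "((\<lambda>y. f' y / 1) \<longlongrightarrow> f' x) (at x)" using assms(2) by (simp add: isCont_def)
  qed (auto intro!: derivative_eq_intros always_eventually)
  then show ?thesis by (simp add: has_field_derivative_iff)
qed

text \<open>The derivative of an even function is odd, so it vanishes at \<open>0\<close> and is divisible by \<open>u\<close>.\<close>

lemma even_derivative_quotient:
  fixes f :: "real \<Rightarrow> real"
  assumes "smooth_on f {-d<..<d}" "\<And>u. u \<in> {-d<..<d} \<Longrightarrow> f (-u) = f u" "d > 0"
  obtains g where "smooth_on g {-d<..<d}" "\<And>u. u \<in> {-d<..<d} \<Longrightarrow> g (-u) = g u"
    "\<And>u. u \<in> {-d<..<d} \<Longrightarrow> (f has_real_derivative 2 * u * g u) (at u)"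
proof -
  have odd: "deriv f (-u) = - deriv f u" if u: "u \<in> {-d<..<d}" for u
  proof -
    have "(f has_real_derivative deriv f (-u)) (at (-u))"
      using smooth_on_has_real_derivative[OF assms(1)] u by auto
    then have "((\<lambda>u. f (-u)) has_real_derivative deriv f (-u) * -1) (at u)"
      by (rule DERIV_chain2) (auto intro!: derivative_eq_intros)
    then have "(f has_real_derivative deriv f (-u) * -1) (at u)"
      by (rule has_field_derivative_transform_within_open[where S="{-d<..<d}"])
        (use assms u in auto)
    then show ?thesis
      using smooth_on_has_real_derivative[OF assms(1) _ u] DERIV_unique by fastforce
  qed
  have "deriv f 0 / 2 = 0" using odd[of 0] assms(3) by simp
  moreover have "smooth_on (\<lambda>u. deriv f u / 2) {-d<..<d}"
    by (intro smooth_on_divide smooth_on_deriv smooth_on_const assms) auto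
  ultimately obtain g where g: "smooth_on g {-d<..<d}" "\<And>u. u \<in> {-d<..<d} \<Longrightarrow> deriv f u / 2 = u * g u"
    using Hadamard_lemma by metis
  have g2: "deriv f u = 2 * u * g u" if "u \<in> {-d<..<d}" for u using g(2)[OF that] by simp
  show ?thesis
  proof
    show "g (-u) = g u" if u: "u \<in> {-d<..<d}" for u
    proof (cases "u = 0")
      case False
      have "2 * (-u) * g (-u) = - (2 * u * g u)"
        using odd[OF u] g2[OF u] g2[of "-u"] u by auto
      then show ?thesis using False by simp
    qed simp
    show "(f has_real_derivative 2 * u * g u) (at u)" if "u \<in> {-d<..<d}" for u
      using smooth_on_has_real_derivative[OF assms(1) _ that] g2[OF that] by simp
  qed (fact g(1))
qed

text \<open>On \<open>x \<ge> 0\<close> the function \<open>f(\<surd>x)\<close> has the iterates \<open>F j(\<surd>x)\<close> of \<open>f \<mapsto> f'/(2u)\<close> as its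
  derivatives, up to the boundary. A function with the derivatives \<open>F j 0\<close> at \<open>0\<close>, from
  Borel's theorem, continues it to \<open>x < 0\<close>.\<close>

lemma Whitney_even_function:
  fixes f :: "real \<Rightarrow> real"
  assumes "smooth_on f {-d<..<d}" "\<And>u. u \<in> {-d<..<d} \<Longrightarrow> f (-u) = f u" "d > 0"
  obtains g where "smooth_on g {..<d\<^sup>2}" "\<And>u. u \<in> {-d<..<d} \<Longrightarrow> f u = g (u\<^sup>2)"
proof -
  define P where "P n F \<longleftrightarrow> smooth_on F {-d<..<d} \<and> (\<forall>u\<in>{-d<..<d}. F (-u) = F u) \<and> (n = 0 \<longrightarrow> F = f)"
    for n :: nat and F :: "real \<Rightarrow> real"
  have "\<exists>F. \<forall>n. P n (F n) \<and> (\<forall>u\<in>{-d<..<d}. (F n has_real_derivative 2 * u * F (Suc n) u) (at u))"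
  proof (rule dependent_nat_choice)
    show "\<exists>F. P 0 F" using assms by (auto simp: P_def)
    show "\<exists>G. P (Suc n) G \<and> (\<forall>u\<in>{-d<..<d}. (F has_real_derivative 2 * u * G u) (at u))"
      if "P n F" for F n
      using even_derivative_quotient[of F d] that assms(3) unfolding P_def by (metis nat.distinct(1))
  qed
  then obtain F where F: "\<And>n. P n (F n)"
    "\<And>n u. u \<in> {-d<..<d} \<Longrightarrow> (F n has_real_derivative 2 * u * F (Suc n) u) (at u)" by blast
  obtain h where h: "\<And>j x. (h j has_real_derivative h (Suc j) x) (at x)" "\<And>j. h j 0 = F j 0"
    using Borel_theorem[of "\<lambda>j. F j 0"] by blast
  define G where "G j x = (if x < 0 then h j x else F j (sqrt x))" for j x
  have sq: "sqrt x \<in> {-d<..<d}" if "0 \<le> x" "x < d\<^sup>2" for x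
  proof -
    have "0 \<le> sqrt x" "sqrt x < d" using that assms(3) real_less_lsqrt[of d x] by auto
    then have "- d < sqrt x" using assms(3) by linarith
    with \<open>sqrt x < d\<close> show ?thesis by simp
  qed
  have off0: "(G j has_real_derivative G (Suc j) x) (at x)" if x: "x < d\<^sup>2" "x \<noteq> 0" for j x
  proof (cases "x < 0")
    case True
    have "(h j has_real_derivative G (Suc j) x) (at x)" using h(1)[of j x] True by (simp add: G_def)
    then show ?thesis
      by (rule has_field_derivative_transform_within_open[where S="{..<0}"]) (use True in \<open>auto simp: G_def\<close>)
  next
    case False
    with x have x0: "x > 0" by simp
    have "((\<lambda>x. F j (sqrt x)) has_real_derivative 2 * sqrt x * F (Suc j) (sqrt x) * (inverse (sqrt x) / 2)) (at x)"
      by (rule DERIV_chain2[OF F(2)[OF sq] DERIV_real_sqrt]) (use x x0 in auto)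
    then have "((\<lambda>x. F j (sqrt x)) has_real_derivative G (Suc j) x) (at x)"
      using x0 by (simp add: G_def field_simps)
    then show ?thesis
      by (rule has_field_derivative_transform_within_open[where S="{0<..}"]) (use x0 in \<open>auto simp: G_def\<close>)
  qed
  have cont0: "isCont (G j) 0" for j
    unfolding isCont_def filterlim_at_split
  proof
    have "(h j \<longlongrightarrow> h j 0) (at_left 0)"
      using DERIV_isCont[OF h(1)[of j 0]] by (simp add: isCont_def filterlim_at_split)
    then have "(h j \<longlongrightarrow> G j 0) (at_left 0)" by (simp add: G_def h(2))
    then show "(G j \<longlongrightarrow> G j 0) (at_left 0)"
      by (rule Lim_transform_eventually) (auto simp: eventually_at_filter G_def)
    have "isCont (F j) (sqrt 0)"
      using DERIV_isCont[OF F(2)[of 0 j]] assms(3) by simp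
    then have "isCont (\<lambda>x. F j (sqrt x)) 0"
      by (rule isCont_o2[rotated]) (rule isCont_real_sqrt)
    then have "((\<lambda>x. F j (sqrt x)) \<longlongrightarrow> G j 0) (at_right 0)"
      by (simp add: isCont_def filterlim_at_split G_def)
    then show "(G j \<longlongrightarrow> G j 0) (at_right 0)"
      by (rule Lim_transform_eventually) (auto simp: eventually_at_filter G_def)
  qed
  have at0: "(G j has_real_derivative G (Suc j) 0) (at 0)" for j
  proof (rule has_real_derivative_at_removable_point)
    have "\<forall>\<^sub>F y in nhds (0::real). y < d\<^sup>2"
      using assms(3) by (intro eventually_nhds_in_open[of "{..<d\<^sup>2}" 0, simplified]) auto
    then show "\<forall>\<^sub>F y in at 0. (G j has_real_derivative G (Suc j) y) (at y)"
      unfolding eventually_at_filter by eventually_elim (use off0 in auto)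
  qed (use cont0 in auto)
  show ?thesis
  proof
    show "smooth_on (G 0) {..<d\<^sup>2}"
      by (rule smooth_on_derivative_sequence[OF open_lessThan]) (metis off0 at0 lessThan_iff)
    show "f u = G 0 (u\<^sup>2)" if "u \<in> {-d<..<d}" for u
      using F(1)[of 0] assms(2)[OF that] by (auto simp: P_def G_def abs_if)
  qed
qed

text \<open>The odd part is \<open>u\<close> times an even function, so Whitney's theorem covers both parts.\<close>

lemma even_odd_decomposition:
  fixes f :: "real \<Rightarrow> real"
  assumes "smooth_on f {-d<..<d}" "d > 0"
  obtains A B where "smooth_on A {..<d\<^sup>2}" "smooth_on B {..<d\<^sup>2}"
    "\<And>u. u \<in> {-d<..<d} \<Longrightarrow> f u = A (u\<^sup>2) + u * B (u\<^sup>2)"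
proof -
  have sm: "smooth_on (\<lambda>u. f (-u)) {-d<..<d}"
    by (rule smooth_on_compose[OF _ _ _ assms(1)]) (auto intro!: smooth_on_uminus smooth_on_id)
  have s1: "smooth_on (\<lambda>u. (f u + f (-u)) / 2) {-d<..<d}"
    and s2: "smooth_on (\<lambda>u. (f u - f (-u)) / 2) {-d<..<d}"
    by (intro smooth_on_divide smooth_on_add smooth_on_diff smooth_on_const assms sm; simp)+
  obtain A where A: "smooth_on A {..<d\<^sup>2}" "\<And>u. u \<in> {-d<..<d} \<Longrightarrow> (f u + f (-u)) / 2 = A (u\<^sup>2)"
    using Whitney_even_function[OF s1 _ assms(2)] by (auto simp: add.commute)
  obtain q where q: "smooth_on q {-d<..<d}" "\<And>u. u \<in> {-d<..<d} \<Longrightarrow> (f u - f (-u)) / 2 = u * q u"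
    using Hadamard_lemma[OF s2] by auto
  have "q (-u) = q u" if u: "u \<in> {-d<..<d}" for u
  proof (cases "u = 0")
    case False
    have "(-u) * q (-u) = - (u * q u)"
      using q(2)[OF u] q(2)[of "-u"] u by (auto simp: field_simps)
    then show ?thesis using False by simp
  qed simp
  then obtain B where B: "smooth_on B {..<d\<^sup>2}" "\<And>u. u \<in> {-d<..<d} \<Longrightarrow> q u = B (u\<^sup>2)"
    using Whitney_even_function[OF q(1) _ assms(2)] by auto
  have "f u = A (u\<^sup>2) + u * B (u\<^sup>2)" if u: "u \<in> {-d<..<d}" for u
  proof -
    have "f u = (f u + f (-u)) / 2 + (f u - f (-u)) / 2" by (simp add: field_simps)
    then show ?thesis using A(2)[OF u] q(2)[OF u] B(2)[OF u] by simp
  qed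
  then show ?thesis using that A(1) B(1) by blast
qed


section \<open>Normal forms of curve germs in three-space\<close>

lemma smooth_on_imp_smooth_map_on:
  assumes "smooth_on f W" "open W" "A \<subseteq> W" shows "smooth_map_on f A"
  unfolding smooth_map_on_def using assms by blast

lemma diffeomorphism_openI:
  assumes "open W" "open V" "smooth_on f W" "smooth_on g V"
    and "\<And>x. x \<in> W \<Longrightarrow> f x \<in> V \<and> g (f x) = x" "\<And>y. y \<in> V \<Longrightarrow> g y \<in> W \<and> f (g y) = y"
  shows "diffeomorphism W V f g"
  unfolding diffeomorphism_def
proof (intro conjI)
  show "homeomorphism W V f g"
    by (rule homeomorphismI) (use assms smooth_on_imp_continuous_on in auto)
qed (use smooth_on_imp_smooth_map_on[OF assms(3,1)] smooth_on_imp_smooth_map_on[OF assms(4,2)] in auto)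

lemma smooth_on_vector3:
  fixes f g h :: "'a::euclidean_space \<Rightarrow> real"
  assumes "open S" "smooth_on f S" "smooth_on g S" "smooth_on h S"
  shows "smooth_on (\<lambda>x. vector [f x, g x, h x] :: real^3) S"
proof -
  have "(\<lambda>x. vector [f x, g x, h x] :: real^3) = (\<lambda>x. \<chi> i. if i = 1 then f x else if i = 2 then g x else h x)"
    by (auto simp: vec_eq_iff forall_3)
  moreover have "smooth_on (\<lambda>x. \<chi> i::3. if i = 1 then f x else if i = 2 then g x else h x) S"
  proof (rule smooth_on_vec_lambda)
    show "smooth_on (\<lambda>x. if i = 1 then f x else if i = 2 then g x else h x) S" for i :: 3
      using assms by (cases "i = 1"; cases "i = 2") auto
  qed (fact assms(1))
  ultimately show ?thesis by simp
qed

text \<open>The counterpart in \<open>\<real>\<^sup>3\<close>, based at the parameter \<open>0\<close>, of local diffeomorphy of a curve in de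
  Sitter space to \<open>Z\<close>.\<close>

definition curve_germ_equivalent :: "(real \<Rightarrow> real^3) \<Rightarrow> (real^3) set \<Rightarrow> bool" where
  "curve_germ_equivalent c Z \<longleftrightarrow> (\<exists>W V f g. open W \<and> open V \<and> c 0 \<in> W \<and> diffeomorphism W V f g \<and>
     f (c 0) = 0 \<and> (\<forall>\<^sub>F \<epsilon> in at_right 0. c ` {-\<epsilon><..<\<epsilon>} \<subseteq> W \<and> same_germ 0 (f ` c ` {-\<epsilon><..<\<epsilon>}) Z))"

lemma eventually_at_right_0I:
  assumes "(d::real) > 0" "\<And>x. 0 < x \<Longrightarrow> x < d \<Longrightarrow> P x"
  shows "\<forall>\<^sub>F x in at_right 0. P x"
  using assms eventually_at_right_field by blast

text \<open>The last assumption says that only small parameters \<open>v\<close> lead near \<open>0\<close>. Hence every arc of the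
  curve around \<open>0\<close>, however short, already fills the germ of the range of \<open>P\<close>.\<close>

lemma curve_germ_equivalentI:
  fixes \<kappa> h :: "real \<Rightarrow> real"
  assumes "open W" "open V" "diffeomorphism W V f g" "f (c 0) = 0"
    and "d > 0" "homeomorphism {-d<..<d} T \<kappa> h" "open T" "\<kappa> 0 = 0"
    and "c ` {-d<..<d} \<subseteq> W" "\<And>u. u \<in> {-d<..<d} \<Longrightarrow> f (c u) = P (\<kappa> u)"
    and small: "\<And>\<mu>. \<mu> > 0 \<Longrightarrow> \<exists>N. open N \<and> 0 \<in> N \<and> (\<forall>v. P v \<in> N \<longrightarrow> \<bar>v\<bar> < \<mu>)"
  shows "curve_germ_equivalent c (range P)"
  unfolding curve_germ_equivalent_def
proof (intro exI conjI)
  show "\<forall>\<^sub>F \<epsilon> in at_right 0. c ` {-\<epsilon><..<\<epsilon>} \<subseteq> W \<and> same_germ 0 (f ` c ` {-\<epsilon><..<\<epsilon>}) (range P)"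
  proof (rule eventually_at_right_0I[OF assms(5)])
    fix \<epsilon> assume e: "0 < \<epsilon>" "\<epsilon> < d"
    let ?J = "{-\<epsilon><..<\<epsilon>}"
    have sub: "?J \<subseteq> {-d<..<d}" using e by auto
    have eq: "\<kappa> ` ?J = T \<inter> h -` ?J"
      using assms(6) sub by (force simp: homeomorphism_def)
    have "open (\<kappa> ` ?J)"
      unfolding eq using assms(6,7) by (intro continuous_open_preimage) (auto simp: homeomorphism_def)
    moreover have "0 \<in> \<kappa> ` ?J" using e assms(8) by (intro image_eqI[of _ _ 0]) auto
    ultimately obtain \<mu> where mu: "\<mu> > 0" "ball 0 \<mu> \<subseteq> \<kappa> ` ?J" using openE by blast
    obtain N where N: "open N" "0 \<in> N" "\<And>v. P v \<in> N \<Longrightarrow> \<bar>v\<bar> < \<mu>" using small[OF mu(1)] by blast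
    have im: "f ` c ` ?J = P ` \<kappa> ` ?J"
      using assms(10) sub by (force simp: image_image intro!: image_cong)
    have "range P \<inter> N \<subseteq> P ` \<kappa> ` ?J"
      using N(3) mu(2) by (force simp: subset_iff dist_real_def)
    then have "P ` \<kappa> ` ?J \<inter> N = range P \<inter> N" by blast
    then have "same_germ 0 (f ` c ` ?J) (range P)"
      unfolding same_germ_def im using N(1,2) by metis
    then show "c ` ?J \<subseteq> W \<and> same_germ 0 (f ` c ` ?J) (range P)" using sub assms(9) by blast
  qed
  show "c 0 \<in> W" using assms(5,9) by (auto simp: subset_iff)
qed (use assms in auto)

text \<open>The third coordinate \<open>x\<^sub>3\<close> is a parameter of the curve; with its inverse \<open>g\<close> the map
  \<open>x \<mapsto> x - c(g(x\<^sub>3))\<close>, applied to the first two coordinates only, moves the curve to the axis.\<close>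

lemma regular_curve_germ:
  fixes c :: "real \<Rightarrow> real^3"
  assumes "smooth_on c {-d<..<d}" "d > 0" "c 0 = 0" "deriv (\<lambda>u. c u $ 3) 0 \<noteq> 0"
  shows "curve_germ_equivalent c (span {axis 3 1})"
proof -
  have sm: "smooth_on (\<lambda>u. c u $ i) {-d<..<d}" for i
    by (rule smooth_on_vec_nth[OF _ assms(1)]) simp
  obtain e g where e: "e > 0" "{0-e<..<0+e} \<subseteq> {-d<..<d}"
    and T: "open ((\<lambda>u. c u $ 3) ` {0-e<..<0+e})"
    and hom: "homeomorphism {0-e<..<0+e} ((\<lambda>u. c u $ 3) ` {0-e<..<0+e}) (\<lambda>u. c u $ 3) g"
    and g: "smooth_on g ((\<lambda>u. c u $ 3) ` {0-e<..<0+e})"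
    by (rule smooth_local_inverse[OF _ _ sm assms(4)]) (use assms(2) in auto)
  define T where "T = (\<lambda>u. c u $ 3) ` {-e<..<e}"
  define W where "W = {q :: real^3. q $ 3 \<in> T}"
  define f :: "real^3 \<Rightarrow> real^3" where "f q = vector [q$1 - c (g (q$3)) $ 1, q$2 - c (g (q$3)) $ 2, q$3]" for q
  define f' :: "real^3 \<Rightarrow> real^3" where "f' q = vector [q$1 + c (g (q$3)) $ 1, q$2 + c (g (q$3)) $ 2, q$3]" for q
  have hom: "homeomorphism {-e<..<e} T (\<lambda>u. c u $ 3) g" and T: "open T" and g: "smooth_on g T"
    using hom T g by (auto simp: T_def)
  have gc: "g (c u $ 3) = u" if "u \<in> {-e<..<e}" for u using hom that by (auto simp: homeomorphism_def)
  have W: "open W" unfolding W_def using T continuous_open_preimage[of UNIV "\<lambda>q::real^3. q$3" T]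
    by (auto simp: vimage_def continuous_on_component)
  have coord: "smooth_on (\<lambda>q::real^3. q $ i) W" for i
    by (rule smooth_on_linear[OF W bounded_linear_vec_nth])
  have g3: "smooth_on (\<lambda>q::real^3. g (q $ 3)) W"
    by (rule smooth_on_compose[OF W T _ g coord]) (auto simp: W_def)
  have gT: "g ` T = {-e<..<e}" using hom by (simp add: homeomorphism_def)
  have cg: "smooth_on (\<lambda>q::real^3. c (g (q $ 3)) $ i) W" for i
    by (rule smooth_on_compose[OF W _ _ sm g3]) (use gT e in \<open>auto simp: W_def\<close>)
  have "curve_germ_equivalent c (range (\<lambda>v. v *\<^sub>R axis 3 1))"
  proof (rule curve_germ_equivalentI[OF W W _ _ e(1) hom T])
    show "diffeomorphism W W f f'"
      by (rule diffeomorphism_openI[OF W W])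
        (auto simp: f_def[abs_def] f'_def[abs_def] W_def[symmetric] vec_eq_iff forall_3
          intro!: smooth_on_vector3 smooth_on_add smooth_on_diff coord cg W, auto simp: W_def)
    show "f (c 0) = 0" using gc[of 0] e(1) assms(3) by (simp add: f_def vec_eq_iff forall_3)
    show "c ` {-e<..<e} \<subseteq> W" by (auto simp: W_def T_def)
    show "f (c u) = (c u $ 3) *\<^sub>R axis 3 1" if "u \<in> {-e<..<e}" for u
      using gc[OF that] by (simp add: f_def vec_eq_iff forall_3 axis_def)
    show "\<exists>N. open N \<and> 0 \<in> N \<and> (\<forall>v. v *\<^sub>R (axis 3 1 :: real^3) \<in> N \<longrightarrow> \<bar>v\<bar> < \<mu>)" if "\<mu> > 0" for \<mu>
      by (rule exI[of _ "ball (0::real^3) \<mu>"]) (use that in \<open>auto simp: dist_norm norm_axis_1\<close>)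
  qed (use assms(3) in auto)
  then show ?thesis by (simp add: span_singleton full_SetCompr_eq)
qed

text \<open>The Morse lemma on the line: if \<open>f(u) = u\<^sup>2 e(u)\<close> with \<open>e(0) \<noteq> 0\<close>, then \<open>\<kappa>(u) = u \<surd>\<bar>e(u)\<bar>\<close> is a
  coordinate.\<close>

lemma Morse_coordinate:
  fixes f :: "real \<Rightarrow> real"
  assumes "smooth_on f {-d<..<d}" "d > 0" "f 0 = 0" "deriv f 0 = 0" "(deriv ^^ 2) f 0 \<noteq> 0"
  obtains \<kappa> g T b \<sigma> where "0 < b" "b \<le> d" "\<sigma>\<^sup>2 = 1" "open T" "homeomorphism {-b<..<b} T \<kappa> g"
    "smooth_on g T" "\<kappa> 0 = 0" "\<And>u. u \<in> {-b<..<b} \<Longrightarrow> f u = \<sigma> * (\<kappa> u)\<^sup>2" "deriv g 0 \<noteq> 0"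
proof -
  have van: "(deriv ^^ i) f 0 = 0" if "i < 2" for i
    using that assms(3,4) by (cases i) auto
  obtain e where e: "smooth_on e {-d<..<d}" "\<And>u. u \<in> {-d<..<d} \<Longrightarrow> f u = u^2 * e u"
    "(deriv ^^ 2) f 0 = fact 2 * e 0"
    using vanishing_order_factor[OF assms(1,2) van] by blast
  have e0: "e 0 \<noteq> 0" using e(3) assms(5) by auto
  define \<sigma> where "\<sigma> = sgn (e 0)"
  have sg: "\<sigma>\<^sup>2 = 1" using e0 by (simp add: \<sigma>_def sgn_if)
  have "continuous_on {-d<..<d} (\<lambda>u. \<sigma> * e u)"
    using smooth_on_imp_continuous_on[OF e(1)] by (intro continuous_intros) auto
  then have "open ({-d<..<d} \<inter> (\<lambda>u. \<sigma> * e u) -` {0<..})"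
    by (intro continuous_open_preimage) auto
  moreover have "0 \<in> {-d<..<d} \<inter> (\<lambda>u. \<sigma> * e u) -` {0<..}"
    using assms(2) e0 by (auto simp: \<sigma>_def sgn_if)
  ultimately obtain a where a: "a > 0" "ball 0 a \<subseteq> {-d<..<d} \<inter> (\<lambda>u. \<sigma> * e u) -` {0<..}"
    using openE by metis
  have b0: "ball 0 a = {-a<..<a}" by (simp add: ball_eq_greaterThanLessThan)
  define \<kappa> where "\<kappa> u = u * sqrt (\<sigma> * e u)" for u
  have sub: "{-a<..<a} \<subseteq> {-d<..<d}" and pos: "\<And>u. u \<in> {-a<..<a} \<Longrightarrow> \<sigma> * e u > 0"
    using a(2) unfolding b0 by auto
  have se: "smooth_on e {-a<..<a}" using smooth_on_subset[OF e(1) _ _ sub] by auto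
  have sq: "smooth_on (\<lambda>u. sqrt (\<sigma> * e u)) {-a<..<a}"
    by (intro smooth_on_sqrt smooth_on_mult smooth_on_const se pos) auto
  have sk: "smooth_on \<kappa> {-a<..<a}"
    unfolding \<kappa>_def by (intro smooth_on_mult smooth_on_id sq) auto
  have "deriv \<kappa> 0 = sqrt (\<sigma> * e 0)"
    using deriv_iterate_power_times[OF sq a(1), of 1] by (simp add: \<kappa>_def[abs_def])
  then have dk: "deriv \<kappa> 0 \<noteq> 0" using pos[of 0] a(1) by auto
  obtain b g where b: "b > 0" "{0-b<..<0+b} \<subseteq> {-a<..<a}"
    and T: "open (\<kappa> ` {0-b<..<0+b})"
    and hom: "homeomorphism {0-b<..<0+b} (\<kappa> ` {0-b<..<0+b}) \<kappa> g"
    and g: "smooth_on g (\<kappa> ` {0-b<..<0+b})"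
    by (rule smooth_local_inverse[OF _ _ sk dk]) (use a(1) in auto)
  define T where "T = \<kappa> ` {-b<..<b}"
  have hom: "homeomorphism {-b<..<b} T \<kappa> g" and T: "open T" and g: "smooth_on g T"
    using hom T g by (auto simp: T_def)
  have k0: "\<kappa> 0 = 0" by (simp add: \<kappa>_def)
  have T0: "0 \<in> T" using k0 b(1) unfolding T_def by (intro image_eqI[of _ _ 0]) auto
  have kg: "\<kappa> (g y) = y" if "y \<in> T" for y using hom that by (auto simp: homeomorphism_def)
  have "g (\<kappa> 0) = 0" using hom b(1) unfolding homeomorphism_def by auto
  then have "g 0 = 0" using k0 by simp
  have "((\<lambda>y. \<kappa> (g y)) has_real_derivative deriv \<kappa> (g 0) * deriv g 0) (at 0)"
    by (rule DERIV_chain2)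
      (use smooth_on_has_real_derivative[OF g T T0] smooth_on_has_real_derivative[OF sk] a(1) \<open>g 0 = 0\<close> in auto)
  then have "((\<lambda>y. y) has_real_derivative deriv \<kappa> (g 0) * deriv g 0) (at 0)"
    by (rule has_field_derivative_transform_within_open[OF _ T T0 kg])
  then have "deriv \<kappa> (g 0) * deriv g 0 = 1" using DERIV_ident DERIV_unique by blast
  then have "deriv g 0 \<noteq> 0" by auto
  moreover have "f u = \<sigma> * (\<kappa> u)\<^sup>2" if u: "u \<in> {-b<..<b}" for u
  proof -
    have u: "u \<in> {-a<..<a}" using u b(2) by auto
    have "\<sigma> * (\<kappa> u)\<^sup>2 = \<sigma>\<^sup>2 * (u\<^sup>2 * e u)"
      using pos[OF u] by (simp add: \<kappa>_def power_mult_distrib power2_eq_square)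
    then show ?thesis using sg e(2)[of u] sub u by auto
  qed
  moreover have "b \<le> d" using b sub
    by (metis add_0 diff_0 dual_order.trans greaterThanLessThan_subseteq_greaterThanLessThan
        less_le_not_le neg_less_pos)
  ultimately show ?thesis using that[OF b(1) _ sg T hom g k0] by blast
qed

lemma factor_compose:
  fixes f g :: "real \<Rightarrow> real"
  assumes "smooth_on f {-d<..<d}" "d > 0" "\<And>i. i < k \<Longrightarrow> (deriv ^^ i) f 0 = 0" "(deriv ^^ k) f 0 \<noteq> 0"
    and "smooth_on g {-b<..<b}" "b > 0" "g ` {-b<..<b} \<subseteq> {-d<..<d}" "g 0 = 0" "deriv g 0 \<noteq> 0"
  obtains e where "smooth_on e {-b<..<b}" "\<And>u. u \<in> {-b<..<b} \<Longrightarrow> f (g u) = u^k * e u" "e 0 \<noteq> 0"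
proof -
  obtain e where e: "smooth_on e {-d<..<d}" "\<And>u. u \<in> {-d<..<d} \<Longrightarrow> f u = u^k * e u"
    "(deriv ^^ k) f 0 = fact k * e 0"
    using vanishing_order_factor[OF assms(1,2,3)] by blast
  obtain m where m: "smooth_on m {-b<..<b}" "\<And>u. u \<in> {-b<..<b} \<Longrightarrow> g u = u^1 * m u"
    "(deriv ^^ 1) g 0 = fact 1 * m 0"
    by (rule vanishing_order_factor[OF assms(5,6), of 1]) (use assms(8) in auto)
  show ?thesis
  proof
    show "smooth_on (\<lambda>u. m u ^ k * e (g u)) {-b<..<b}"
      by (intro smooth_on_mult smooth_on_power m smooth_on_compose[OF _ _ assms(7) e(1) assms(5)]) auto
    show "f (g u) = u^k * (m u ^ k * e (g u))" if u: "u \<in> {-b<..<b}" for u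
    proof -
      have "g u \<in> {-d<..<d}" using assms(7) u by blast
      from e(2)[OF this] show ?thesis using m(2)[OF u] by (simp add: power_mult_distrib)
    qed
    show "m 0 ^ k * e (g 0) \<noteq> 0" using m(3) e(3) assms(4,8,9) by auto
  qed
qed

lemma cusp_234_eq: "cusp_234 = range (\<lambda>u. vector [u^2, u^3, u^4])"
  by (auto simp: cusp_234_def)

text \<open>The numbering of the coordinates is reversed: the first one vanishes to order \<open>4\<close>, the last one to
  order \<open>2\<close>. In the proof \<open>f'\<close> takes the model cusp to the curve. On the last two model coordinates it
  is linear with a matrix of determinant \<open>\<Delta>(x)\<close>, so that \<open>f\<close> is given by Cramer's rule.\<close>

lemma cusp_234_curve_germ:
  fixes c :: "real \<Rightarrow> real^3"
  assumes "smooth_on c {-d<..<d}" "d > 0"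
    and ord1: "\<And>i. i < 4 \<Longrightarrow> (deriv ^^ i) (\<lambda>u. c u $ 1) 0 = 0" "(deriv ^^ 4) (\<lambda>u. c u $ 1) 0 \<noteq> 0"
    and ord2: "\<And>i. i < 3 \<Longrightarrow> (deriv ^^ i) (\<lambda>u. c u $ 2) 0 = 0" "(deriv ^^ 3) (\<lambda>u. c u $ 2) 0 \<noteq> 0"
    and ord3: "\<And>i. i < 2 \<Longrightarrow> (deriv ^^ i) (\<lambda>u. c u $ 3) 0 = 0" "(deriv ^^ 2) (\<lambda>u. c u $ 3) 0 \<noteq> 0"
  shows "curve_germ_equivalent c cusp_234"
proof -
  have sm: "smooth_on (\<lambda>u. c u $ i) {-d<..<d}" for i
    by (rule smooth_on_vec_nth[OF _ assms(1)]) simp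
  obtain \<kappa> g T b \<sigma> where b: "0 < b" "b \<le> d" and sg: "\<sigma>\<^sup>2 = (1::real)" and T: "open T"
    and hom: "homeomorphism {-b<..<b} T \<kappa> g" and g: "smooth_on g T" and k0: "\<kappa> 0 = 0"
    and c3: "\<And>u. u \<in> {-b<..<b} \<Longrightarrow> c u $ 3 = \<sigma> * (\<kappa> u)\<^sup>2" and dg: "deriv g 0 \<noteq> 0"
    by (rule Morse_coordinate[OF sm assms(2) _ _ ord3(2)]) (use ord3(1)[of 0] ord3(1)[of 1] in auto)
  have "0 \<in> T" using hom k0 b(1) by (force simp: homeomorphism_def)
  then obtain \<delta> where \<delta>: "\<delta> > 0" "ball 0 \<delta> \<subseteq> T" using T openE by blast
  then have dT: "{-\<delta><..<\<delta>} \<subseteq> T" by (simp add: ball_eq_greaterThanLessThan)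
  have gk: "g (\<kappa> u) = u" if "u \<in> {-b<..<b}" for u using hom that by (auto simp: homeomorphism_def)
  have g0: "g 0 = 0" using gk[of 0] k0 b(1) by simp
  have gs: "smooth_on g {-\<delta><..<\<delta>}" using smooth_on_subset[OF g T _ dT] by simp
  have gim: "g ` {-\<delta><..<\<delta>} \<subseteq> {-d<..<d}"
  proof -
    have "g ` {-\<delta><..<\<delta>} \<subseteq> {-b<..<b}" using hom dT by (auto simp: homeomorphism_def)
    then show ?thesis using b by force
  qed
  obtain e1 where e1: "smooth_on e1 {-\<delta><..<\<delta>}" "\<And>v. v \<in> {-\<delta><..<\<delta>} \<Longrightarrow> c (g v) $ 1 = v^4 * e1 v" "e1 0 \<noteq> 0"
    by (rule factor_compose[OF sm assms(2) ord1 gs \<delta>(1) gim g0 dg]) (assumption, rule that)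
  obtain e2 where e2: "smooth_on e2 {-\<delta><..<\<delta>}" "\<And>v. v \<in> {-\<delta><..<\<delta>} \<Longrightarrow> c (g v) $ 2 = v^3 * e2 v" "e2 0 \<noteq> 0"
    by (rule factor_compose[OF sm assms(2) ord2 gs \<delta>(1) gim g0 dg]) (assumption, rule that)
  obtain C E where C: "smooth_on C {..<\<delta>\<^sup>2}" and E: "smooth_on E {..<\<delta>\<^sup>2}"
    and CE: "\<And>v. v \<in> {-\<delta><..<\<delta>} \<Longrightarrow> e1 v = C (v\<^sup>2) + v * E (v\<^sup>2)"
    by (rule even_odd_decomposition[OF e1(1) \<delta>(1)], rule that)
  obtain A B where A: "smooth_on A {..<\<delta>\<^sup>2}" and B: "smooth_on B {..<\<delta>\<^sup>2}"
    and AB: "\<And>v. v \<in> {-\<delta><..<\<delta>} \<Longrightarrow> e2 v = A (v\<^sup>2) + v * B (v\<^sup>2)"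
    by (rule even_odd_decomposition[OF e2(1) \<delta>(1)], rule that)
  define \<Delta> where "\<Delta> x = A x * C x - x * B x * E x" for x
  have sD: "smooth_on \<Delta> {..<\<delta>\<^sup>2}"
    unfolding \<Delta>_def by (intro smooth_on_diff smooth_on_mult smooth_on_id A B C E) auto
  have "open ({..<\<delta>\<^sup>2} \<inter> \<Delta> -` (-{0}))"
    by (intro continuous_open_preimage smooth_on_imp_continuous_on[OF sD]) auto
  moreover have "0 \<in> {..<\<delta>\<^sup>2} \<inter> \<Delta> -` (-{0})"
    using \<delta>(1) CE[of 0] AB[of 0] e1(3) e2(3) by (simp add: \<Delta>_def)
  ultimately obtain \<eta> where \<eta>: "\<eta> > 0" "ball 0 \<eta> \<subseteq> {..<\<delta>\<^sup>2} \<inter> \<Delta> -` (-{0})"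
    using openE by blast
  have \<eta>_sub: "{-\<eta><..<\<eta>} \<subseteq> {..<\<delta>\<^sup>2}" and \<Delta>0: "\<And>x. x \<in> {-\<eta><..<\<eta>} \<Longrightarrow> \<Delta> x \<noteq> 0"
    using \<eta>(2) by (auto simp: ball_eq_greaterThanLessThan)
  have \<sigma>_cases: "\<sigma> = 1 \<or> \<sigma> = -1" using sg by (simp add: power2_eq_1_iff)
  define W where "W = {q :: real^3. q $ 3 \<in> {-\<eta><..<\<eta>}}"
  define V where "V = {q :: real^3. q $ 1 \<in> {-\<eta><..<\<eta>}}"
  define f :: "real^3 \<Rightarrow> real^3" where "f q = (let x = \<sigma> * q$3 in vector [x, (C x * q$2 - B x * q$1) / \<Delta> x,
      (A x * q$1 - x * E x * q$2) / \<Delta> x])" for q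
  define f' :: "real^3 \<Rightarrow> real^3" where "f' q = (let x = q$1 in vector [q$3 * C x + x * q$2 * E x, q$2 * A x + q$3 * B x, \<sigma> * x])"
    for q
  have W: "open W" and V: "open V" unfolding W_def V_def
    using continuous_open_preimage[of UNIV "\<lambda>q::real^3. q$3" "{-\<eta><..<\<eta>}"]
      continuous_open_preimage[of UNIV "\<lambda>q::real^3. q$1" "{-\<eta><..<\<eta>}"]
    by (auto simp: vimage_def continuous_on_component)
  have coord: "open S \<Longrightarrow> smooth_on (\<lambda>q::real^3. q $ i) S" for i S
    by (rule smooth_on_linear[OF _ bounded_linear_vec_nth])
  have x: "smooth_on (\<lambda>q::real^3. \<sigma> * q$3) W" by (intro smooth_on_mult smooth_on_const coord W)
  have xW: "\<sigma> * q$3 \<in> {-\<eta><..<\<eta>}" if "q \<in> W" for q using that \<sigma>_cases by (auto simp: W_def)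
  have cW: "smooth_on (\<lambda>q::real^3. F (\<sigma> * q$3)) W" if "smooth_on F {..<\<delta>\<^sup>2}" for F
    by (rule smooth_on_compose[OF W _ _ that x]) (use subsetD[OF \<eta>_sub xW] in auto)
  have cV: "smooth_on (\<lambda>q::real^3. F (q$1)) V" if "smooth_on F {..<\<delta>\<^sup>2}" for F
    by (rule smooth_on_compose[OF V _ _ that coord[OF V]]) (use subsetD[OF \<eta>_sub] in \<open>auto simp: V_def\<close>)
  have sf: "smooth_on f W"
    unfolding f_def Let_def
    by (intro smooth_on_vector3 smooth_on_divide smooth_on_diff smooth_on_mult x coord W cW A B C E sD)
      (use xW \<Delta>0 in auto)
  have sf': "smooth_on f' V"
    unfolding f'_def Let_def
    by (intro smooth_on_vector3 smooth_on_add smooth_on_mult smooth_on_const coord V cV A B C E)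
  have ff: "f' q \<in> W \<and> f (f' q) = q" if q: "q \<in> V" for q
  proof -
    have s: "\<sigma> * (\<sigma> * x) = x" for x using sg by (simp add: power2_eq_square flip: mult.assoc)
    have "\<Delta> (q$1) \<noteq> 0" using q \<Delta>0 by (simp add: V_def)
    moreover have "C x * (y * A x + z * B x) - B x * (z * C x + x * y * E x) = y * \<Delta> x"
      "A x * (z * C x + x * y * E x) - x * E x * (y * A x + z * B x) = z * \<Delta> x" for x y z
      by (simp_all add: \<Delta>_def algebra_simps)
    ultimately have "f (f' q) = q" by (simp add: f_def f'_def Let_def s vec_eq_iff forall_3)
    moreover have "f' q \<in> W" using q \<sigma>_cases by (auto simp: W_def V_def f'_def Let_def)
    ultimately show ?thesis by simp
  qed
  have ff': "f q \<in> V \<and> f' (f q) = q" if q: "q \<in> W" for q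
  proof -
    have s: "\<sigma> * (\<sigma> * x) = x" for x using sg by (simp add: power2_eq_square flip: mult.assoc)
    define x where "x = \<sigma> * q$3"
    have D: "\<Delta> x \<noteq> 0" using q \<Delta>0 xW by (simp add: x_def)
    have "(A x * p - x * E x * r) / \<Delta> x * C x + x * ((C x * r - B x * p) / \<Delta> x) * E x = p"
      "(C x * r - B x * p) / \<Delta> x * A x + (A x * p - x * E x * r) / \<Delta> x * B x = r" for p r
    proof -
      have "(A x * p - x * E x * r) * C x + x * (C x * r - B x * p) * E x = p * \<Delta> x"
        "(C x * r - B x * p) * A x + (A x * p - x * E x * r) * B x = r * \<Delta> x"
        by (simp_all add: \<Delta>_def algebra_simps)
      then show "(A x * p - x * E x * r) / \<Delta> x * C x + x * ((C x * r - B x * p) / \<Delta> x) * E x = p"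
        "(C x * r - B x * p) / \<Delta> x * A x + (A x * p - x * E x * r) / \<Delta> x * B x = r"
        using D by (simp_all add: add_divide_distrib[symmetric])
    qed
    then have "f' (f q) = q"
      by (simp add: f_def f'_def Let_def s x_def[symmetric] vec_eq_iff forall_3) (simp add: x_def s)
    moreover have "f q \<in> V" using xW[OF q] by (simp add: V_def f_def Let_def)
    ultimately show ?thesis by simp
  qed
  have f_curve: "f (c u) = vector [(\<kappa> u)\<^sup>2, (\<kappa> u)^3, (\<kappa> u)^4]"
    if u: "u \<in> {-b<..<b}" and small: "\<kappa> u \<in> {-\<delta><..<\<delta>}" "(\<kappa> u)\<^sup>2 < \<eta>" for u
  proof -
    define v where "v = \<kappa> u"
    have x: "\<sigma> * c u $ 3 = v\<^sup>2" using c3[OF u] sg by (simp add: v_def power2_eq_square flip: mult.assoc)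
    have "v\<^sup>2 \<in> {-\<eta><..<\<eta>}" using small \<eta>(1)
      by (auto simp: v_def intro: less_le_trans[of _ 0])
    then have D: "\<Delta> (v\<^sup>2) \<noteq> 0" using \<Delta>0 by blast
    have y: "c u $ 2 = v^3 * (A (v\<^sup>2) + v * B (v\<^sup>2))" "c u $ 1 = v^4 * (C (v\<^sup>2) + v * E (v\<^sup>2))"
      using e1(2)[OF small(1)] e2(2)[OF small(1)] AB[OF small(1)] CE[OF small(1)] gk[OF u]
      by (simp_all add: v_def)
    have "C (v\<^sup>2) * c u $ 2 - B (v\<^sup>2) * c u $ 1 = v^3 * \<Delta> (v\<^sup>2)"
      "A (v\<^sup>2) * c u $ 1 - v\<^sup>2 * E (v\<^sup>2) * c u $ 2 = v^4 * \<Delta> (v\<^sup>2)"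
      unfolding y \<Delta>_def by (simp_all add: algebra_simps power_numeral_reduce)
    then show ?thesis using D unfolding f_def Let_def x by (simp add: v_def)
  qed
  \<comment> \<open>The even-odd decompositions hold only for small \<open>\<kappa>\<close>, so the arc is shortened once more.\<close>
  obtain a where a: "0 < a" "a \<le> b" and asm: "\<And>u. u \<in> {-a<..<a} \<Longrightarrow> \<kappa> u \<in> {-\<delta><..<\<delta>} \<and> (\<kappa> u)\<^sup>2 < \<eta>"
  proof -
    have ck: "continuous_on {-b<..<b} \<kappa>" using hom by (simp add: homeomorphism_def)
    then have "open ({-b<..<b} \<inter> (\<lambda>u. (\<kappa> u, (\<kappa> u)\<^sup>2)) -` ({-\<delta><..<\<delta>} \<times> {..<\<eta>}))"
      by (intro continuous_open_preimage continuous_intros open_Times) auto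
    moreover have "0 \<in> {-b<..<b} \<inter> (\<lambda>u. (\<kappa> u, (\<kappa> u)\<^sup>2)) -` ({-\<delta><..<\<delta>} \<times> {..<\<eta>})"
      using b k0 \<delta> \<eta> by auto
    ultimately obtain a where "a > 0" "ball 0 a \<subseteq> {-b<..<b} \<inter> (\<lambda>u. (\<kappa> u, (\<kappa> u)\<^sup>2)) -` ({-\<delta><..<\<delta>} \<times> {..<\<eta>})"
      using openE by blast
    then show ?thesis
      by (intro that[of "min a b"]) (use b in \<open>auto simp: ball_eq_greaterThanLessThan subset_iff\<close>)
  qed
  have sub: "{-a<..<a} \<subseteq> {-b<..<b}" using a by auto
  have hom': "homeomorphism {-a<..<a} (\<kappa> ` {-a<..<a}) \<kappa> g"
    using homeomorphism_of_subsets[OF hom sub] by blast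
  have eq: "\<kappa> ` {-a<..<a} = T \<inter> g -` {-a<..<a}"
    using hom sub by (force simp: homeomorphism_def)
  have T': "open (\<kappa> ` {-a<..<a})"
    unfolding eq using hom T by (intro continuous_open_preimage) (auto simp: homeomorphism_def)
  show ?thesis
    unfolding cusp_234_eq
  proof (rule curve_germ_equivalentI[OF W V diffeomorphism_openI[OF W V sf sf' ff' ff] _ a(1) hom' T' k0])
    show fc: "f (c u) = vector [(\<kappa> u)\<^sup>2, (\<kappa> u)^3, (\<kappa> u)^4]" if "u \<in> {-a<..<a}" for u
      using f_curve asm[OF that] sub that by blast
    show "f (c 0) = 0" using fc[of 0] a(1) k0 by (simp add: vec_eq_iff forall_3)
    show "c ` {-a<..<a} \<subseteq> W"
    proof (rule image_subsetI)
      fix u assume u: "u \<in> {-a<..<a}"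
      have "\<bar>c u $ 3\<bar> = (\<kappa> u)\<^sup>2" using c3[of u] u sub \<sigma>_cases by (auto simp: abs_mult)
      then show "c u \<in> W" using asm[OF u] by (auto simp: W_def abs_less_iff)
    qed
    show "\<exists>N. open N \<and> 0 \<in> N \<and> (\<forall>v. (vector [v\<^sup>2, v^3, v^4] :: real^3) \<in> N \<longrightarrow> \<bar>v\<bar> < \<mu>)" if "\<mu> > 0" for \<mu> :: real
    proof (rule exI[of _ "{q :: real^3. q $ 1 < \<mu>\<^sup>2}"], intro conjI allI impI)
      show "open {q :: real^3. q $ 1 < \<mu>\<^sup>2}" by (simp add: open_halfspace_component_lt_cart)
      show "\<bar>v\<bar> < \<mu>" if "vector [v\<^sup>2, v^3, v^4] \<in> {q :: real^3. q $ 1 < \<mu>\<^sup>2}" for v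
        using that power2_less_imp_less[of "\<bar>v\<bar>" \<mu>] \<open>\<mu> > 0\<close> by simp
    qed (use that in auto)
  qed
qed


section \<open>Minkowski geometry\<close>

text \<open>Enumerations of the index type run through \<open>1, 2, 3, 4\<close>; their last member is the time index.\<close>

lemma four_eq_zero: "(4::4) = 0" by simp

lemma det_4:
  fixes A :: "'a::comm_ring_1^4^4"
  shows "det A =
    A$1$1 * A$2$2 * A$3$3 * A$4$4
    + A$1$1 * A$2$3 * A$3$4 * A$4$2
    + A$1$1 * A$2$4 * A$3$2 * A$4$3
    + A$1$2 * A$2$1 * A$3$4 * A$4$3
    + A$1$2 * A$2$3 * A$3$1 * A$4$4
    + A$1$2 * A$2$4 * A$3$3 * A$4$1
    + A$1$3 * A$2$1 * A$3$2 * A$4$4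
    + A$1$3 * A$2$2 * A$3$4 * A$4$1
    + A$1$3 * A$2$4 * A$3$1 * A$4$2
    + A$1$4 * A$2$1 * A$3$3 * A$4$2
    + A$1$4 * A$2$2 * A$3$1 * A$4$3
    + A$1$4 * A$2$3 * A$3$2 * A$4$1
    - A$1$1 * A$2$2 * A$3$4 * A$4$3
    - A$1$1 * A$2$3 * A$3$2 * A$4$4
    - A$1$1 * A$2$4 * A$3$3 * A$4$2
    - A$1$2 * A$2$1 * A$3$3 * A$4$4
    - A$1$2 * A$2$3 * A$3$4 * A$4$1
    - A$1$2 * A$2$4 * A$3$1 * A$4$3
    - A$1$3 * A$2$1 * A$3$4 * A$4$2
    - A$1$3 * A$2$2 * A$3$1 * A$4$4
    - A$1$3 * A$2$4 * A$3$2 * A$4$1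
    - A$1$4 * A$2$1 * A$3$2 * A$4$3
    - A$1$4 * A$2$2 * A$3$3 * A$4$1
    - A$1$4 * A$2$3 * A$3$1 * A$4$2"
proof -
  have f1234: "finite {2::4, 3, 4}" "1 \<notin> {2::4, 3, 4}" by auto
  have f234: "finite {3::4, 4}" "2 \<notin> {3::4, 4}" by auto
  have f34: "finite {4::4}" "3 \<notin> {4::4}" by auto
  show ?thesis
    unfolding det_def UNIV_4
    unfolding sum_over_permutations_insert[OF f1234]
    unfolding sum_over_permutations_insert[OF f234]
    unfolding sum_over_permutations_insert[OF f34]
    unfolding permutes_sing
    by (simp add: sign_swap_id permutation_swap_id permutation_compose sign_compose sign_id swap_id_eq algebra_simps)
qed

lemma bounded_bilinear_mink: "bounded_bilinear mink"
  unfolding bilinear_conv_bounded_bilinear[symmetric] bilinear_def linear_iff mink_def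
  by (auto simp: algebra_simps)

interpretation mink: bounded_bilinear mink
  by (rule bounded_bilinear_mink)

lemmas mink_simps = mink.add_left mink.add_right mink.diff_left mink.diff_right
  mink.scaleR_left mink.scaleR_right mink.minus_left mink.minus_right mink.zero_left mink.zero_right

lemma mink_commute: "mink x y = mink y x"
  by (simp add: mink_def)

lemma wedge_nth:
  "wedge x y z $ 0 = - (x$1 * (y$2 * z$3 - y$3 * z$2) - x$2 * (y$1 * z$3 - y$3 * z$1) + x$3 * (y$1 * z$2 - y$2 * z$1))"
  "wedge x y z $ 1 = - (x$0 * (y$2 * z$3 - y$3 * z$2) - x$2 * (y$0 * z$3 - y$3 * z$0) + x$3 * (y$0 * z$2 - y$2 * z$0))"
  "wedge x y z $ 2 = x$0 * (y$1 * z$3 - y$3 * z$1) - x$1 * (y$0 * z$3 - y$3 * z$0) + x$3 * (y$0 * z$1 - y$1 * z$0)"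
  "wedge x y z $ 3 = - (x$0 * (y$1 * z$2 - y$2 * z$1) - x$1 * (y$0 * z$2 - y$2 * z$0) + x$2 * (y$0 * z$1 - y$1 * z$0))"
  unfolding wedge_def by (simp_all add: det_4 axis_def four_eq_zero algebra_simps)

lemma mink_wedge_orthogonal:
  "mink (wedge x y z) x = 0" "mink (wedge x y z) y = 0" "mink (wedge x y z) z = 0"
  unfolding mink_def wedge_nth by algebra+

lemma mink_wedge_self:
  "mink (wedge x y z) (wedge x y z) =
    - (mink x x * (mink y y * mink z z - mink y z * mink y z)
       - mink x y * (mink x y * mink z z - mink y z * mink x z)
       + mink x z * (mink x y * mink y z - mink y y * mink x z))"
  unfolding mink_def wedge_nth by algebra


text \<open>With \<open>\<nu>\<close> and \<open>\<alpha>\<close> the squared lengths of the space parts of \<open>v\<close> and \<open>a\<close>, Cauchy-Schwarz yields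
  \<open>v\<^sub>0\<^sup>2 a\<^sub>0\<^sup>2 \<le> \<nu> \<alpha> \<le> \<nu> a\<^sub>0\<^sup>2\<close>, where \<open>a\<^sub>0\<^sup>2 = 1 + \<alpha> > 0\<close>.\<close>

lemma nonneg_on_timelike_complement:
  assumes "mink a a = -1" "mink v a = 0"
  shows "mink v v \<ge> 0"
proof -
  define \<sigma> where "\<sigma> = v$1 * a$1 + v$2 * a$2 + v$3 * a$3"
  define \<alpha> where "\<alpha> = (a$1)\<^sup>2 + (a$2)\<^sup>2 + (a$3)\<^sup>2"
  define \<nu> where "\<nu> = (v$1)\<^sup>2 + (v$2)\<^sup>2 + (v$3)\<^sup>2"
  have "\<nu> * \<alpha> - \<sigma>\<^sup>2 = (v$1 * a$2 - v$2 * a$1)\<^sup>2 + (v$1 * a$3 - v$3 * a$1)\<^sup>2 + (v$2 * a$3 - v$3 * a$2)\<^sup>2"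
    unfolding \<nu>_def \<alpha>_def \<sigma>_def by algebra
  then have cs: "\<sigma>\<^sup>2 \<le> \<nu> * \<alpha>" by (smt (verit) zero_le_power2)
  have "v$0 * a$0 = \<sigma>" using assms(2) by (simp add: mink_def \<sigma>_def)
  then have "(v$0)\<^sup>2 * (a$0)\<^sup>2 = \<sigma>\<^sup>2" by (metis power_mult_distrib)
  moreover have a0: "(a$0)\<^sup>2 = 1 + \<alpha>" using assms(1) by (simp add: mink_def \<alpha>_def power2_eq_square)
  moreover have "\<nu> \<ge> 0" "\<alpha> \<ge> 0" by (simp_all add: \<nu>_def \<alpha>_def)
  ultimately have "(v$0)\<^sup>2 * (1 + \<alpha>) \<le> \<nu> * (1 + \<alpha>)" using cs by (simp add: algebra_simps)
  then have "(v$0)\<^sup>2 \<le> \<nu>" using \<open>\<alpha> \<ge> 0\<close> by (simp add: mult_le_cancel_right)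
  then show ?thesis by (simp add: mink_def \<nu>_def power2_eq_square)
qed

text \<open>The map taking \<open>x\<close> to its four products with the frame has an explicit right inverse; in finite
  dimension it is therefore injective.\<close>

lemma pseudo_orthonormal_complete:
  assumes "mink a a = -1" "mink b b = 1" "mink c c = 1" "mink d d = 1"
    and "mink a b = 0" "mink a c = 0" "mink a d = 0" "mink b c = 0" "mink b d = 0" "mink c d = 0"
    and "mink x a = 0" "mink x b = 0" "mink x c = 0" "mink x d = 0"
  shows "x = 0"
proof -
  define F :: "real^4 \<Rightarrow> real^4" where
    "F x = (\<chi> i. mink x (if i = 0 then a else if i = 1 then b else if i = 2 then c else d))" for x
  have lin: "linear F" by (simp add: linear_iff F_def vec_eq_iff mink_simps)
  have "F (- q$0 *\<^sub>R a + q$1 *\<^sub>R b + q$2 *\<^sub>R c + q$3 *\<^sub>R d) = q" for q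
    using assms by (simp add: F_def vec_eq_iff forall_4 four_eq_zero mink_simps mink_commute[of b a]
        mink_commute[of c a] mink_commute[of d a] mink_commute[of c b] mink_commute[of d b] mink_commute[of d c])
  then have "surj F" unfolding surj_def by metis
  then have "inj F" using linear_surjective_imp_injective[OF lin] by simp
  moreover have "F x = F 0" using assms by (simp add: F_def vec_eq_iff mink_simps)
  ultimately show ?thesis by (simp add: inj_eq)
qed

section \<open>Charts of de Sitter space\<close>

text \<open>On the orthogonal complement of \<open>p\<close>, the tangent space of the hyperquadric at \<open>p\<close>, the map \<open>L\<close>
  is an isomorphism with inverse \<open>J\<close>; the last property identifies \<open>J \<circ> L\<close> with the orthogonal
  projection.\<close>

lemma de_Sitter_chart:
  assumes p: "mink p p = 1" and orth: "mink p a = 0" "mink p b = 0" "mink p c = 0"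
    and nd: "\<And>x. mink x p = 0 \<Longrightarrow> mink x a = 0 \<Longrightarrow> mink x b = 0 \<Longrightarrow> mink x c = 0 \<Longrightarrow> x = 0"
  defines "L \<equiv> \<lambda>x. vector [mink x a, mink x b, mink x c] :: real^3"
  obtains J where "linear L" "linear J" "\<And>q. L (J q) = q" "\<And>q. mink (J q) p = 0"
    "\<And>x. J (L x) = x - mink x p *\<^sub>R p"
proof -
  define F :: "real^4 \<Rightarrow> real^4" where
    "F x = (\<chi> i. mink x (if i = 0 then p else if i = 1 then a else if i = 2 then b else c))" for x
  have lin: "linear F" by (simp add: linear_iff F_def vec_eq_iff mink_simps)
  have "x = 0" if "F x = 0" for x
    using that nd by (simp add: F_def vec_eq_iff forall_4 four_eq_zero)
  then have "inj F" using lin linear_injective_0 by blast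
  then obtain G where G: "linear G" "\<And>x. G (F x) = x" "\<And>y. F (G y) = y"
    using linear_injective_isomorphism[OF lin] by blast
  define E :: "real^3 \<Rightarrow> real^4" where
    "E q = (\<chi> i. if i = 0 then 0 else if i = 1 then q$1 else if i = 2 then q$2 else q$3)" for q
  have linE: "linear E" by (simp add: linear_iff E_def vec_eq_iff)
  have FG: "mink (G (E q)) (if i = 0 then p else if i = 1 then a else if i = 2 then b else c) = E q $ i" for q i
    using G(3)[of "E q"] by (simp add: F_def vec_eq_iff)
  show ?thesis
  proof
    show "linear L" by (auto simp: linear_iff L_def vec_eq_iff forall_3 mink_simps)
    show "linear (\<lambda>q. G (E q))" using linear_compose[OF linE G(1)] by (simp add: o_def)
    show "L (G (E q)) = q" for q
      using FG[of q 1] FG[of q 2] FG[of q 3] by (simp add: L_def E_def vec_eq_iff forall_3)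
    show "mink (G (E q)) p = 0" for q using FG[of q 0] by (simp add: E_def)
    show "G (E (L x)) = x - mink x p *\<^sub>R p" for x
    proof -
      have "E (L x) = F (x - mink x p *\<^sub>R p)"
        using p orth by (simp add: E_def L_def F_def vec_eq_iff forall_4 four_eq_zero mink_simps)
      then show ?thesis using G(2) by simp
    qed
  qed
qed

text \<open>Near \<open>p\<close> the hyperquadric is the graph of \<open>\<surd>(1 - \<langle>y,y\<rangle>)\<close> over the orthogonal complement of \<open>p\<close>.\<close>

lemma locally_diffeomorphic_at_if_chart_germ:
  fixes D :: "real \<Rightarrow> real^4" and L :: "real^4 \<Rightarrow> real^3"
  assumes "open I" "s0 \<in> I" "continuous_on I D" "D ` I \<subseteq> de_Sitter_space"
    and L: "linear L" and J: "linear J" and LJ: "\<And>q. L (J q) = q" and Jp: "\<And>q. mink (J q) (D s0) = 0"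
    and JL: "\<And>x. J (L x) = x - mink x (D s0) *\<^sub>R D s0"
    and germ: "curve_germ_equivalent (\<lambda>u. L (D (s0 + u))) Z"
  shows "locally_diffeomorphic_at D s0 Z"
proof -
  define p where "p = D s0"
  have p: "mink p p = 1" using assms(2,4) by (auto simp: p_def de_Sitter_space_def)
  have bl: "bounded_linear L" "bounded_linear J" using L J linear_conv_bounded_linear by auto
  obtain W V f g where W: "open W" "open V" "L p \<in> W" and fg: "diffeomorphism W V f g" and f0: "f (L p) = 0"
    and ev: "\<forall>\<^sub>F \<epsilon> in at_right 0. (\<lambda>u. L (D (s0 + u))) ` {-\<epsilon><..<\<epsilon>} \<subseteq> W \<and>
      same_germ 0 (f ` (\<lambda>u. L (D (s0 + u))) ` {-\<epsilon><..<\<epsilon>}) Z"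
    using germ unfolding curve_germ_equivalent_def p_def by auto
  have hom: "homeomorphism W V f g" and smf: "smooth_map_on f W" and smg: "smooth_map_on g V"
    using fg by (auto simp: diffeomorphism_def)
  define r where "r q = mink (J q) (J q)" for q
  define \<psi>0 where "\<psi>0 q = J q + sqrt (1 - r q) *\<^sub>R p" for q
  define O3 where "O3 = {q. r q < 1}"
  have contr: "continuous_on UNIV r" unfolding r_def
    by (intro mink.continuous_on linear_continuous_on bl)
  have O3: "open O3"
    unfolding O3_def using continuous_open_preimage[OF contr open_UNIV open_lessThan[of 1]]
    by (simp add: vimage_def lessThan_def)
  have sJ: "smooth_on J O3" by (rule smooth_on_linear[OF O3 bl(2)])
  have s\<psi>0: "smooth_on \<psi>0 O3"
    unfolding \<psi>0_def r_def
    by (intro smooth_on_add smooth_on_scaleR smooth_on_sqrt smooth_on_diff smooth_on_const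
        smooth_on_bilinear[OF _ bounded_bilinear_mink] sJ O3) (auto simp: O3_def r_def)
  define W' where "W' = {x \<in> de_Sitter_space. mink x p > 0 \<and> L x \<in> W}"
  define V' where "V' = V \<inter> g -` (W \<inter> O3)"
  define \<phi> where "\<phi> x = f (L x)" for x
  define \<psi> where "\<psi> q = \<psi>0 (g q)" for q
  define OW where "OW = {x. mink x p > 0} \<inter> L -` W"
  have contp: "continuous_on UNIV (\<lambda>x. mink x p)"
    by (rule linear_continuous_on[OF mink.bounded_linear_left])
  have "open {x. mink x p > 0}"
    using continuous_open_preimage[OF contp open_UNIV open_greaterThan[of 0]]
    by (simp add: vimage_def greaterThan_def)
  moreover have "open (L -` W)"
    using continuous_open_preimage[OF linear_continuous_on[OF bl(1)] open_UNIV W(1)] by simp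
  ultimately have OW: "open OW" by (auto simp: OW_def)
  have W'_eq: "W' = de_Sitter_space \<inter> OW" by (auto simp: W'_def OW_def)
  have rL: "r (L x) = 1 - (mink x p)\<^sup>2" if "x \<in> de_Sitter_space" for x
    using that p unfolding r_def JL p_def[symmetric]
    by (simp add: de_Sitter_space_def mink_simps mink_commute[of p x] power2_eq_square)
  have \<psi>0L: "\<psi>0 (L x) = x" if "x \<in> de_Sitter_space" "mink x p > 0" for x
    using that unfolding \<psi>0_def rL[OF that(1)] JL p_def[symmetric] by simp
  have Lp0: "L p = 0"
  proof -
    have "J (L p) = 0" using JL[of p] p by (simp add: p_def)
    then show ?thesis using LJ[of "L p"] linear_0[OF L] by simp
  qed
  have \<psi>0_dS: "mink (\<psi>0 q) (\<psi>0 q) = 1" "mink (\<psi>0 q) p > 0" if "q \<in> O3" for q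
  proof -
    have "mink (J q) p = 0" "mink p (J q) = 0" using Jp[of q] mink_commute by (auto simp: p_def)
    then show "mink (\<psi>0 q) (\<psi>0 q) = 1" "mink (\<psi>0 q) p > 0"
      using that p by (simp_all add: \<psi>0_def mink_simps O3_def r_def)
  qed
  have L\<psi>0: "L (\<psi>0 q) = q" for q
    using Lp0 LJ[of q] by (simp add: \<psi>0_def linear_add[OF L] linear_scale[OF L])
  have gf: "x \<in> W \<Longrightarrow> g (f x) = x" "x \<in> W \<Longrightarrow> f x \<in> V" "y \<in> V \<Longrightarrow> f (g y) = y" "y \<in> V \<Longrightarrow> g y \<in> W" for x y
    using hom by (auto simp: homeomorphism_def)
  have cg: "continuous_on V g" and cf: "continuous_on W f" using hom by (auto simp: homeomorphism_def)
  have V': "open V'" unfolding V'_def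
    by (intro continuous_open_preimage cg W open_Int O3)
  have "homeomorphism W' V' \<phi> \<psi>"
  proof (rule homeomorphismI)
    show "continuous_on W' \<phi>" unfolding \<phi>_def
      by (rule continuous_on_compose2[OF cf linear_continuous_on[OF bl(1)]]) (auto simp: W'_def)
    show "continuous_on V' \<psi>" unfolding \<psi>_def
      by (rule continuous_on_compose2[OF smooth_on_imp_continuous_on[OF s\<psi>0 O3] continuous_on_subset[OF cg]])
        (auto simp: V'_def)
    show "\<phi> ` W' \<subseteq> V'"
      using gf rL by (auto simp: \<phi>_def W'_def V'_def O3_def)
    show "\<psi> ` V' \<subseteq> W'"
      using \<psi>0_dS L\<psi>0 by (auto simp: \<psi>_def W'_def V'_def de_Sitter_space_def)
    show "\<psi> (\<phi> x) = x" if "x \<in> W'" for x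
      using that gf \<psi>0L by (auto simp: \<phi>_def \<psi>_def W'_def)
    show "\<phi> (\<psi> q) = q" if "q \<in> V'" for q
      using that gf L\<psi>0 by (auto simp: \<phi>_def \<psi>_def V'_def)
  qed
  moreover have "smooth_map_on \<phi> W'"
    unfolding smooth_map_on_def
  proof
    fix x assume x: "x \<in> W'"
    then obtain A h where A: "open A" "L x \<in> A" "smooth_on h A" "\<forall>y\<in>W \<inter> A. h y = f y"
      using smf unfolding smooth_map_on_def W'_def by blast
    have oA: "open (L -` A)"
      using continuous_open_preimage[OF linear_continuous_on[OF bl(1)] open_UNIV A(1)] by simp
    have "smooth_on (\<lambda>x. h (L x)) (L -` A)"
      by (rule smooth_on_compose[OF oA A(1) _ A(3) smooth_on_linear[OF oA bl(1)]]) auto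
    then show "\<exists>A g. open A \<and> x \<in> A \<and> smooth_on g A \<and> (\<forall>y\<in>W' \<inter> A. g y = \<phi> y)"
      using oA A by (intro exI[of _ "L -` A"] exI[of _ "\<lambda>x. h (L x)"]) (auto simp: W'_def \<phi>_def)
  qed
  moreover have "smooth_map_on \<psi> V'"
    unfolding smooth_map_on_def
  proof
    fix q assume q: "q \<in> V'"
    then obtain A h where A: "open A" "q \<in> A" "smooth_on h A" "\<forall>y\<in>V \<inter> A. h y = g y"
      using smg unfolding smooth_map_on_def V'_def by blast
    define A' where "A' = A \<inter> V'"
    have A': "open A'" using A(1) V' by (auto simp: A'_def)
    have "smooth_on h A'" by (rule smooth_on_subset[OF A(3,1) A']) (auto simp: A'_def)
    moreover have "h ` A' \<subseteq> O3" using A(4) by (auto simp: A'_def V'_def)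
    ultimately have "smooth_on (\<lambda>q. \<psi>0 (h q)) A'" using smooth_on_compose[OF A' O3 _ s\<psi>0] by blast
    then show "\<exists>A g. open A \<and> q \<in> A \<and> smooth_on g A \<and> (\<forall>y\<in>V' \<inter> A. g y = \<psi> y)"
      using A' A q by (intro exI[of _ A'] exI[of _ "\<lambda>q. \<psi>0 (h q)"]) (auto simp: A'_def V'_def \<psi>_def)
  qed
  ultimately have dif: "diffeomorphism W' V' \<phi> \<psi>" by (simp add: diffeomorphism_def)
  have pW': "p \<in> W'" using p W(3) by (simp add: W'_def de_Sitter_space_def)
  have "open (I \<inter> D -` OW)" by (rule continuous_open_preimage[OF assms(3,1) OW])
  moreover have "s0 \<in> I \<inter> D -` OW" using assms(2) pW' by (auto simp: W'_eq p_def)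
  ultimately obtain d where d: "d > 0" "ball s0 d \<subseteq> I \<inter> D -` OW" using openE by blast
  have "\<forall>\<^sub>F \<epsilon> in at_right 0. \<epsilon> < d"
    by (rule eventually_at_right_0I[OF d(1)])
  with ev have "\<forall>\<^sub>F \<epsilon> in at_right 0. same_germ 0 (\<phi> ` (D ` {s0-\<epsilon><..<s0+\<epsilon>} \<inter> W')) Z"
  proof eventually_elim
    fix \<epsilon> assume e: "(\<lambda>u. L (D (s0 + u))) ` {-\<epsilon><..<\<epsilon>} \<subseteq> W \<and>
      same_germ 0 (f ` (\<lambda>u. L (D (s0 + u))) ` {-\<epsilon><..<\<epsilon>}) Z" "\<epsilon> < d"
    have sh: "{s0-\<epsilon><..<s0+\<epsilon>} = (\<lambda>u. s0 + u) ` {-\<epsilon><..<\<epsilon>}"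
      by (force intro: image_eqI[of _ _ "x - s0" for x])
    have "{s0-\<epsilon><..<s0+\<epsilon>} \<subseteq> ball s0 d" using e(2) by (auto simp: dist_real_def)
    then have "D ` {s0-\<epsilon><..<s0+\<epsilon>} \<subseteq> W'" using d(2) assms(4) unfolding W'_eq by blast
    then have "\<phi> ` (D ` {s0-\<epsilon><..<s0+\<epsilon>} \<inter> W') = \<phi> ` D ` {s0-\<epsilon><..<s0+\<epsilon>}" by (simp add: Int_absorb2)
    also have "\<dots> = f ` (\<lambda>u. L (D (s0 + u))) ` {-\<epsilon><..<\<epsilon>}"
      unfolding sh by (simp add: image_image \<phi>_def)
    finally show "same_germ 0 (\<phi> ` (D ` {s0-\<epsilon><..<s0+\<epsilon>} \<inter> W')) Z" using e(1) by simp
  qed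
  moreover have "openin (top_of_set de_Sitter_space) W'" unfolding W'_eq using OW by (simp add: openin_open_Int)
  moreover have "0 \<in> V'"
  proof -
    have "\<phi> p \<in> V'" using \<open>homeomorphism W' V' \<phi> \<psi>\<close> pW' by (auto simp: homeomorphism_def)
    then show ?thesis by (simp add: \<phi>_def f0)
  qed
  moreover have "\<phi> (D s0) = 0" using f0 by (simp add: \<phi>_def p_def)
  ultimately show ?thesis
    unfolding locally_diffeomorphic_at_def using dif V' pW' p_def by blast
qed


section \<open>Curves dual to their osculating hyperplanes\<close>

primrec curve_deriv :: "nat \<Rightarrow> (real \<Rightarrow> 'b::euclidean_space) \<Rightarrow> real \<Rightarrow> 'b" where
  "curve_deriv 0 f = f"
| "curve_deriv (Suc i) f = (\<lambda>s. vector_derivative (curve_deriv i f) (at s))"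

lemma smooth_on_curve_deriv: "smooth_on f S \<Longrightarrow> open S \<Longrightarrow> smooth_on (curve_deriv i f) S"
  by (induction i) (auto intro: smooth_on_vector_derivative)

lemma curve_deriv_has_vector_derivative:
  assumes "smooth_on f S" "open S" "s \<in> S"
  shows "(curve_deriv i f has_vector_derivative curve_deriv (Suc i) f s) (at s)"
  using smooth_on_has_vector_derivative[OF smooth_on_curve_deriv[OF assms(1,2)] assms(2,3)] by simp

lemma mink_has_real_derivative:
  assumes "(f has_vector_derivative f') (at s)" "(g has_vector_derivative g') (at s)"
  shows "((\<lambda>s. mink (f s) (g s)) has_real_derivative mink f' (g s) + mink (f s) g') (at s)"
  using mink.has_vector_derivative[OF assms]
  by (simp add: has_real_derivative_iff_has_vector_derivative add.commute)

lemma smooth_on_mink: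
  "open S \<Longrightarrow> smooth_on f S \<Longrightarrow> smooth_on g S \<Longrightarrow> smooth_on (\<lambda>x. mink (f x) (g x)) S"
  by (rule smooth_on_bilinear[OF _ bounded_bilinear_mink])

lemma deriv_iterate_mink:
  assumes "smooth_on f S" "open S" "s \<in> S"
  shows "(deriv ^^ i) (\<lambda>s. mink (f s) v) s = mink (curve_deriv i f s) v"
  using assms(3)
proof (induction i arbitrary: s)
  case (Suc i)
  have "\<forall>\<^sub>F x in nhds s. (deriv ^^ i) (\<lambda>s. mink (f s) v) x = mink (curve_deriv i f x) v"
    using Suc assms(2) eventually_nhds by blast
  then have "(deriv ^^ Suc i) (\<lambda>s. mink (f s) v) s = deriv (\<lambda>x. mink (curve_deriv i f x) v) s"
    by (simp add: deriv_cong_ev)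
  also have "\<dots> = mink (curve_deriv (Suc i) f s) v"
    using DERIV_imp_deriv[OF mink_has_real_derivative[OF curve_deriv_has_vector_derivative[OF assms(1,2) Suc.prems]
      has_vector_derivative_const[of v]]] by (simp add: mink.zero_right)
  finally show ?case .
qed simp

\<comment> \<open>Otherwise the first derivatives, named \<open>curve_deriv 1 f\<close>, would be unfolded everywhere.\<close>
declare curve_deriv.simps(2) [simp del]

lemma deriv_iterate_shift:
  fixes g :: "real \<Rightarrow> real"
  shows "(deriv ^^ i) (\<lambda>u. g (a + u)) = (\<lambda>u. (deriv ^^ i) g (a + u))"
proof (induction i)
  case (Suc i)
  have "deriv (\<lambda>u. h (a + u)) u = deriv h (a + u)" for h :: "real \<Rightarrow> real" and u
    using DERIV_shift[of h _ u a] by (simp add: deriv_def add.commute)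
  with Suc show ?case by simp
qed simp

lemma derivative_eq_of_eq_on:
  fixes f g :: "real \<Rightarrow> real"
  assumes "open S" "s \<in> S" "\<And>x. x \<in> S \<Longrightarrow> f x = g x"
    and "(f has_real_derivative f') (at s)" "(g has_real_derivative g') (at s)"
  shows "f' = g'"
  using has_field_derivative_transform_within_open[OF assms(4,1,2,3)] DERIV_unique assms(5) by blast

text \<open>At each point \<open>D\<close> is a unit normal of the hyperplane spanned by \<open>T, T', T''\<close>. Differentiating the
  orthogonality relations expresses all \<open>\<langle>D\<^sup>(\<^sup>i\<^sup>), T\<^sup>(\<^sup>j\<^sup>)\<rangle>\<close> that are needed through \<open>\<langle>D, T'''\<rangle>\<close>,
  \<open>\<langle>D', T'''\<rangle>\<close> and \<open>\<langle>D, T\<^sup>(\<^sup>4\<^sup>)\<rangle>\<close>.\<close>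

locale dual_curve =
  fixes I :: "real set" and T D :: "real \<Rightarrow> real^4" and s0 :: real
  assumes open_I: "open I" and s0_I: "s0 \<in> I" and smooth_T: "smooth_on T I" and smooth_D: "smooth_on D I"
    and D_unit: "\<And>s. s \<in> I \<Longrightarrow> mink (D s) (D s) = 1"
    and D_orth: "\<And>s j. s \<in> I \<Longrightarrow> j < 3 \<Longrightarrow> mink (D s) (curve_deriv j T s) = 0"
    and nondegenerate: "\<And>x. mink x (D s0) = 0 \<Longrightarrow> (\<And>j. j < 3 \<Longrightarrow> mink x (curve_deriv j T s0) = 0) \<Longrightarrow> x = 0"
begin

definition m :: "nat \<Rightarrow> nat \<Rightarrow> real \<Rightarrow> real" where
  "m i j s = mink (curve_deriv i D s) (curve_deriv j T s)"

lemma m_has_real_derivative: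
  "s \<in> I \<Longrightarrow> (m i j has_real_derivative m (Suc i) j s + m i (Suc j) s) (at s)"
  unfolding m_def[abs_def]
  by (intro mink_has_real_derivative curve_deriv_has_vector_derivative[OF smooth_T open_I]
      curve_deriv_has_vector_derivative[OF smooth_D open_I])

lemma m_eq_0_step: "(\<And>s. s \<in> I \<Longrightarrow> m i j s = 0) \<Longrightarrow> s \<in> I \<Longrightarrow> m (Suc i) j s = - m i (Suc j) s"
  using derivative_eq_of_eq_on[OF open_I _ _ m_has_real_derivative DERIV_const, of s i j 0] by fastforce

lemma m_relations:
  assumes s: "s \<in> I"
  shows "m 0 0 s = 0" "m 0 (Suc 0) s = 0" "m 0 2 s = 0" "m 1 0 s = 0" "m 1 1 s = 0" "m 1 2 s = - m 0 3 s"
    "m 2 0 s = 0" "m 2 1 s = m 0 3 s" "m 3 0 s = - m 0 3 s"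
    "m 2 2 s = - 2 * m 1 3 s - m 0 4 s" "m 3 1 s = 3 * m 1 3 s + 2 * m 0 4 s"
    "m 4 0 s = - 4 * m 1 3 s - 3 * m 0 4 s"
proof -
  note [simp] = numeral_nat
  have z: "m 0 0 s = 0" "m 0 1 s = 0" "m 0 2 s = 0" if "s \<in> I" for s
    using D_orth[OF that, of 0] D_orth[OF that, of 1] D_orth[OF that, of 2] by (simp_all add: m_def)
  have a: "m 1 0 s = 0" "m 1 1 s = 0" "m 1 2 s = - m 0 3 s" if s: "s \<in> I" for s
    using m_eq_0_step[OF z(1) s] m_eq_0_step[OF z(2) s] m_eq_0_step[OF z(3) s] z[OF s] by simp_all
  have b: "m 2 0 s = 0" "m 2 1 s = m 0 3 s" if s: "s \<in> I" for s
    using m_eq_0_step[OF a(1) s] m_eq_0_step[OF a(2) s] a[OF s] by simp_all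
  have c: "m 3 0 s = - m 0 3 s" if s: "s \<in> I" for s
    using m_eq_0_step[OF b(1) s] b[OF s] by simp
  have d: "m 2 2 s + m 1 3 s = - (m 1 3 s + m 0 4 s)"
    using derivative_eq_of_eq_on[OF open_I s a(3) m_has_real_derivative[OF s] DERIV_minus[OF m_has_real_derivative[OF s]]]
    by simp
  have e: "m 3 1 s + m 2 2 s = m 1 3 s + m 0 4 s"
    using derivative_eq_of_eq_on[OF open_I s b(2) m_has_real_derivative[OF s] m_has_real_derivative[OF s]]
    by simp
  have f: "m 4 0 s + m 3 1 s = - (m 1 3 s + m 0 4 s)"
    using derivative_eq_of_eq_on[OF open_I s c m_has_real_derivative[OF s] DERIV_minus[OF m_has_real_derivative[OF s]]]
    by simp
  show "m 0 0 s = 0" "m 0 (Suc 0) s = 0" "m 0 2 s = 0" using z[OF s] by simp_all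
  show "m 1 0 s = 0" "m 1 1 s = 0" "m 1 2 s = - m 0 3 s" using a[OF s] .
  show "m 2 0 s = 0" "m 2 1 s = m 0 3 s" using b[OF s] .
  show "m 3 0 s = - m 0 3 s" using c[OF s] .
  show "m 2 2 s = - 2 * m 1 3 s - m 0 4 s" "m 3 1 s = 3 * m 1 3 s + 2 * m 0 4 s"
    "m 4 0 s = - 4 * m 1 3 s - 3 * m 0 4 s"
    using d e f by linarith+
qed

text \<open>Where \<open>\<langle>D, T'''\<rangle>\<close> vanishes, \<open>D'\<close> is orthogonal to \<open>D, T, T', T''\<close> and hence zero.\<close>

lemma singular_point:
  assumes "m 0 3 s0 = 0" shows "m 1 3 s0 = 0"
proof -
  have "((\<lambda>s. mink (D s) (D s)) has_real_derivative
      mink (curve_deriv 1 D s0) (D s0) + mink (D s0) (curve_deriv 1 D s0)) (at s0)"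
    using mink_has_real_derivative[OF curve_deriv_has_vector_derivative[OF smooth_D open_I s0_I, of 0]
        curve_deriv_has_vector_derivative[OF smooth_D open_I s0_I, of 0]] by simp
  from derivative_eq_of_eq_on[OF open_I s0_I D_unit this DERIV_const]
  have "mink (curve_deriv 1 D s0) (D s0) = 0" by (simp add: mink_commute)
  moreover have "mink (curve_deriv 1 D s0) (curve_deriv j T s0) = 0" if "j < 3" for j
  proof -
    consider "j = 0" | "j = 1" | "j = 2" using \<open>j < 3\<close> by linarith
    then show ?thesis using m_relations(4,5,6)[OF s0_I] assms by cases (auto simp: m_def)
  qed
  ultimately have "curve_deriv 1 D s0 = 0" using nondegenerate by blast
  then show ?thesis by (simp add: m_def mink.zero_left)
qed

definition coords :: "real \<Rightarrow> real^3" where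
  "coords u = vector [mink (D (s0 + u)) (T s0), mink (D (s0 + u)) (curve_deriv 1 T s0),
    mink (D (s0 + u)) (curve_deriv 2 T s0)]"

lemma germ_transfer:
  assumes "curve_germ_equivalent coords Z"
  shows "locally_diffeomorphic_at D s0 Z"
proof -
  let ?L = "\<lambda>x. vector [mink x (T s0), mink x (curve_deriv 1 T s0), mink x (curve_deriv 2 T s0)] :: real^3"
  have o: "mink (D s0) (T s0) = 0" "mink (D s0) (curve_deriv 1 T s0) = 0" "mink (D s0) (curve_deriv 2 T s0) = 0"
    using D_orth[OF s0_I, of 0] D_orth[OF s0_I, of 1] D_orth[OF s0_I, of 2] by simp_all
  have nd: "x = 0" if "mink x (D s0) = 0" "mink x (T s0) = 0" "mink x (curve_deriv 1 T s0) = 0"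
    "mink x (curve_deriv 2 T s0) = 0" for x
  proof (rule nondegenerate[OF that(1)])
    fix j :: nat assume "j < 3"
    then consider "j = 0" | "j = 1" | "j = 2" by linarith
    then show "mink x (curve_deriv j T s0) = 0" using that by cases simp_all
  qed
  obtain J where J: "linear ?L" "linear J" "\<And>q. ?L (J q) = q" "\<And>q. mink (J q) (D s0) = 0"
    "\<And>x. J (?L x) = x - mink x (D s0) *\<^sub>R D s0"
    by (rule de_Sitter_chart[OF D_unit[OF s0_I] o], erule (3) nd, rule that)
  show ?thesis
  proof (rule locally_diffeomorphic_at_if_chart_germ[OF open_I s0_I _ _ J(1,2)])
    show "curve_germ_equivalent (\<lambda>u. ?L (D (s0 + u))) Z" using assms by (simp add: coords_def[abs_def])
    show "continuous_on I D" by (rule smooth_on_imp_continuous_on[OF smooth_D open_I])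
    show "D ` I \<subseteq> de_Sitter_space" using D_unit by (auto simp: de_Sitter_space_def)
  qed (fact J(3) J(4) J(5))+
qed

lemma smooth_shift:
  obtains d where "d > 0" "smooth_on coords {-d<..<d}"
proof -
  obtain d where d: "d > 0" "ball s0 d \<subseteq> I" using openE[OF open_I s0_I] by blast
  have "(\<lambda>u. s0 + u) ` {-d<..<d} \<subseteq> ball s0 d" by (auto simp: dist_real_def)
  then have "smooth_on (\<lambda>u. D (s0 + u)) {-d<..<d}"
    by (intro smooth_on_compose[OF _ open_I _ smooth_D]) (use d in \<open>auto intro!: smooth_on_add smooth_on_const smooth_on_id\<close>)
  then have "smooth_on coords {-d<..<d}"
    unfolding coords_def[abs_def] by (intro smooth_on_vector3 smooth_on_mink smooth_on_const) auto
  then show ?thesis by (rule that[OF d(1)])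
qed

lemma deriv_iterate_coordinate:
  "(deriv ^^ i) (\<lambda>u. mink (D (s0 + u)) (curve_deriv j T s0)) 0 = m i j s0"
  using deriv_iterate_shift[of i "\<lambda>s. mink (D s) (curve_deriv j T s0)" s0]
    deriv_iterate_mink[OF smooth_D open_I s0_I, of i "curve_deriv j T s0"] by (simp add: m_def)

lemma regular_germ:
  assumes "m 0 3 s0 \<noteq> 0"
  shows "locally_diffeomorphic_at D s0 (span {axis 3 1})"
proof (rule germ_transfer)
  obtain d where d: "d > 0" "smooth_on coords {-d<..<d}"
    by (rule smooth_shift)
  show "curve_germ_equivalent coords (span {axis 3 1})"
  proof (rule regular_curve_germ[OF d(2,1)])
    show "coords 0 = 0"
      using D_orth[OF s0_I, of 0] D_orth[OF s0_I, of 1] D_orth[OF s0_I, of 2] by (simp add: coords_def vec_eq_iff forall_3)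
    show "deriv (\<lambda>u. coords u $ 3) 0 \<noteq> 0"
      using deriv_iterate_coordinate[of 1 2] m_relations(6)[OF s0_I] assms by (simp add: coords_def)
  qed
qed

text \<open>With \<open>b = \<langle>D, T\<^sup>(\<^sup>4\<^sup>)\<rangle>\<close> at \<open>s0\<close>, the coordinates begin with the fourth, third and second derivative
  \<open>-3b\<close>, \<open>2b\<close> and \<open>-b\<close>.\<close>

lemma cusp_germ:
  assumes "m 0 3 s0 = 0" "m 0 4 s0 \<noteq> 0"
  shows "locally_diffeomorphic_at D s0 cusp_234"
proof (rule germ_transfer)
  note rel = m_relations[OF s0_I] singular_point[OF assms(1)] assms
  obtain d where d: "d > 0" "smooth_on coords {-d<..<d}"
    by (rule smooth_shift)
  have coord: "(deriv ^^ i) (\<lambda>u. coords u $ 1) 0 = m i 0 s0"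
    "(deriv ^^ i) (\<lambda>u. coords u $ 2) 0 = m i 1 s0"
    "(deriv ^^ i) (\<lambda>u. coords u $ 3) 0 = m i 2 s0" for i
    using deriv_iterate_coordinate[of i 0] deriv_iterate_coordinate[of i 1] deriv_iterate_coordinate[of i 2]
    unfolding coords_def vector_3 curve_deriv.simps(1) by blast+
  show "curve_germ_equivalent coords cusp_234"
  proof (rule cusp_234_curve_germ[OF d(2,1)]; unfold coord)
    show "m i 0 s0 = 0" if i: "i < 4" for i
    proof -
      consider "i = 0" | "i = 1" | "i = 2" | "i = 3" using i by linarith
      then show ?thesis using rel by cases simp_all
    qed
    show "m i 1 s0 = 0" if i: "i < 3" for i
    proof -
      consider "i = 0" | "i = 1" | "i = 2" using i by linarith
      then show ?thesis using rel by cases simp_all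
    qed
    show "m i 2 s0 = 0" if i: "i < 2" for i
    proof -
      consider "i = 0" | "i = 1" using i by linarith
      then show ?thesis using rel by cases simp_all
    qed
    show "m 4 0 s0 \<noteq> 0" "m 3 1 s0 \<noteq> 0" "m 2 2 s0 \<noteq> 0" using rel by simp_all
  qed
qed

end


section \<open>The moving frame of a curve in a spacelike hypersurface\<close>

text \<open>The multiple \<open>m = n / \<langle>n, e\<^sub>0\<rangle>\<close> of the normal is the solution of the linear system
  \<open>\<langle>e\<^sub>0, m\<rangle> = 1\<close>, \<open>\<langle>\<partial>\<^sub>iX, m\<rangle> = 0\<close>, which is regular because \<open>e\<^sub>0\<close> is not tangent to the hypersurface; by
  Cramer's rule it is smooth. The factor is recovered from \<open>\<langle>n, n\<rangle> = -1\<close> and \<open>\<langle>n, e\<^sub>0\<rangle> < 0\<close>.\<close>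

lemma smooth_on_unit_normal:
  assumes hyp: "spacelike_hypersurface U X" and normal: "future_unit_normal U X n"
    and I: "open I" and smooth_\<gamma>: "smooth_on \<gamma>b I" and \<gamma>_U: "\<gamma>b ` I \<subseteq> U"
  shows "smooth_on (\<lambda>s. n (X (\<gamma>b s))) I"
proof -
  have U: "open U" and sX: "smooth_on X U" and inj: "\<And>u. u \<in> U \<Longrightarrow> inj (frechet_derivative X (at u))"
    using hyp by (auto simp: spacelike_hypersurface_def smooth_embedding_def)
  let ?e0 = "axis 0 1 :: real^4"
  define Y where "Y i s = (if i = 0 then ?e0 else frechet_derivative X (at (\<gamma>b s))
    (axis (if i = 1 then 1 else if i = 2 then 2 else 3) 1))" for i :: 4 and s
  \<comment> \<open>The signs of the metric turn the products \<open>\<langle>Y i s, m\<rangle>\<close> into a matrix applied to \<open>\<eta> m\<close>.\<close>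
  define \<eta> where "\<eta> j = (if j = 0 then -1 else 1 :: real)" for j :: 4
  define A where "A s = (\<chi> i j. Y i s $ j)" for s
  define \<nu> where "\<nu> s = n (X (\<gamma>b s))" for s
  have sY: "smooth_on (Y i) I" for i
  proof (cases "i = 0")
    case True
    then have "Y i = (\<lambda>s. ?e0)" by (auto simp: Y_def)
    then show ?thesis using smooth_on_const[OF I] by metis
  next
    case False
    then show ?thesis unfolding Y_def
      using smooth_on_compose[OF I U \<gamma>_U smooth_on_frechet_derivative[OF sX] smooth_\<gamma>] by simp
  qed
  have sA: "smooth_on (\<lambda>s. A s $ i $ j) I" for i j
    unfolding A_def using smooth_on_vec_nth[OF I sY] by simp
  have \<nu>: "mink (\<nu> s) (\<nu> s) = -1" "\<And>w. mink (\<nu> s) (frechet_derivative X (at (\<gamma>b s)) w) = 0"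
    "mink (\<nu> s) ?e0 < 0" if "s \<in> I" for s
    using normal \<gamma>_U that by (auto simp: future_unit_normal_def \<nu>_def)
  have Anz: "det (A s) \<noteq> 0" if s: "s \<in> I" for s
  proof -
    let ?dX = "frechet_derivative X (at (\<gamma>b s))"
    have lin: "linear ?dX"
      using smooth_on_differentiable[OF sX U] s \<gamma>_U linear_frechet_derivative by blast
    have ker: "x = 0" if "transpose (A s) *v x = 0" for x
    proof -
      have "(\<Sum>i\<in>UNIV. x $ i *\<^sub>R Y i s) = 0"
        using that by (simp add: vec_eq_iff matrix_vector_mult_def transpose_def A_def mult.commute)
      moreover define w :: "real^3" where "w = x$1 *\<^sub>R axis 1 1 + x$2 *\<^sub>R axis 2 1 + x$3 *\<^sub>R axis 3 1"
      have "?dX w = x$1 *\<^sub>R Y 1 s + x$2 *\<^sub>R Y 2 s + x$3 *\<^sub>R Y 3 s"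
        by (simp add: w_def linear_add[OF lin] linear_scale[OF lin] Y_def)
      ultimately have sum: "x$0 *\<^sub>R ?e0 + ?dX w = 0"
        by (simp add: sum_4 four_eq_zero Y_def algebra_simps)
      then have "mink (\<nu> s) (x$0 *\<^sub>R ?e0 + ?dX w) = 0" by (simp add: mink_simps)
      then have x0: "x$0 = 0" using \<nu>[OF s] by (simp add: mink_simps)
      then have "?dX w = ?dX 0" using sum linear_0[OF lin] by simp
      then have "w = 0" using inj s \<gamma>_U by (meson image_subset_iff injD)
      then show "x = 0" using x0
        by (simp add: w_def vec_eq_iff forall_3 forall_4 four_eq_zero axis_def)
    qed
    have "\<exists>B. B ** transpose (A s) = mat 1"
      unfolding matrix_left_invertible_ker using ker by blast
    then have "invertible (transpose (A s))" by (simp add: invertible_left_inverse)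
    then show ?thesis by (simp add: invertible_det_nz det_transpose)
  qed
  define m where "m s = (\<chi> k. \<eta> k * (det (\<chi> i j. if j = k then axis 0 1 $ i else A s $ i $ j) / det (A s)))" for s
  have sm: "smooth_on m I" unfolding m_def
  proof (intro smooth_on_vec_lambda smooth_on_mult smooth_on_divide smooth_on_det smooth_on_const I sA Anz)
    show "smooth_on (\<lambda>x. (\<chi> i j. if j = k then axis 0 1 $ i else A x $ i $ j) $ i $ j) I" for i j k
      using sA[of i j] smooth_on_const[OF I] by (cases "j = k") simp_all
  qed
  have m_eq: "m s = (1 / mink (\<nu> s) ?e0) *\<^sub>R \<nu> s" if s: "s \<in> I" for s
  proof -
    let ?k = "1 / mink (\<nu> s) ?e0"
    have Y: "mink (\<nu> s) (Y i s) = (if i = 0 then mink (\<nu> s) ?e0 else 0)" for i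
      using \<nu>(2)[OF s] by (simp add: Y_def)
    have AY: "(A s *v (\<chi> j. \<eta> j * k * \<nu> s $ j)) $ i = k * mink (\<nu> s) (Y i s)" for i k
      by (simp add: matrix_vector_mult_def sum_4 four_eq_zero A_def \<eta>_def mink_def algebra_simps)
    have "(A s *v (\<chi> j. \<eta> j * ?k * \<nu> s $ j)) $ i = axis 0 1 $ i" for i
      unfolding AY Y using \<nu>(3)[OF s] by (cases "i = 0") (simp_all add: axis_nth, simp add: axis_def)
    then have "A s *v (\<chi> j. \<eta> j * ?k * \<nu> s $ j) = axis 0 1"
      unfolding vec_eq_iff by blast
    then have "(\<chi> j. \<eta> j * ?k * \<nu> s $ j) = (\<chi> k. det (\<chi> i j. if j = k then axis 0 1 $ i else A s $ i $ j) / det (A s))"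
      using cramer[OF Anz[OF s]] by blast
    then have "det (\<chi> i j. if j = k then axis 0 1 $ i else A s $ i $ j) / det (A s) = \<eta> k * ?k * \<nu> s $ k" for k
      by (simp add: vec_eq_iff)
    then have "m s $ k = ?k * \<nu> s $ k" for k by (simp add: m_def \<eta>_def)
    then show ?thesis by (simp add: vec_eq_iff)
  qed
  have mm: "- mink (m s) (m s) = (1 / mink (\<nu> s) ?e0)\<^sup>2" if "s \<in> I" for s
    using \<nu>(1)[OF that] by (simp add: m_eq[OF that] mink_simps power2_eq_square)
  have "smooth_on (\<lambda>s. - (1 / sqrt (- mink (m s) (m s))) *\<^sub>R m s) I"
  proof (intro smooth_on_scaleR smooth_on_uminus smooth_on_divide smooth_on_const smooth_on_sqrt smooth_on_mink sm I)
    show pos: "- mink (m s) (m s) > 0" if "s \<in> I" for s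
      using mm[OF that] \<nu>(3)[OF that] by simp
    show "sqrt (- mink (m s) (m s)) \<noteq> 0" if "s \<in> I" for s
      using pos[OF that] by simp
  qed
  moreover have "- (1 / sqrt (- mink (m s) (m s))) *\<^sub>R m s = n (X (\<gamma>b s))" if "s \<in> I" for s
  proof -
    have "sqrt (- mink (m s) (m s)) = - (1 / mink (\<nu> s) ?e0)"
      using \<nu>(3)[OF that] by (simp add: mm[OF that])
    then show ?thesis using \<nu>(3)[OF that] by (simp add: m_eq[OF that]) (simp add: \<nu>_def)
  qed
  ultimately show ?thesis
    using smooth_on_cong[OF I, of "\<lambda>s. - (1 / sqrt (- mink (m s) (m s))) *\<^sub>R m s" "\<lambda>s. n (X (\<gamma>b s))"] by blast
qed

lemma smooth_on_wedge:
  assumes "open S" "smooth_on x S" "smooth_on y S" "smooth_on z S"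
  shows "smooth_on (\<lambda>s. wedge (x s) (y s) (z s)) S"
  unfolding wedge_def
proof (intro smooth_on_vec_lambda smooth_on_det assms(1))
  fix i r j :: 4
  show "smooth_on (\<lambda>s. (\<chi> r. if r = 0 then axis i (if i = 0 then - 1 else 1) else if r = 1 then x s
      else if r = 2 then y s else z s) $ r $ j) S"
    using smooth_on_const[OF assms(1)] smooth_on_vec_nth[OF assms(1)] assms(2-4)
    by (cases "r = 0"; cases "r = 1"; cases "r = 2") auto
qed

lemma mink_derivative_of_constant:
  assumes "open I" "s \<in> I" "smooth_on f I" "smooth_on g I" "\<And>s. s \<in> I \<Longrightarrow> mink (f s) (g s) = c"
  shows "mink (vector_derivative f (at s)) (g s) = - mink (f s) (vector_derivative g (at s))"
proof -
  have "mink (vector_derivative f (at s)) (g s) + mink (f s) (vector_derivative g (at s)) = 0"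
    by (rule derivative_eq_of_eq_on[OF assms(1,2,5) mink_has_real_derivative DERIV_const])
      (auto intro: smooth_on_has_vector_derivative[OF assms(3,1,2)] smooth_on_has_vector_derivative[OF assms(4,1,2)])
  then show ?thesis by simp
qed

locale hypersurface_curve =
  fixes U :: "(real^3) set" and X :: "real^3 \<Rightarrow> real^4" and n :: "real^4 \<Rightarrow> real^4"
    and I :: "real set" and \<gamma>b :: "real \<Rightarrow> real^3" and \<gamma> :: "real \<Rightarrow> real^4"
  assumes hypersurface: "spacelike_hypersurface U X" and normal: "future_unit_normal U X n"
    and open_I: "open I" and smooth_\<gamma>b: "smooth_on \<gamma>b I" and \<gamma>b_U: "\<gamma>b ` I \<subseteq> U"
    and \<gamma>_eq: "\<forall>s\<in>I. \<gamma> s = X (\<gamma>b s)"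
    and unit_speed: "\<forall>s\<in>I. mink_norm (tangent \<gamma> s) = 1"
    and kg_nz: "\<forall>s\<in>I. k_g n \<gamma> s \<noteq> 0"
    and \<mu>_nz: "\<forall>s\<in>I. k_n n \<gamma> s * tau_2 n \<gamma> s + k_g n \<gamma> s * tau_g n \<gamma> s \<noteq> 0"
    and kn_kg: "\<forall>s\<in>I. (k_n n \<gamma> s)\<^sup>2 > (k_g n \<gamma> s)\<^sup>2"
begin

abbreviation "T \<equiv> tangent \<gamma>"
abbreviation "N \<equiv> nrm n \<gamma>"
abbreviation "kn \<equiv> k_n n \<gamma>"
abbreviation "kg \<equiv> k_g n \<gamma>"
abbreviation "E1 \<equiv> n1 n \<gamma>"
abbreviation "E2 \<equiv> n2 n \<gamma>"
abbreviation "\<mu> s \<equiv> kn s * tau_2 n \<gamma> s + kg s * tau_g n \<gamma> s"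
abbreviation "\<Delta> s \<equiv> (kn s)\<^sup>2 - (kg s)\<^sup>2"

lemma smooth_N: "smooth_on N I"
proof -
  have "N s = n (X (\<gamma>b s))" if "s \<in> I" for s using \<gamma>_eq that by (simp add: nrm_def)
  then show ?thesis
    using smooth_on_unit_normal[OF hypersurface normal open_I smooth_\<gamma>b \<gamma>b_U]
      smooth_on_cong[OF open_I, of "\<lambda>s. n (X (\<gamma>b s))" N] by simp
qed

lemma smooth_\<gamma>: "smooth_on \<gamma> I"
proof -
  have "open U" "smooth_on X U" using hypersurface by (auto simp: spacelike_hypersurface_def smooth_embedding_def)
  then have "smooth_on (\<lambda>s. X (\<gamma>b s)) I"
    using smooth_on_compose[OF open_I _ \<gamma>b_U] smooth_\<gamma>b by blast
  then show ?thesis using smooth_on_cong[OF open_I, of "\<lambda>s. X (\<gamma>b s)" \<gamma>] \<gamma>_eq by simp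
qed

lemma smooth_T: "smooth_on T I"
  unfolding tangent_def[abs_def] by (rule smooth_on_vector_derivative[OF smooth_\<gamma> open_I])

lemma T_derivative: "vector_derivative T (at s) = curve_deriv 1 T s"
  by (simp add: curve_deriv.simps(2))

lemma mink_N_N: "s \<in> I \<Longrightarrow> mink (N s) (N s) = -1"
  using normal \<gamma>b_U \<gamma>_eq by (auto simp: future_unit_normal_def nrm_def)

lemma mink_N_T:
  assumes s: "s \<in> I" shows "mink (N s) (T s) = 0"
proof -
  have U: "open U" "smooth_on X U" using hypersurface by (auto simp: spacelike_hypersurface_def smooth_embedding_def)
  have u: "\<gamma>b s \<in> U" using s \<gamma>b_U by auto
  have dX: "(X has_derivative frechet_derivative X (at (\<gamma>b s))) (at (\<gamma>b s))"
    using smooth_on_differentiable[OF U(2,1) u] frechet_derivative_works by blast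
  have "((X \<circ> \<gamma>b) has_vector_derivative frechet_derivative X (at (\<gamma>b s)) (vector_derivative \<gamma>b (at s))) (at s)"
    by (rule vector_derivative_diff_chain_within[OF smooth_on_has_vector_derivative[OF smooth_\<gamma>b open_I s]])
      (rule has_derivative_at_withinI[OF dX])
  then have "(\<gamma> has_vector_derivative frechet_derivative X (at (\<gamma>b s)) (vector_derivative \<gamma>b (at s))) (at s)"
    by (rule has_vector_derivative_transform_within_open[OF _ open_I s]) (use \<gamma>_eq in auto)
  then have "T s = frechet_derivative X (at (\<gamma>b s)) (vector_derivative \<gamma>b (at s))"
    by (simp add: tangent_def vector_derivative_at)
  then show ?thesis using normal u \<gamma>_eq s by (simp add: future_unit_normal_def nrm_def)
qed

text \<open>Unit speed fixes the absolute value only; the sign comes from the timelike normal \<open>N\<close>.\<close>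

lemma mink_T_T:
  assumes s: "s \<in> I" shows "mink (T s) (T s) = 1"
proof -
  have "mink (T s) (T s) \<ge> 0"
    using nonneg_on_timelike_complement[OF mink_N_N[OF s]] mink_N_T[OF s] mink_commute by metis
  moreover have "\<bar>mink (T s) (T s)\<bar> = 1" using unit_speed s by (simp add: mink_norm_def)
  ultimately show ?thesis by simp
qed

lemma mink_dT_T: "s \<in> I \<Longrightarrow> mink (curve_deriv 1 T s) (T s) = 0"
  using mink_derivative_of_constant[OF open_I _ smooth_T smooth_T mink_T_T, of s]
  by (simp add: T_derivative mink_commute)

text \<open>The part of \<open>T'\<close> that is tangent to the hypersurface.\<close>

definition V where "V s = curve_deriv 1 T s - kn s *\<^sub>R N s"

lemma smooth_kn: "smooth_on kn I"
  unfolding k_n_def[abs_def]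
  by (intro smooth_on_uminus smooth_on_mink smooth_N smooth_on_vector_derivative smooth_T open_I)

lemma smooth_V: "smooth_on V I"
  unfolding V_def[abs_def]
  by (intro smooth_on_diff smooth_on_scaleR smooth_on_curve_deriv smooth_T smooth_kn smooth_N open_I)

lemma mink_V:
  assumes s: "s \<in> I"
  shows "mink (V s) (N s) = 0" "mink (V s) (T s) = 0" "mink (V s) (V s) > 0" "kg s = sqrt (mink (V s) (V s))"
proof -
  have "mink (curve_deriv 1 T s) (N s) = - kn s" by (simp add: k_n_def T_derivative mink_commute)
  then show VN: "mink (V s) (N s) = 0"
    using mink_N_N[OF s] unfolding V_def by (simp add: mink_simps)
  show "mink (V s) (T s) = 0"
    using mink_N_T[OF s] mink_dT_T[OF s] by (simp add: V_def mink_simps)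
  have nn: "mink (V s) (V s) \<ge> 0" by (rule nonneg_on_timelike_complement[OF mink_N_N[OF s] VN])
  then show kg: "kg s = sqrt (mink (V s) (V s))" by (simp add: k_g_def mink_norm_def V_def T_derivative)
  show "mink (V s) (V s) > 0" using nn kg kg_nz s by (metis less_eq_real_def real_sqrt_zero)
qed

lemma smooth_kg: "smooth_on kg I"
proof -
  have "smooth_on (\<lambda>s. sqrt (mink (V s) (V s))) I"
    by (intro smooth_on_sqrt smooth_on_mink smooth_V open_I mink_V(3))
  then show ?thesis using smooth_on_cong[OF open_I, of "\<lambda>s. sqrt (mink (V s) (V s))" kg] mink_V(4) by simp
qed

lemma E1_eq: "E1 s = inverse (kg s) *\<^sub>R V s"
  by (simp add: n1_def V_def T_derivative)

lemma dT_eq: "s \<in> I \<Longrightarrow> curve_deriv 1 T s = kn s *\<^sub>R N s + kg s *\<^sub>R E1 s"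
  using kg_nz by (simp add: E1_eq V_def)

lemma smooth_E1: "smooth_on E1 I"
  unfolding E1_eq[abs_def] using kg_nz by (intro smooth_on_scaleR smooth_on_inverse smooth_kg smooth_V open_I) auto

lemma smooth_E2: "smooth_on E2 I"
  unfolding n2_def[abs_def] by (intro smooth_on_wedge smooth_N smooth_T smooth_E1 open_I)

lemma frame:
  assumes s: "s \<in> I"
  shows "mink (N s) (N s) = -1" "mink (T s) (T s) = 1" "mink (E1 s) (E1 s) = 1" "mink (E2 s) (E2 s) = 1"
    "mink (N s) (T s) = 0" "mink (N s) (E1 s) = 0" "mink (N s) (E2 s) = 0"
    "mink (T s) (E1 s) = 0" "mink (T s) (E2 s) = 0" "mink (E1 s) (E2 s) = 0"
    "mink (T s) (N s) = 0" "mink (E1 s) (N s) = 0" "mink (E2 s) (N s) = 0"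
    "mink (E1 s) (T s) = 0" "mink (E2 s) (T s) = 0" "mink (E2 s) (E1 s) = 0"
proof -
  note V = mink_V[OF s]
  show NN: "mink (N s) (N s) = -1" and TT: "mink (T s) (T s) = 1" and NT: "mink (N s) (T s) = 0"
    using mink_N_N mink_T_T mink_N_T s by auto
  have "(kg s)\<^sup>2 = mink (V s) (V s)" using V(3,4) by simp
  then show EE: "mink (E1 s) (E1 s) = 1"
    using kg_nz s V(3) by (simp add: E1_eq mink_simps power2_eq_square field_simps)
  show EN: "mink (E1 s) (N s) = 0" and ET: "mink (E1 s) (T s) = 0"
    using V by (simp_all add: E1_eq mink_simps)
  show TN: "mink (T s) (N s) = 0" "mink (N s) (E1 s) = 0" "mink (T s) (E1 s) = 0"
    using NT EN ET by (simp_all add: mink_commute)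
  show "mink (E2 s) (N s) = 0" "mink (E2 s) (T s) = 0" "mink (E2 s) (E1 s) = 0"
    by (simp_all add: n2_def mink_wedge_orthogonal)
  then show "mink (N s) (E2 s) = 0" "mink (T s) (E2 s) = 0" "mink (E1 s) (E2 s) = 0"
    by (simp_all add: mink_commute)
  show "mink (E2 s) (E2 s) = 1"
    using NN TT EE NT TN by (simp add: n2_def mink_wedge_self)
qed

text \<open>In the plane of \<open>N\<close> and \<open>E1\<close> this is the direction orthogonal to \<open>T'\<close>.\<close>

definition W where "W s = kg s *\<^sub>R N s + kn s *\<^sub>R E1 s"

text \<open>Since \<open>T'\<close> is orthogonal to \<open>W\<close> and to \<open>E2\<close>, the products of \<open>T''\<close> with these are \<open>-\<langle>T', W'\<rangle>\<close> and
  \<open>-\<langle>T', E2'\<rangle>\<close>; this takes only first derivatives of the frame.\<close>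

lemma mink_ddT:
  assumes s: "s \<in> I"
  shows "mink (curve_deriv 2 T s) (W s) = - lambda_0 n \<gamma> s" "mink (curve_deriv 2 T s) (E2 s) = \<mu> s"
proof -
  let ?d = "\<lambda>f. vector_derivative f (at s)"
  have sW: "smooth_on W I" unfolding W_def[abs_def]
    by (intro smooth_on_add smooth_on_scaleR smooth_kg smooth_kn smooth_N smooth_E1 open_I)
  have s1: "smooth_on (curve_deriv 1 T) I" by (rule smooth_on_curve_deriv[OF smooth_T open_I])
  have d2: "?d (curve_deriv 1 T) = curve_deriv 2 T s" by (simp add: numeral_2_eq_2 curve_deriv.simps(2))
  have TW: "mink (curve_deriv 1 T s) (W s) = 0" if "s \<in> I" for s
    using frame[OF that] unfolding dT_eq[OF that] W_def by (simp add: mink_simps)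
  have TE: "mink (curve_deriv 1 T s) (E2 s) = 0" if "s \<in> I" for s
    using frame[OF that] unfolding dT_eq[OF that] by (simp add: mink_simps)
  have "(W has_vector_derivative (kg s *\<^sub>R ?d N + deriv kg s *\<^sub>R N s) + (kn s *\<^sub>R ?d E1 + deriv kn s *\<^sub>R E1 s)) (at s)"
    unfolding W_def[abs_def]
    by (intro has_vector_derivative_add has_vector_derivative_scaleR smooth_on_has_vector_derivative[OF smooth_N open_I s]
        smooth_on_has_vector_derivative[OF smooth_E1 open_I s] smooth_on_has_real_derivative[OF smooth_kg open_I s]
        smooth_on_has_real_derivative[OF smooth_kn open_I s])
  then have dW: "?d W = (kg s *\<^sub>R ?d N + deriv kg s *\<^sub>R N s) + (kn s *\<^sub>R ?d E1 + deriv kn s *\<^sub>R E1 s)"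
    by (rule vector_derivative_at)
  have NdN: "mink (N s) (?d N) = 0"
    using mink_derivative_of_constant[OF open_I s smooth_N smooth_N frame(1)] by (simp add: mink_commute)
  have EdE: "mink (E1 s) (?d E1) = 0"
    using mink_derivative_of_constant[OF open_I s smooth_E1 smooth_E1 frame(3)] by (simp add: mink_commute)
  have NdE: "mink (N s) (?d E1) = - tau_1 n \<gamma> s"
    using mink_derivative_of_constant[OF open_I s smooth_N smooth_E1 frame(6)] by (simp add: mink_commute tau_1_def)
  have EdN: "mink (E1 s) (?d N) = tau_1 n \<gamma> s" by (simp add: tau_1_def)
  have "mink (curve_deriv 2 T s) (W s) = - mink (curve_deriv 1 T s) (?d W)"
    using mink_derivative_of_constant[OF open_I s s1 sW TW] unfolding d2 .
  also have "\<dots> = - lambda_0 n \<gamma> s"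
    using frame[OF s] NdN EdE NdE EdN unfolding dW dT_eq[OF s]
    by (simp add: mink_simps lambda_0_def power2_eq_square algebra_simps)
  finally show "mink (curve_deriv 2 T s) (W s) = - lambda_0 n \<gamma> s" .
  have NdE2: "mink (N s) (?d E2) = - tau_2 n \<gamma> s"
    using mink_derivative_of_constant[OF open_I s smooth_N smooth_E2 frame(7)] by (simp add: mink_commute tau_2_def)
  have E1dE2: "mink (E1 s) (?d E2) = - tau_g n \<gamma> s" by (simp add: tau_g_def mink_commute)
  have "mink (curve_deriv 2 T s) (E2 s) = - mink (curve_deriv 1 T s) (?d E2)"
    using mink_derivative_of_constant[OF open_I s s1 smooth_E2 TE] unfolding d2 .
  also have "\<dots> = \<mu> s"
    using NdE2 E1dE2 unfolding dT_eq[OF s] by (simp add: mink_simps)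
  finally show "mink (curve_deriv 2 T s) (E2 s) = \<mu> s" .
qed

lemma \<Delta>_pos: "s \<in> I \<Longrightarrow> \<Delta> s > 0"
  using kn_kg by simp

lemma DS_eq: "DS n \<gamma> s \<phi> = (cos \<phi> / sqrt (\<Delta> s)) *\<^sub>R W s + sin \<phi> *\<^sub>R E2 s"
  by (simp add: DS_def W_def)

lemma mink_DS:
  assumes s: "s \<in> I"
  shows "mink (DS n \<gamma> s \<phi>) (DS n \<gamma> s \<phi>) = 1" "mink (T s) (DS n \<gamma> s \<phi>) = 0"
    "mink (curve_deriv 1 T s) (DS n \<gamma> s \<phi>) = 0"
    "mink (curve_deriv 2 T s) (DS n \<gamma> s \<phi>) = sin \<phi> * \<mu> s - cos \<phi> / sqrt (\<Delta> s) * lambda_0 n \<gamma> s"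
proof -
  note f = frame[OF s]
  have WW: "mink (W s) (W s) = \<Delta> s" "mink (W s) (E2 s) = 0" "mink (E2 s) (W s) = 0"
    using f by (simp_all add: W_def mink_simps power2_eq_square)
  have "(cos \<phi> / sqrt (\<Delta> s)) * ((cos \<phi> / sqrt (\<Delta> s)) * \<Delta> s) = (cos \<phi>)\<^sup>2"
    using \<Delta>_pos[OF s] by (simp add: power2_eq_square)
  then show "mink (DS n \<gamma> s \<phi>) (DS n \<gamma> s \<phi>) = 1"
    using f(4) by (simp add: DS_eq mink_simps WW flip: power2_eq_square)
  show "mink (T s) (DS n \<gamma> s \<phi>) = 0" using f by (simp add: DS_eq W_def mink_simps)
  show "mink (curve_deriv 1 T s) (DS n \<gamma> s \<phi>) = 0"
    using f unfolding dT_eq[OF s] by (simp add: DS_eq W_def mink_simps)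
  show "mink (curve_deriv 2 T s) (DS n \<gamma> s \<phi>) = sin \<phi> * \<mu> s - cos \<phi> / sqrt (\<Delta> s) * lambda_0 n \<gamma> s"
    using mink_ddT[OF s] by (simp add: DS_eq mink_simps)
qed

lemma frame_expansion:
  assumes s: "s \<in> I"
  shows "y = - mink y (N s) *\<^sub>R N s + mink y (T s) *\<^sub>R T s + mink y (E1 s) *\<^sub>R E1 s + mink y (E2 s) *\<^sub>R E2 s"
    (is "y = ?r")
proof -
  have "y - ?r = 0"
    by (rule pseudo_orthonormal_complete[OF frame(1-10)[OF s]]) (use frame[OF s] in \<open>simp_all add: mink_simps\<close>)
  then show ?thesis by simp
qed

context
  fixes \<theta> :: "real \<Rightarrow> real"
  assumes angle: "de_Sitter_angle n \<gamma> I \<theta>"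
begin

lemma angle_relation:
  assumes s: "s \<in> I"
  shows "cos (\<theta> s) \<noteq> 0" "cos (\<theta> s) * lambda_0 n \<gamma> s = sin (\<theta> s) * \<mu> s * sqrt (\<Delta> s)"
proof -
  show c: "cos (\<theta> s) \<noteq> 0" using angle s by (simp add: de_Sitter_angle_def)
  have "tan (\<theta> s) = lambda_0 n \<gamma> s / (\<mu> s * sqrt (\<Delta> s))" using angle s by (simp add: de_Sitter_angle_def)
  then show "cos (\<theta> s) * lambda_0 n \<gamma> s = sin (\<theta> s) * \<mu> s * sqrt (\<Delta> s)"
    using c \<mu>_nz \<Delta>_pos[OF s] s by (simp add: tan_def frac_eq_eq mult_ac)
qed

text \<open>Nondegeneracy: orthogonality of \<open>x\<close> to \<open>T'\<close> confines its products with \<open>N\<close> and \<open>E1\<close> to a multiple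
  \<open>r\<close> of \<open>(k\<^sub>g, -k\<^sub>n)\<close>. Orthogonality to \<open>DC\<close> and to \<open>T''\<close> then says that an orthogonal matrix with entries
  \<open>\<plusminus>cos \<theta>\<close> and \<open>sin \<theta>\<close> kills \<open>(r \<surd>\<Delta>, \<langle>x, E2\<rangle>)\<close>.\<close>

lemma dual_curve_DC:
  assumes s0: "s0 \<in> I"
  shows "dual_curve I T (DC n \<gamma> \<theta>) s0"
proof
  show "open I" "s0 \<in> I" "smooth_on T I" by (rule open_I s0 smooth_T)+
  have s\<theta>: "smooth_on \<theta> I" using angle by (simp add: de_Sitter_angle_def)
  have sq: "sqrt (\<Delta> s) \<noteq> 0" if "s \<in> I" for s
    using \<Delta>_pos[OF that] by (metis less_irrefl real_sqrt_eq_0_iff)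
  show "smooth_on (DC n \<gamma> \<theta>) I"
    unfolding DC_def[abs_def] DS_def
    by (intro smooth_on_add smooth_on_scaleR smooth_on_divide smooth_on_cos smooth_on_sin smooth_on_sqrt
        smooth_on_diff smooth_on_power smooth_kn smooth_kg smooth_N smooth_E1 smooth_E2 s\<theta> open_I sq \<Delta>_pos)
  show "mink (DC n \<gamma> \<theta> s) (DC n \<gamma> \<theta> s) = 1" if "s \<in> I" for s
    using mink_DS(1)[OF that] by (simp add: DC_def)
  show "mink (DC n \<gamma> \<theta> s) (curve_deriv j T s) = 0" if s: "s \<in> I" and j: "j < 3" for s j
  proof -
    have "sin (\<theta> s) * \<mu> s - cos (\<theta> s) / sqrt (\<Delta> s) * lambda_0 n \<gamma> s = 0"
      using angle_relation(2)[OF s] \<Delta>_pos[OF s] by (simp add: field_simps)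
    then have dd: "mink (curve_deriv 2 T s) (DC n \<gamma> \<theta> s) = 0"
      unfolding DC_def mink_DS(4)[OF s] .
    consider "j = 0" | "j = 1" | "j = 2" using j by linarith
    then have "mink (curve_deriv j T s) (DC n \<gamma> \<theta> s) = 0"
      using mink_DS(2,3)[OF s, of "\<theta> s"] dd by cases (simp_all add: DC_def)
    then show ?thesis using mink_commute by metis
  qed
  fix x assume xD: "mink x (DC n \<gamma> \<theta> s0) = 0" and xj: "\<And>j. j < 3 \<Longrightarrow> mink x (curve_deriv j T s0) = 0"
  have xT: "mink x (T s0) = 0" "mink x (curve_deriv 1 T s0) = 0" "mink x (curve_deriv 2 T s0) = 0"
    using xj[of 0] xj[of 1] xj[of 2] by simp_all
  define \<alpha> \<beta> \<delta> where "\<alpha> = mink x (N s0)" and "\<beta> = mink x (E1 s0)" and "\<delta> = mink x (E2 s0)"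
  have kn_nz: "kn s0 \<noteq> 0"
  proof
    assume "kn s0 = 0"
    with kn_kg s0 have "(kg s0)\<^sup>2 < 0" by force
    then show False by simp
  qed
  define r where "r = - \<beta> / kn s0"
  have "kn s0 * \<alpha> + kg s0 * \<beta> = 0"
    using xT(2) unfolding dT_eq[OF s0] by (simp add: mink_simps \<alpha>_def \<beta>_def)
  then have \<alpha>\<beta>: "\<alpha> = r * kg s0" "\<beta> = - r * kn s0" using kn_nz by (simp_all add: r_def field_simps)
  define q where "q = sqrt (\<Delta> s0)"
  have q: "q > 0" "q * q = \<Delta> s0" using \<Delta>_pos[OF s0] by (simp_all add: q_def)
  have xW: "mink x (W s0) = - r * q * q"
  proof -
    have "mink x (W s0) = kg s0 * \<alpha> + kn s0 * \<beta>" by (simp add: W_def mink_simps \<alpha>_def \<beta>_def)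
    also have "\<dots> = - r * \<Delta> s0" unfolding \<alpha>\<beta> by (simp add: power2_eq_square algebra_simps)
    finally show ?thesis unfolding q(2)[symmetric] by simp
  qed
  have eq1: "- cos (\<theta> s0) * (q * r) + sin (\<theta> s0) * \<delta> = 0"
    using xD q(1) by (simp add: DC_def DS_eq mink_simps xW \<delta>_def[symmetric] q_def[symmetric])
  have "mink x (curve_deriv 2 T s0) = - mink (curve_deriv 2 T s0) (N s0) * \<alpha> + mink (curve_deriv 2 T s0) (E1 s0) * \<beta>
      + mink (curve_deriv 2 T s0) (E2 s0) * \<delta>"
    using arg_cong[OF frame_expansion[OF s0, of "curve_deriv 2 T s0"], of "mink x"] xT(1)
    by (simp add: mink_simps \<alpha>_def \<beta>_def \<delta>_def)
  also have "\<dots> = - r * mink (curve_deriv 2 T s0) (W s0) + \<mu> s0 * \<delta>"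
    using mink_ddT(2)[OF s0] by (simp add: W_def mink_simps \<alpha>\<beta> algebra_simps)
  also have "\<dots> = r * lambda_0 n \<gamma> s0 + \<mu> s0 * \<delta>" using mink_ddT(1)[OF s0] by simp
  finally have "cos (\<theta> s0) * (r * lambda_0 n \<gamma> s0 + \<mu> s0 * \<delta>) = 0" using xT(3) by simp
  moreover have "cos (\<theta> s0) * (r * lambda_0 n \<gamma> s0 + \<mu> s0 * \<delta>) =
      \<mu> s0 * (sin (\<theta> s0) * (q * r) + cos (\<theta> s0) * \<delta>)"
    using angle_relation(2)[OF s0] unfolding q_def[symmetric] by algebra
  ultimately have eq2: "sin (\<theta> s0) * (q * r) + cos (\<theta> s0) * \<delta> = 0" using \<mu>_nz s0 by simp
  have sc: "(sin (\<theta> s0))\<^sup>2 + (cos (\<theta> s0))\<^sup>2 = 1" by simp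
  have \<delta>0: "\<delta> = 0" using eq1 eq2 sc by algebra
  have "q * r = 0" using eq1 eq2 sc by algebra
  then have "r = 0" using q(1) by simp
  then have "\<alpha> = 0" "\<beta> = 0" by (simp_all add: \<alpha>\<beta>)
  then show "x = 0"
    using pseudo_orthonormal_complete[OF frame(1-10)[OF s0]] \<delta>0 xT(1) unfolding \<alpha>_def \<beta>_def \<delta>_def by blast
qed

text \<open>The assumption determines \<open>tan \<phi>\<close>, so \<open>\<phi>\<close> and \<open>\<theta>\<close> agree modulo \<open>\<pi>\<close>.\<close>

lemma DS_eq_DC_up_to_sign:
  assumes s: "s \<in> I" and "mink (curve_deriv 2 T s) (DS n \<gamma> s \<phi>) = 0"
  obtains \<epsilon> where "\<epsilon> \<noteq> 0" "DS n \<gamma> s \<phi> = \<epsilon> *\<^sub>R DC n \<gamma> \<theta> s"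
proof
  let ?\<theta> = "\<theta> s"
  let ?\<epsilon> = "cos (\<phi> - ?\<theta>)"
  have "sin \<phi> * \<mu> s * sqrt (\<Delta> s) = cos \<phi> * lambda_0 n \<gamma> s"
    using assms(2) \<Delta>_pos[OF s] unfolding mink_DS(4)[OF s] by (simp add: field_simps)
  then have "(\<mu> s * sqrt (\<Delta> s)) * (sin \<phi> * cos ?\<theta> - cos \<phi> * sin ?\<theta>) = 0"
    using angle_relation(2)[OF s] by algebra
  then have s0: "sin (\<phi> - ?\<theta>) = 0" using \<mu>_nz \<Delta>_pos[OF s] s by (simp add: sin_diff)
  show "?\<epsilon> \<noteq> 0" using s0 sin_cos_squared_add[of "\<phi> - ?\<theta>"] by auto
  have "cos \<phi> = ?\<epsilon> * cos ?\<theta>" "sin \<phi> = ?\<epsilon> * sin ?\<theta>"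
    using cos_add[of "\<phi> - ?\<theta>" ?\<theta>] sin_add[of "\<phi> - ?\<theta>" ?\<theta>] s0 by simp_all
  then show "DS n \<gamma> s \<phi> = ?\<epsilon> *\<^sub>R DC n \<gamma> \<theta> s"
    by (simp add: DC_def DS_eq scaleR_right_distrib)
qed

end

lemma deriv_iterate_h_t: "s \<in> I \<Longrightarrow> (deriv ^^ i) (h_t \<gamma> v) s = mink (curve_deriv i T s) v"
  unfolding h_t_def[abs_def] by (rule deriv_iterate_mink[OF smooth_T open_I])

lemma contact_of_order_Suc_iff:
  assumes s: "s \<in> I"
  shows "contact_of_order (Suc k) \<gamma> v (mink (\<gamma> s) v) s \<longleftrightarrow> A_singularity k (h_t \<gamma> v) s"
proof -
  let ?g = "\<lambda>x. mink (\<gamma> x) v - mink (\<gamma> s) v"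
  have "deriv ?g x = h_t \<gamma> v x" if "x \<in> I" for x
  proof (rule DERIV_imp_deriv)
    have "((\<lambda>x. mink (\<gamma> x) v) has_real_derivative h_t \<gamma> v x) (at x)"
      using mink_has_real_derivative[OF smooth_on_has_vector_derivative[OF smooth_\<gamma> open_I that] has_vector_derivative_const[of v]]
      by (simp add: h_t_def tangent_def mink.zero_right)
    then show "(?g has_real_derivative h_t \<gamma> v x) (at x)" by (auto intro!: derivative_eq_intros)
  qed
  then have *: "(deriv ^^ Suc i) ?g s = (deriv ^^ i) (h_t \<gamma> v) s" for i
    unfolding funpow_Suc_right comp_def by (rule deriv_iterate_cong[OF open_I s])
  have split: "(\<forall>i\<le>Suc k. P i) \<longleftrightarrow> P 0 \<and> (\<forall>i\<le>k. P (Suc i))" for P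
    by (metis Suc_le_mono le0 not0_implies_Suc)
  show ?thesis
    unfolding contact_of_order_def A_singularity_def split * by simp
qed

end

section \<open>Contact with slice surfaces and the de Sitter curve\<close>

theorem proposition5p7:
  fixes U :: "(real^3) set" and X :: "real^3 \<Rightarrow> real^4" and n :: "real^4 \<Rightarrow> real^4"
    and I :: "real set" and \<gamma>b :: "real \<Rightarrow> real^3" and \<gamma> :: "real \<Rightarrow> real^4"
    and \<theta> :: "real \<Rightarrow> real" and s0 \<theta>0 c :: real and v0 :: "real^4"
  assumes "spacelike_hypersurface U X" and "future_unit_normal U X n"
    and "open I" and "is_interval I"
    and "smooth_on \<gamma>b I" and "\<gamma>b ` I \<subseteq> U" and "\<forall>s\<in>I. vector_derivative \<gamma>b (at s) \<noteq> 0"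
    and "\<forall>s\<in>I. \<gamma> s = X (\<gamma>b s)"
    and "\<forall>s\<in>I. mink_norm (tangent \<gamma> s) = 1"
    and "\<forall>s\<in>I. k_g n \<gamma> s \<noteq> 0"
    and "\<forall>s\<in>I. k_n n \<gamma> s * tau_2 n \<gamma> s + k_g n \<gamma> s * tau_g n \<gamma> s \<noteq> 0"
    and "\<forall>s\<in>I. (k_n n \<gamma> s)\<^sup>2 > (k_g n \<gamma> s)\<^sup>2"
    and "\<exists>s\<in>I. rho n \<gamma> s \<noteq> 0"
    and "de_Sitter_angle n \<gamma> I \<theta>"
    and "s0 \<in> I" and "v0 = DS n \<gamma> s0 \<theta>0" and "c = mink (\<gamma> s0) v0"
  shows "((\<exists>k\<ge>3. contact_of_order k \<gamma> v0 c s0) \<longleftrightarrow> (\<exists>k\<ge>2. A_singularity k (h_t \<gamma> v0) s0))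
       \<and> (contact_of_order 3 \<gamma> v0 c s0 \<longrightarrow>
            (\<exists>w. w \<noteq> 0 \<and> locally_diffeomorphic_at (DC n \<gamma> \<theta>) s0 (span {w})))
       \<and> (contact_of_order 4 \<gamma> v0 c s0 \<longleftrightarrow> A_singularity 3 (h_t \<gamma> v0) s0)
       \<and> (contact_of_order 4 \<gamma> v0 c s0 \<and> lambda_0 n \<gamma> s0 \<noteq> 0 \<longrightarrow>
            locally_diffeomorphic_at (DC n \<gamma> \<theta>) s0 cusp_234)"
proof -
  interpret hypersurface_curve U X n I \<gamma>b \<gamma>
    by unfold_locales (use assms in auto)
  interpret dual_curve I "tangent \<gamma>" "DC n \<gamma> \<theta>" s0
    by (rule dual_curve_DC[OF assms(14,15)])
  have contact: "contact_of_order (Suc k) \<gamma> v0 c s0 \<longleftrightarrow> A_singularity k (h_t \<gamma> v0) s0" for k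
    using contact_of_order_Suc_iff[OF assms(15)] assms(17) by simp
  have contact3: "contact_of_order 3 \<gamma> v0 c s0 \<longleftrightarrow> A_singularity 2 (h_t \<gamma> v0) s0"
    and contact4: "contact_of_order 4 \<gamma> v0 c s0 \<longleftrightarrow> A_singularity 3 (h_t \<gamma> v0) s0"
    using contact[of 2] contact[of 3] by simp_all
  \<comment> \<open>Once the second derivative of \<open>h\<close> vanishes, \<open>v0\<close> may be replaced by \<open>DC s0\<close>.\<close>
  have m: "m 0 j s0 = 0 \<longleftrightarrow> mink (curve_deriv j (tangent \<gamma>) s0) v0 = 0"
    if d: "mink (curve_deriv 2 (tangent \<gamma>) s0) v0 = 0" for j
  proof -
    obtain \<epsilon> where "\<epsilon> \<noteq> 0" "v0 = \<epsilon> *\<^sub>R DC n \<gamma> \<theta> s0"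
      using DS_eq_DC_up_to_sign[OF assms(14,15)] d assms(16) by metis
    then show ?thesis by (simp add: m_def mink_simps mink_commute)
  qed
  have A: "A_singularity k (h_t \<gamma> v0) s0 \<longleftrightarrow>
      (\<forall>i\<le>k. mink (curve_deriv i (tangent \<gamma>) s0) v0 = 0) \<and> mink (curve_deriv (Suc k) (tangent \<gamma>) s0) v0 \<noteq> 0" for k
    unfolding A_singularity_def by (simp only: deriv_iterate_h_t[OF assms(15)])
  have "(\<exists>k\<ge>3. contact_of_order k \<gamma> v0 c s0) \<longleftrightarrow> (\<exists>k\<ge>2. A_singularity k (h_t \<gamma> v0) s0)"
  proof
    assume "\<exists>k\<ge>3. contact_of_order k \<gamma> v0 c s0"
    then obtain k where "k \<ge> 3" "contact_of_order k \<gamma> v0 c s0" by blast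
    then show "\<exists>k\<ge>2. A_singularity k (h_t \<gamma> v0) s0"
      using contact[of "k - 1"] by (intro exI[of _ "k - 1"]) auto
  next
    assume "\<exists>k\<ge>2. A_singularity k (h_t \<gamma> v0) s0"
    then obtain k where "k \<ge> 2" "A_singularity k (h_t \<gamma> v0) s0" by blast
    then show "\<exists>k\<ge>3. contact_of_order k \<gamma> v0 c s0"
      using contact[of k] by (intro exI[of _ "Suc k"]) auto
  qed
  moreover have "locally_diffeomorphic_at (DC n \<gamma> \<theta>) s0 (span {axis 3 1})"
    if "contact_of_order 3 \<gamma> v0 c s0"
  proof (rule regular_germ)
    have "A_singularity 2 (h_t \<gamma> v0) s0" using that contact3 by simp
    then show "m 0 3 s0 \<noteq> 0" using m[of 3] unfolding A by (simp add: numeral_3_eq_3)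
  qed
  moreover have "locally_diffeomorphic_at (DC n \<gamma> \<theta>) s0 cusp_234" if "contact_of_order 4 \<gamma> v0 c s0"
  proof (rule cusp_germ)
    have a: "A_singularity 3 (h_t \<gamma> v0) s0" using that contact4 by simp
    then show "m 0 3 s0 = 0" using m[of 3] unfolding A by simp
    have "mink (curve_deriv 2 (tangent \<gamma>) s0) v0 = 0" "mink (curve_deriv 4 (tangent \<gamma>) s0) v0 \<noteq> 0"
      using a unfolding A by (simp_all)
    then show "m 0 4 s0 \<noteq> 0" using m[of 4] by simp
  qed
  moreover have "axis 3 1 \<noteq> (0 :: real^3)" by (simp add: axis_eq_0_iff)
  ultimately show ?thesis using contact4 by blast
qed

end
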